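(* Let $\sigma$ be an irreducible incommensurable normalized multiscale substitution scheme in $\mathbb{R}^d$, and let $\mathcal{S}\in\mathbb{X}_\sigma^F$ be a stationary tiling. Let $\mathcal{P}$ be a patch in $\mathcal{S}$ and let $I$ be a bounded interval that contains $1$ and a left neighborhood of $1$. Then for every van Hove sequence $(A_q)_{q\ge1}$ in $\mathbb{R}^d$ the limit $$\mathrm{freq}(\mathcal{P},I,\mathcal{S}):=\lim_{q\to\infty}\frac{L_{\mathcal{P},I}(A_q+h,\mathcal{S})}{\mathrm{vol}(A_q)}$$ exists uniformly in $h\in\mathbb{R}^d$, and is positive.
   Context: Schemes. A tile in $\mathbb{R}^d$ is a bounded Lebesgue measurable set $T$ of positive measure $\mathrm{vol}\,T$ whose boundary has measure zero. A tessellation of $U\subset\mathbb{R}^d$ is a collection of tiles with pairwise disjoint interiors and union $U$; it is called a patch if $U$ is bounded ($U$ is then the support, $\mathrm{supp}$, of the patch) and a tiling if $U=\mathbb{R}^d$. A multiscale substitution scheme $\sigma=(\tau_\sigma,\varrho_\sigma)$ consists of a finite list of prototiles $\tau_\sigma=(T_1,\dots,T_n)$ and, for each $i$, a tessellation $\varrho_\sigma(T_i)$ of $T_i$ all of whose tiles are translates of rescaled prototiles $\alpha T_j$, with all $\alpha\in(0,1)$. A translate of $\alpha T_j$, $\alpha>0$, is a tile of type $j$ and scale $\alpha$. Standing assumptions: $\sigma$ is normalized, i.e. $\mathrm{vol}\,T_i=1$ for all $i$; distinct prototiles are geometrically different ($T_i$ is not a rescaled copy of $T_j$ for $i\ne j$),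 so the type of a tile is determined by the tile. Substitution semi-flow. For $t\ge 0$, $F_t(T_i)$ is the patch supported on $e^tT_i$ obtained by starting with $e^tT_i$ and repeatedly substituting (according to the rescaled rule $\varrho_\sigma$) every tile of volume $>1$, until all tiles have volume $\le 1$. In the same way $F_t$ is defined on every tile $T$ that is a translate of $\alpha T_i$ with $0<\alpha\le 1$ ($F_t(T)$ is supported on $e^tT$), on patches of such tiles, and on tilings by such tiles (tile by tile). $\sigma$ is irreducible if for all $i,j$ there is $t>0$ such that $F_t(T_i)$ contains a tile of type $j$. $\sigma$ is incommensurable if there are $i,j$ and $t_1,t_2>0$ with $t_1\notin\mathbb{Q}t_2$ such that $F_{t_1}(T_i)$ contains a tile of type $i$ and unit volume and $F_{t_2}(T_j)$ contains a tile of type $j$ and unit volume. Tiling space. Position each $T_i$ so that the origin is an interior point. Let $\mathscr{P}_\sigma=\{F_t(T_i): t\ge0,\ i=1,\dots,n\}$. Identify a patch or tiling with the closed set which is the union of the boundaries of its tiles. On closed subsets of $\mathbb{R}^d$ use the metric $D(A_1,A_2)=\inf(\{r>0: A_1\cap B(0,1/r)\subset A_2^{+r},\ A_2\cap B(0,1/r)\subset A_1^{+r}\}\cup\{1\})$, where $A^{+r}=\{x:\mathrm{dist}(x,A)\le r\}$ and $B(x,R)$ is the open Euclidean ball. $\mathbb{X}^F_\sigma$ is the set of all tilings $\mathcal{T}$ of $\mathbb{R}^d$ such that every sub-patch of $\mathcal{T}$ is a limit, with respect to $D$, of translated sub-patches of elements of $\mathscr{P}_\sigma$. A stationary tiling is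 a tiling $\mathcal{S}\in\mathbb{X}_\sigma^F$ of the form $\mathcal{S}=\bigcup_{k\ge0}F_{a+ks}(T_i)$ with $a\ge0$ and $s>0$ such that $F_s(T_i)$ contains a tile of type $i$ and unit volume, where $T_i$ is positioned so that the origin is an interior point and the patches $F_{a+ks}(T_i)$, $k\ge0$, are nested (each a sub-patch of the next); it satisfies $F_s(\mathcal{S})=\mathcal{S}$. Counting. A sequence $(A_q)_{q\ge1}$ of bounded measurable subsets of $\mathbb{R}^d$ (of positive volume) is van Hove if $\lim_{q\to\infty}\mathrm{vol}((\partial A_q)^{+r})/\mathrm{vol}(A_q)=0$ for all $r>0$. For a patch $\mathcal{P}$ (non-empty, finite), an interval $I$ and a bounded set $A\subset\mathbb{R}^d$, $$L_{\mathcal{P},I}(A,\mathcal{S}):=\#\{g\in\mathbb{R}^d:\ \exists\,\alpha\in I,\ \alpha>0,\text{ such that } g+\alpha\mathcal{P}\subset\mathcal{S}\text{ and } g+\mathrm{supp}(\alpha\mathcal{P})\subset A\},$$ where $g+\alpha\mathcal{P}\subset\mathcal{S}$ means that every tile of $g+\alpha\mathcal{P}$ is a tile of $\mathcal{S}$.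
   Formalization: The tessellation of each prototile given by the substitution rule is required to be finite; with infinitely many tiles in a rule, and an interval I reaching down to 0, the counts of copies can be infinite and the limit need not exist. *)

theory Defs
  imports "HOL-Analysis.Analysis"
begin

abbreviation vol :: "'a::euclidean_space set \<Rightarrow> real" where
  "vol A \<equiv> measure lebesgue A"

definition copy :: "real \<Rightarrow> 'a::euclidean_space \<Rightarrow> 'a set \<Rightarrow> 'a set" where
  "copy \<alpha> g T = (\<lambda>x. g + \<alpha> *\<^sub>R x) ` T"

definition tile :: "'a::euclidean_space set \<Rightarrow> bool" where
  "tile T \<longleftrightarrow> bounded T \<and> T \<in> sets lebesgue \<and> vol T > 0 \<and> frontier T \<in> null_sets lebesgue"

definition tessellation :: "'a::euclidean_space set \<Rightarrow> 'a set set \<Rightarrow> bool" where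
  "tessellation U C \<longleftrightarrow>
     (\<forall>T\<in>C. tile T) \<and> pairwise (\<lambda>T T'. interior T \<inter> interior T' = {}) C \<and> \<Union>C = U"

definition patch :: "'a::euclidean_space set set \<Rightarrow> bool" where
  "patch P \<longleftrightarrow> (\<exists>U. bounded U \<and> tessellation U P)"

definition tiling :: "'a::euclidean_space set set \<Rightarrow> bool" where
  "tiling S \<longleftrightarrow> tessellation UNIV S"

text \<open>The type of a prototile is its index in the list, counted from 0; the values of \<open>rule\<close>
  at other indices play no role.\<close>

record 'a scheme =
  prototiles :: "'a set list"
  rule :: "nat \<Rightarrow> 'a set set"

abbreviation proto :: "'a scheme \<Rightarrow> nat \<Rightarrow> 'a set" where
  "proto \<sigma> i \<equiv> prototiles \<sigma> ! i"

abbreviation types :: "'a scheme \<Rightarrow> nat set" where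
  "types \<sigma> \<equiv> {..<length (prototiles \<sigma>)}"

definition has_type :: "'a::euclidean_space scheme \<Rightarrow> nat \<Rightarrow> 'a set \<Rightarrow> bool" where
  "has_type \<sigma> j V \<longleftrightarrow> (\<exists>\<alpha>>0. \<exists>g. V = copy \<alpha> g (proto \<sigma> j))"

text \<open>The substitution rules are finite: otherwise the tiles of a bounded patch could have
  arbitrarily small scales, unions of boundaries need not be closed, and patch counts in bounded
  sets may be infinite.  The last conjunct says that distinct prototiles are geometrically
  different, also up to translation, so that a tile (as a set) determines its type, its scale and
  its position.\<close>

definition multiscale_scheme :: "'a::euclidean_space scheme \<Rightarrow> bool" where
  "multiscale_scheme \<sigma> \<longleftrightarrow>
     (\<forall>i\<in>types \<sigma>. tile (proto \<sigma> i)) \<and>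
     (\<forall>i\<in>types \<sigma>. finite (rule \<sigma> i) \<and> tessellation (proto \<sigma> i) (rule \<sigma> i) \<and>
        (\<forall>U\<in>rule \<sigma> i. \<exists>j\<in>types \<sigma>. \<exists>\<alpha>\<in>{0<..<1}. \<exists>g. U = copy \<alpha> g (proto \<sigma> j))) \<and>
     (\<forall>i\<in>types \<sigma>. \<forall>j\<in>types \<sigma>. i \<noteq> j \<longrightarrow> \<not> has_type \<sigma> j (proto \<sigma> i))"

definition normalized :: "'a::euclidean_space scheme \<Rightarrow> bool" where
  "normalized \<sigma> \<longleftrightarrow> (\<forall>i\<in>types \<sigma>. vol (proto \<sigma> i) = 1)"

text \<open>All tiles that occur at some stage when one starts with \<open>T\<^sub>0\<close> and repeatedly substitutes
  every tile of volume \<open>> 1\<close>.  Those of volume at most 1 are never substituted, so they are the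
  tiles of the final patch.\<close>

inductive_set stages :: "'a::euclidean_space scheme \<Rightarrow> 'a set \<Rightarrow> 'a set set"
  for \<sigma> :: "'a::euclidean_space scheme" and T\<^sub>0 :: "'a set" where
  start: "T\<^sub>0 \<in> stages \<sigma> T\<^sub>0"
| substitute: "copy \<alpha> g (proto \<sigma> j) \<in> stages \<sigma> T\<^sub>0 \<Longrightarrow> vol (copy \<alpha> g (proto \<sigma> j)) > 1 \<Longrightarrow>
    j \<in> types \<sigma> \<Longrightarrow> \<alpha> > 0 \<Longrightarrow> W \<in> rule \<sigma> j \<Longrightarrow> copy \<alpha> g W \<in> stages \<sigma> T\<^sub>0"

text \<open>The patch \<open>F\<^sub>t(T)\<close>, for \<open>t \<ge> 0\<close> and a translate \<open>T\<close> of \<open>\<alpha> T\<^sub>i\<close> with \<open>0 < \<alpha> \<le> 1\<close>.\<close>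

definition flow :: "'a::euclidean_space scheme \<Rightarrow> real \<Rightarrow> 'a set \<Rightarrow> 'a set set" where
  "flow \<sigma> t T = {V \<in> stages \<sigma> (copy (exp t) 0 T). vol V \<le> 1}"

definition irreducible_scheme :: "'a::euclidean_space scheme \<Rightarrow> bool" where
  "irreducible_scheme \<sigma> \<longleftrightarrow>
     (\<forall>i\<in>types \<sigma>. \<forall>j\<in>types \<sigma>. \<exists>t>0. \<exists>V\<in>flow \<sigma> t (proto \<sigma> i). has_type \<sigma> j V)"

definition returns :: "'a::euclidean_space scheme \<Rightarrow> nat \<Rightarrow> real \<Rightarrow> bool" where
  "returns \<sigma> i t \<longleftrightarrow> (\<exists>V\<in>flow \<sigma> t (proto \<sigma> i). has_type \<sigma> i V \<and> vol V = 1)"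

definition incommensurable :: "'a::euclidean_space scheme \<Rightarrow> bool" where
  "incommensurable \<sigma> \<longleftrightarrow>
     (\<exists>i\<in>types \<sigma>. \<exists>j\<in>types \<sigma>. \<exists>t1>0. \<exists>t2>0.
        t1 \<notin> {q * t2 |q. q \<in> \<rat>} \<and> returns \<sigma> i t1 \<and> returns \<sigma> j t2)"

text \<open>The prototiles are not assumed to contain the origin; positioning \<open>T\<^sub>i\<close> with the origin in
  its interior means replacing it by \<open>T\<^sub>i - x\<close> for some interior point \<open>x\<close> of \<open>T\<^sub>i\<close>.\<close>

definition positioned :: "'a::euclidean_space scheme \<Rightarrow> nat \<Rightarrow> 'a set \<Rightarrow> bool" where
  "positioned \<sigma> i T \<longleftrightarrow> (\<exists>x\<in>interior (proto \<sigma> i). T = copy 1 (- x) (proto \<sigma> i))"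

text \<open>All admissible positions are allowed at once.  A change of position only translates
  \<open>F\<^sub>t(T\<^sub>i)\<close>, which does not affect the tiling space below.\<close>

definition generating_patches :: "'a::euclidean_space scheme \<Rightarrow> 'a set set set" where
  "generating_patches \<sigma> = {flow \<sigma> t T |t i T. t \<ge> 0 \<and> i \<in> types \<sigma> \<and> positioned \<sigma> i T}"

text \<open>The nonemptiness condition is needed because \<open>infdist x {} = 0\<close> in the library, whereas no
  point is close to the empty set.\<close>

definition thicken :: "'a::euclidean_space set \<Rightarrow> real \<Rightarrow> 'a set" where
  "thicken A r = {x. A \<noteq> {} \<and> infdist x A \<le> r}"

definition Dmetric :: "'a::euclidean_space set \<Rightarrow> 'a set \<Rightarrow> real" where
  "Dmetric A1 A2 = Inf ({r. r > 0 \<and> A1 \<inter> ball 0 (1 / r) \<subseteq> thicken A2 r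
                              \<and> A2 \<inter> ball 0 (1 / r) \<subseteq> thicken A1 r} \<union> {1})"

definition skeleton :: "'a::euclidean_space set set \<Rightarrow> 'a set" where
  "skeleton P = (\<Union>T\<in>P. frontier T)"

definition subpatch :: "'a::euclidean_space set set \<Rightarrow> 'a set set \<Rightarrow> bool" where
  "subpatch Q C \<longleftrightarrow> Q \<subseteq> C \<and> patch Q"

definition tiling_space :: "'a::euclidean_space scheme \<Rightarrow> 'a set set set" where
  "tiling_space \<sigma> = {S. tiling S \<and>
     (\<forall>Q. subpatch Q S \<longrightarrow>
        (\<exists>R. (\<forall>k::nat. \<exists>P\<in>generating_patches \<sigma>. \<exists>Q' g. subpatch Q' P \<and> R k = copy 1 g ` Q') \<and>
             (\<lambda>k. Dmetric (skeleton (R k)) (skeleton Q)) \<longlonglongrightarrow> 0))}"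

definition stationary :: "'a::euclidean_space scheme \<Rightarrow> 'a set set \<Rightarrow> bool" where
  "stationary \<sigma> S \<longleftrightarrow> S \<in> tiling_space \<sigma> \<and>
     (\<exists>i\<in>types \<sigma>. \<exists>T a s. positioned \<sigma> i T \<and> a \<ge> 0 \<and> s > 0 \<and> returns \<sigma> i s \<and>
        (\<forall>k::nat. flow \<sigma> (a + real k * s) T \<subseteq> flow \<sigma> (a + real (Suc k) * s) T) \<and>
        S = (\<Union>k::nat. flow \<sigma> (a + real k * s) T))"

definition van_Hove :: "(nat \<Rightarrow> 'a::euclidean_space set) \<Rightarrow> bool" where
  "van_Hove A \<longleftrightarrow>
     (\<forall>q\<ge>1. bounded (A q) \<and> A q \<in> sets lebesgue \<and> vol (A q) > 0) \<and>
     (\<forall>r>0. (\<lambda>q. vol (thicken (frontier (A q)) r) / vol (A q)) \<longlonglongrightarrow> 0)"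

text \<open>For a stationary \<open>S\<close>, nonempty \<open>P\<close> and bounded \<open>A\<close> the set of positions \<open>g\<close> is finite, since
  the tiles of \<open>S\<close> have volumes bounded away from 0.\<close>

definition count_copies ::
  "'a::euclidean_space set set \<Rightarrow> real set \<Rightarrow> 'a set \<Rightarrow> 'a set set \<Rightarrow> nat" where
  "count_copies P I A S =
     card {g. \<exists>\<alpha>\<in>I. \<alpha> > 0 \<and> copy \<alpha> g ` P \<subseteq> S \<and> copy \<alpha> g (\<Union>P) \<subseteq> A}"

end

theory Submission
  imports Defs
begin

text \<open>
  The frequency is the limiting density of copies of \<open>P\<close> in a single large tile.  For a scaled
  tile \<open>X\<close>, cut by the substitution into tiles of volume at most 1, let \<open>num_positions X\<close> be the
  number of positions of copies of \<open>P\<close> that lie well inside \<open>X\<close>.  Three properties force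
  \<open>num_positions X / vol X\<close> to converge to a constant, whatever the type of \<open>X\<close>, as
  \<open>vol X\<close> tends to infinity (\<open>density_limit\<close>).

  \<^item> It is superadditive over the children of a tile.  So if its density comes close to its lower limit
    \<open>m\<close> at some tile, it is close to \<open>m\<close> at all descendants that are not much smaller
    (\<open>minimum_principle\<close>): their mean is at most the density of the tile, and none is much below
    \<open>m\<close>.  By irreducibility and incommensurability the descendants of one tile have all types and
    a nearly dense set of sizes (\<open>lengths_eventually_dense\<close>): two loops of lengths \<open>a\<close>, \<open>b\<close>
    with irrational ratio at one type give all lengths \<open>p a + q b\<close>.

  \<^item> Its density varies slowly with the size of the tile (\<open>density_oscillation\<close>).  Inflating a tile
    destroys only copies of \<open>P\<close> that contain a tile about to be substituted, or whose scale is about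
    to leave \<open>I\<close>.  Both fix the volume of a tile up to a factor close to 1, and such tiles are rare
    (\<open>window_rare\<close>).  This follows from the minimum principle again: otherwise the tiles
    of nearly that volume would be frequent at quadratically many sizes \<open>p a + q b\<close>, \<open>p, q \<le> n\<close>,
    whereas a point has only linearly many ancestors in the corresponding range.

  \<^item> It is nearly additive over a partition into tiles of a fixed large size, because the copies that
    cross the boundaries of these tiles are few (\<open>positions_in_union\<close>, \<open>boundary_rare\<close>).

  By the first two, the density is close to \<open>m\<close> for all tiles of a whole window of sizes, and by the
  third for all larger tiles.  It is positive because a copy of \<open>P\<close> survives a slight
  shrinking of the tile around it, and all large tiles have such shrunken tiles as descendants
  (\<open>large_tiles_have_positions\<close>).

  Finally \<open>S\<close> is an increasing union of patches of large tiles, each of which is partitioned into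
  tiles of any prescribed size.  A region \<open>A + h\<close> is, up to a neighbourhood of its boundary, a union
  of such tiles, and each of them contains about \<open>m\<close> positions per volume.  The error
  depends on the volume of the neighbourhood only, so the convergence is uniform in \<open>h\<close>
  (\<open>count_copies_estimate\<close>).
\<close>

section \<open>Scaled copies\<close>

lemma copy_copy: "copy a g (copy b h T) = copy (a * b) (g + a *\<^sub>R h) T"
  by (auto simp: copy_def image_image algebra_simps)

lemma copy_id [simp]: "copy 1 0 T = T"
  by (simp add: copy_def)

lemma copy_eq_image: "copy a g T = (+) g ` ((*\<^sub>R) a ` T)"
  by (auto simp: copy_def image_image)

lemma copy_mono: "T \<subseteq> U \<Longrightarrow> copy a g T \<subseteq> copy a g U"
  by (auto simp: copy_def)

lemma copy_Union: "copy a g (\<Union>C) = \<Union>(copy a g ` C)"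
  by (auto simp: copy_def)

lemma inj_affine: "a > 0 \<Longrightarrow> inj (\<lambda>x::'a::euclidean_space. g + a *\<^sub>R x)"
  by (auto simp: inj_on_def)

lemma copy_Int: "a > 0 \<Longrightarrow> copy a g (T \<inter> U) = copy a g T \<inter> copy a g U"
  unfolding copy_def by (rule image_Int[OF inj_affine])

lemma inj_copy: "a > 0 \<Longrightarrow> inj (copy a g)"
  unfolding copy_def by (intro inj_onI) (simp add: inj_image_eq_iff[OF inj_affine])

lemma interior_copy: "a > 0 \<Longrightarrow> interior (copy a g T) = copy a g (interior T)"
  by (simp add: copy_eq_image interior_translation interior_injective_linear_image inj_on_def)

lemma frontier_copy: "a > 0 \<Longrightarrow> frontier (copy a g T) = copy a g (frontier T)"
  unfolding frontier_def
  by (simp add: interior_copy)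
     (simp add: copy_eq_image closure_translation flip: closure_scaleR
       image_set_diff[OF inj_on_subset[OF _ subset_UNIV]],
      subst image_set_diff, simp add: inj_on_def, subst image_set_diff, auto simp: inj_on_def)

lemma bounded_copy: "bounded T \<Longrightarrow> bounded (copy a g T)"
  unfolding copy_eq_image by (intro bounded_translation bounded_scaling)

lemma vol_copy: "a > 0 \<Longrightarrow> vol (copy a (g::'a::euclidean_space) T) = a ^ DIM('a) * vol T"
  using measure_lebesgue_affine[of a g T] by (simp add: copy_def add.commute)

lemma lebesgue_sets_copy:
  assumes "a > 0" "T \<in> sets lebesgue" shows "copy a (g::'a::euclidean_space) T \<in> sets lebesgue"
proof -
  have "(*\<^sub>R) a ` T \<in> sets lebesgue"
  proof -
    have "(*\<^sub>R) a ` T = (*\<^sub>R) (1 / a) -` T \<inter> space lebesgue"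
      using assms(1) by (auto simp: image_iff intro!: bexI[of _ "(1 / a) *\<^sub>R _"])
    then show ?thesis using measurable_sets[OF lebesgue_measurable_scaling assms(2), of "1 / a"] by simp
  qed
  then show ?thesis unfolding copy_eq_image by (rule lebesgue_sets_translation)
qed

lemma null_sets_copy:
  assumes "a > 0" "T \<in> null_sets lebesgue" shows "copy a (g::'a::euclidean_space) T \<in> null_sets lebesgue"
proof -
  have "copy a g T \<in> sets lebesgue" using assms lebesgue_sets_copy by blast
  moreover have "emeasure lebesgue (copy a g T) = 0"
    using emeasure_lebesgue_affine[of a g T] assms(2) by (simp add: copy_def add.commute null_sets_def)
  ultimately show ?thesis by (simp add: null_sets_def)
qed

lemma tile_copy: "a > 0 \<Longrightarrow> tile T \<Longrightarrow> tile (copy a g T)"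
  by (auto simp: tile_def bounded_copy lebesgue_sets_copy vol_copy frontier_copy null_sets_copy)

lemma tile_lmeasurable: "tile T \<Longrightarrow> T \<in> lmeasurable"
  by (simp add: tile_def bounded_set_imp_lmeasurable)

lemma tile_nonempty: "tile T \<Longrightarrow> T \<noteq> {}"
  by (auto simp: tile_def)

lemma vol_interior_tile:
  assumes "tile T" shows "vol (interior T) = vol T"
proof -
  have "sym_diff (interior T) T \<subseteq> frontier T"
    using interior_subset[of T] closure_subset[of T] by (auto simp: frontier_def)
  then have "negligible (sym_diff (interior T) T)"
    using assms negligible_subset[of "frontier T"] by (simp add: tile_def negligible_iff_null_sets)
  then have "negligible (sym_diff T (interior T))" by (simp add: Un_commute)
  then show ?thesis using measure_negligible_symdiff[OF tile_lmeasurable[OF assms]] by blast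
qed

lemma interior_tile_nonempty: "tile T \<Longrightarrow> interior T \<noteq> {}"
  using vol_interior_tile[of T] by (auto simp: tile_def)

text \<open>The volume recovers the scale, and a bounded set is invariant under no nonzero translation.\<close>

lemma copy_eqD:
  assumes "tile T" "a > 0" "b > 0" and eq: "copy a (g::'a::euclidean_space) T = copy b h T"
  shows "a = b \<and> g = h"
proof -
  have T: "bounded T" "T \<noteq> {}" "vol T > 0" using assms(1) tile_nonempty by (auto simp: tile_def)
  have "a ^ DIM('a) * vol T = b ^ DIM('a) * vol T"
    using eq vol_copy assms by metis
  then have "a ^ DIM('a) = b ^ DIM('a)" using T by simp
  then have ab: "a = b" using assms(2,3) by (metis DIM_positive less_imp_le power_eq_imp_eq_base)
  define f where "f x = x \<bullet> (g - h)" for x :: 'a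
  define M where "M c = Sup (f ` copy a c T)" for c
  have bdd: "bdd_above (f ` ((*\<^sub>R) a ` T))"
    unfolding f_def image_image
  proof -
    obtain B where B: "\<And>x. x \<in> T \<Longrightarrow> norm x \<le> B" using T(1) by (auto simp: bounded_iff)
    have "a *\<^sub>R x \<bullet> (g - h) \<le> a * (B * norm (g - h))" if "x \<in> T" for x
    proof -
      have "x \<bullet> (g - h) \<le> norm x * norm (g - h)" by (rule norm_cauchy_schwarz)
      also have "\<dots> \<le> B * norm (g - h)" using B[OF that] by (simp add: mult_right_mono)
      finally show ?thesis using assms(2) by (simp add: mult_left_mono)
    qed
    then show "bdd_above ((\<lambda>x. a *\<^sub>R x \<bullet> (g - h)) ` T)" by (auto intro!: bdd_aboveI)
  qed
  have M: "M c = f c + Sup (f ` ((*\<^sub>R) a ` T))" for c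
  proof -
    have "f ` copy a c T = (+) (f c) ` (f ` ((*\<^sub>R) a ` T))"
      by (auto simp: copy_def f_def image_image inner_add_left)
    moreover have "(SUP x\<in>f ` ((*\<^sub>R) a ` T). f c + x) = f c + Sup (f ` ((*\<^sub>R) a ` T))"
      using Sup_add_eq[OF bdd, of "f c"] T by (simp add: image_image)
    ultimately show ?thesis by (simp add: M_def)
  qed
  have "M g = M h" using eq ab by (simp add: M_def)
  then have "f g = f h" by (simp add: M)
  then have "(g - h) \<bullet> (g - h) = 0" by (simp add: f_def inner_diff_left)
  then show ?thesis using ab by simp
qed

section \<open>Families of tiles with disjoint interiors\<close>

definition packing :: "'a::euclidean_space set set \<Rightarrow> bool" where
  "packing C \<longleftrightarrow> (\<forall>T\<in>C. tile T) \<and> pairwise (\<lambda>T T'. interior T \<inter> interior T' = {}) C"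

lemma tessellation_iff: "tessellation U C \<longleftrightarrow> packing C \<and> \<Union>C = U"
  by (auto simp: tessellation_def packing_def)

lemma packing_subset: "packing C \<Longrightarrow> D \<subseteq> C \<Longrightarrow> packing D"
  unfolding packing_def by (meson pairwise_subset subsetD)

lemma packing_eqI: "packing C \<Longrightarrow> T \<in> C \<Longrightarrow> U \<in> C \<Longrightarrow> interior T \<inter> interior U \<noteq> {} \<Longrightarrow> T = U"
  by (auto simp: packing_def pairwise_def)

lemma packing_subset_eq:
  assumes "packing C" "U \<in> C" "V \<in> C" "tile W" "W \<subseteq> U" "W \<subseteq> V" shows "U = V"
  using assms interior_tile_nonempty[of W] interior_mono[of W U] interior_mono[of W V]
  by (intro packing_eqI[of C]) auto

lemma vol_packing:
  assumes "packing C" "finite C" shows "vol (\<Union>C) = (\<Sum>T\<in>C. vol T)"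
proof -
  have "vol (\<Union>T\<in>C. T) = (\<Sum>T\<in>C. vol T)"
  proof (rule measure_UNION_AE[OF assms(2)])
    show "T \<in> lmeasurable" if "T \<in> C" for T
      using that assms by (auto simp: packing_def tile_lmeasurable)
    show "pairwise (\<lambda>T U. AE x in lebesgue. x \<notin> T \<or> x \<notin> U) C"
    proof (rule pairwiseI)
      fix T U assume TU: "T \<in> C" "U \<in> C" "T \<noteq> U"
      then have "interior T \<inter> interior U = {}" using assms by (auto simp: packing_def pairwise_def)
      then have "{x \<in> space lebesgue. \<not> (x \<notin> T \<or> x \<notin> U)} \<subseteq> frontier T \<union> frontier U"
        using closure_subset[of T] closure_subset[of U] by (auto simp: frontier_def)
      moreover have "frontier T \<union> frontier U \<in> null_sets lebesgue"
        using TU assms by (auto simp: packing_def tile_def)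
      ultimately show "AE x in lebesgue. x \<notin> T \<or> x \<notin> U" by (intro AE_I')
    qed
  qed
  then show ?thesis by simp
qed

lemma vol_tessellation:
  "tessellation U C \<Longrightarrow> finite C \<Longrightarrow> vol U = (\<Sum>T\<in>C. vol T)"
  using vol_packing by (auto simp: tessellation_iff)

text \<open>A tile of a packing that is covered by finitely many others is one of them, because it
  meets the interior of one of them: the boundaries are null sets.\<close>

lemma packing_covered_mem:
  assumes C: "packing C" and D: "D \<subseteq> C" "finite D" and V: "V \<in> C" "V \<subseteq> \<Union>D"
  shows "V \<in> D"
proof (rule ccontr)
  assume "V \<notin> D"
  have "interior V \<subseteq> (\<Union>U\<in>D. frontier U)"
  proof
    fix x assume x: "x \<in> interior V"
    then obtain U where U: "U \<in> D" "x \<in> U" using V interior_subset by blast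
    then have "x \<notin> interior U"
      using packing_eqI[OF C V(1), of U] D \<open>V \<notin> D\<close> x by auto
    then show "x \<in> (\<Union>U\<in>D. frontier U)"
      using U closure_subset by (auto simp: frontier_def)
  qed
  moreover have "(\<Union>U\<in>D. frontier U) \<in> null_sets lebesgue"
    using C D by (intro null_sets.finite_UN) (auto simp: packing_def tile_def)
  ultimately have "interior V \<in> null_sets lebesgue"
    by (metis negligible_iff_null_sets negligible_subset)
  then have "vol (interior V) = 0" by (simp add: null_sets_def measure_def)
  moreover have "tile V" using C V by (simp add: packing_def)
  ultimately show False using vol_interior_tile[of V] by (simp add: tile_def)
qed

lemma packing_count:
  assumes C: "packing C" "\<And>V. V \<in> C \<Longrightarrow> vol V \<ge> w" and w: "w > 0"
    and U: "U \<in> lmeasurable" "\<And>V. V \<in> C \<Longrightarrow> V \<subseteq> U"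
  shows "finite C \<and> real (card C) \<le> vol U / w"
proof -
  have fin: "real (card D) \<le> vol U / w" if D: "D \<subseteq> C" "finite D" for D
  proof -
    have P: "packing D" using C D packing_subset by blast
    have "real (card D) * w = (\<Sum>V\<in>D. w)" by simp
    also have "\<dots> \<le> (\<Sum>V\<in>D. vol V)" using C D by (intro sum_mono) auto
    also have "\<dots> = vol (\<Union>D)" using vol_packing[OF P D(2)] by simp
    also have "\<dots> \<le> vol U"
    proof (rule measure_mono_fmeasurable)
      show "\<Union>D \<in> sets lebesgue"
        using P D by (intro sets.finite_Union) (auto simp: packing_def tile_def)
    qed (use U D in auto)
    finally show ?thesis using w by (simp add: field_simps)
  qed
  have "finite C \<and> card C \<le> nat \<lfloor>vol U / w\<rfloor>"
    by (rule finite_if_finite_subsets_card_bdd) (use fin in \<open>simp add: le_nat_floor\<close>)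
  then show ?thesis using fin by blast
qed

section \<open>Neighbourhoods of boundaries\<close>

lemma thicken_iff: "x \<in> thicken A r \<longleftrightarrow> A \<noteq> {} \<and> infdist x A \<le> r"
  by (simp add: thicken_def)

lemma closed_thicken: "closed (thicken (A::'a::euclidean_space set) r)"
proof (cases "A = {}")
  case False
  have "closed {x. infdist x A \<le> r}"
    by (intro closed_Collect_le continuous_intros)
  then show ?thesis using False by (simp add: thicken_def)
qed (simp add: thicken_def)

lemma thicken_mono: "r \<le> s \<Longrightarrow> thicken A r \<subseteq> thicken A s"
  by (auto simp: thicken_def)

lemma thicken_add:
  assumes "x \<in> thicken A r" "dist y x \<le> s" shows "y \<in> thicken A (r + s)"
  using assms infdist_triangle[of y A x] by (auto simp: thicken_iff)

lemma thicken_point: "a \<in> A \<Longrightarrow> dist x a \<le> r \<Longrightarrow> x \<in> thicken A r"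
  using infdist_le[of a A x] by (auto simp: thicken_iff)

lemma bounded_thicken:
  assumes "bounded A" shows "bounded (thicken (A::'a::euclidean_space set) r)"
proof -
  obtain B where B: "\<And>x. x \<in> A \<Longrightarrow> norm x \<le> B" using assms by (auto simp: bounded_iff)
  have "norm x \<le> B + (r + 1)" if "x \<in> thicken A r" for x
  proof -
    have A: "A \<noteq> {}" "infdist x A < r + 1" using that by (auto simp: thicken_iff)
    then have "(INF a\<in>A. dist x a) < r + 1" by (simp add: infdist_def)
    then obtain a where "a \<in> A" "dist x a < r + 1"
      using A cInf_lessD[of "dist x ` A" "r + 1"] by blast
    then show ?thesis using B[of a] norm_triangle_sub[of x a] by (simp add: dist_norm)
  qed
  then show ?thesis unfolding bounded_iff by blast
qed

lemma lmeasurable_thicken: "bounded A \<Longrightarrow> thicken (A::'a::euclidean_space set) r \<in> lmeasurable"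
  by (simp add: bounded_set_imp_lmeasurable bounded_thicken closed_thicken borel_closed sets_completionI_sets)

lemma infdist_copy:
  assumes "a > 0" shows "infdist (g + a *\<^sub>R x) (copy a g A) = a * infdist (x::'a::euclidean_space) A"
proof (cases "A = {}")
  case False
  have d: "dist (g + a *\<^sub>R x) (g + a *\<^sub>R y) = a * dist x y" for y
    using assms by (simp add: dist_norm flip: scaleR_diff_right)
  have "(INF y\<in>A. a * dist x y) / a \<le> (INF y\<in>A. dist x y)"
  proof (rule cINF_greatest[OF False])
    fix y assume "y \<in> A"
    then have "(INF y\<in>A. a * dist x y) \<le> a * dist x y"
      using assms by (intro cINF_lower bdd_belowI[of _ 0]) auto
    then show "(INF y\<in>A. a * dist x y) / a \<le> dist x y" using assms by (simp add: field_simps)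
  qed
  moreover have "a * (INF y\<in>A. dist x y) \<le> (INF y\<in>A. a * dist x y)"
    using assms by (intro cINF_greatest[OF False] mult_left_mono cINF_lower bdd_belowI[of _ 0]) auto
  ultimately have "(INF y\<in>A. a * dist x y) = a * (INF y\<in>A. dist x y)"
    using assms by (simp add: field_simps)
  moreover have "dist (g + a *\<^sub>R x) ` copy a g A = (\<lambda>y. a * dist x y) ` A"
    unfolding copy_def image_image d ..
  ultimately show ?thesis using False unfolding infdist_def by (simp add: copy_def)
qed (simp add: copy_def infdist_def)

lemma thicken_copy:
  assumes "a > 0"
  shows "thicken (copy a g A) r = copy a (g::'a::euclidean_space) (thicken A (r / a))" (is "?L = ?R")
proof -
  have mem: "g + a *\<^sub>R x \<in> ?L \<longleftrightarrow> x \<in> thicken A (r / a)" for x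
    using assms infdist_copy[OF assms, of g x A]
    by (simp add: thicken_iff copy_def pos_le_divide_eq mult.commute)
  show ?thesis
  proof (intro set_eqI iffI)
    fix y assume "y \<in> ?L"
    moreover have y: "y = g + a *\<^sub>R ((1 / a) *\<^sub>R (y - g))" using assms by simp
    ultimately have "(1 / a) *\<^sub>R (y - g) \<in> thicken A (r / a)" using mem by metis
    then show "y \<in> ?R" using y unfolding copy_def by blast
  qed (use mem in \<open>auto simp: copy_def\<close>)
qed

text \<open>The neighbourhoods of a compact set decrease to the set, and the measure is continuous from
  above.\<close>

lemma vol_thicken_tendsto_0:
  assumes "bounded A" "closed A" "A \<in> null_sets lebesgue" "e > 0"
  shows "\<exists>s>0. vol (thicken (A::'a::euclidean_space set) s) \<le> e"
proof -
  define T where "T n = thicken A (1 / real (Suc n))" for n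
  have fm: "T n \<in> lmeasurable" for n by (simp add: T_def assms lmeasurable_thicken)
  have "(\<lambda>n. vol (T n)) \<longlonglongrightarrow> vol (\<Inter>n. T n)"
  proof (rule Lim_measure_decseq)
    show "range T \<subseteq> sets lebesgue" using fm by auto
    show "decseq T" unfolding T_def
      by (intro decseq_SucI thicken_mono) (simp add: field_simps)
    show "emeasure lebesgue (T i) \<noteq> \<infinity>" for i using fm[of i] by (auto simp: fmeasurable_def)
  qed
  moreover have "(\<Inter>n. T n) \<subseteq> A"
  proof
    fix x assume "x \<in> (\<Inter>n. T n)"
    then have x: "A \<noteq> {}" "infdist x A \<le> 1 / real (Suc n)" for n by (auto simp: T_def thicken_iff)
    have "infdist x A \<le> 0"
      by (rule LIMSEQ_le_const[OF LIMSEQ_inverse_real_of_nat]) (use x(2) in \<open>simp add: inverse_eq_divide\<close>)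
    then show "x \<in> A" using x(1) assms(2) infdist_nonneg[of x A] by (simp add: in_closed_iff_infdist_zero)
  qed
  then have "vol (\<Inter>n. T n) = 0"
    using assms(3) by (meson negligible_iff_null_sets negligible_subset negligible_imp_measure0)
  ultimately have "(\<lambda>n. vol (T n)) \<longlonglongrightarrow> 0" by simp
  then have "eventually (\<lambda>n. vol (T n) < e) sequentially" using assms(4) by (rule order_tendstoD)
  then obtain n where "vol (T n) < e" using eventually_happens by force
  then show ?thesis unfolding T_def by (intro exI[of _ "1 / real (Suc n)"]) auto
qed

section \<open>Scaled tiles and their descendants\<close>

locale normalized_scheme =
  fixes \<sigma> :: "'a::euclidean_space scheme"
  assumes scheme: "multiscale_scheme \<sigma>" and normalized: "normalized \<sigma>"
begin

text \<open>The tiles to which the substitution can be applied; they are followed down to arbitrarily small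
  sizes as well as up to arbitrarily large ones.\<close>

definition scaled :: "'a set \<Rightarrow> bool" where
  "scaled X \<longleftrightarrow> (\<exists>j\<in>types \<sigma>. has_type \<sigma> j X)"

lemma scaled_copy_proto: "j \<in> types \<sigma> \<Longrightarrow> \<alpha> > 0 \<Longrightarrow> scaled (copy \<alpha> g (proto \<sigma> j))"
  unfolding scaled_def has_type_def by blast

lemma scaledE:
  assumes "scaled X"
  obtains j \<alpha> g where "j \<in> types \<sigma>" "\<alpha> > 0" "X = copy \<alpha> g (proto \<sigma> j)"
  using assms unfolding scaled_def has_type_def by blast

lemma tile_proto: "j \<in> types \<sigma> \<Longrightarrow> tile (proto \<sigma> j)"
  using scheme by (simp add: multiscale_scheme_def)

lemma vol_proto: "j \<in> types \<sigma> \<Longrightarrow> vol (proto \<sigma> j) = 1"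
  using normalized by (simp add: normalized_def)

lemma scaled_tile: "scaled X \<Longrightarrow> tile X"
  by (metis scaledE tile_copy tile_proto)

lemma scaled_vol_pos: "scaled X \<Longrightarrow> vol X > 0"
  using scaled_tile by (simp add: tile_def)

lemma scaled_proto: "j \<in> types \<sigma> \<Longrightarrow> scaled (proto \<sigma> j)"
  using scaled_copy_proto[of j 1 0] by simp

lemma scaled_copy: "scaled X \<Longrightarrow> c > 0 \<Longrightarrow> scaled (copy c g X)"
  by (elim scaledE) (simp add: copy_copy scaled_copy_proto)

lemma vol_copy_proto: "j \<in> types \<sigma> \<Longrightarrow> \<alpha> > 0 \<Longrightarrow> vol (copy \<alpha> g (proto \<sigma> j)) = \<alpha> ^ DIM('a)"
  by (simp add: vol_copy vol_proto)

lemma copy_proto_eqD: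
  assumes "i \<in> types \<sigma>" "j \<in> types \<sigma>" "\<alpha> > 0" "\<beta> > 0"
    and eq: "copy \<alpha> g (proto \<sigma> i) = copy \<beta> h (proto \<sigma> j)"
  shows "i = j \<and> \<alpha> = \<beta> \<and> g = h"
proof -
  have "proto \<sigma> i = copy (1 / \<alpha>) (- (1 / \<alpha>) *\<^sub>R g) (copy \<alpha> g (proto \<sigma> i))"
    using assms(3) by (simp add: copy_copy)
  also have "\<dots> = copy (1 / \<alpha> * \<beta>) (- (1 / \<alpha>) *\<^sub>R g + (1 / \<alpha>) *\<^sub>R h) (proto \<sigma> j)"
    unfolding eq copy_copy ..
  finally have "has_type \<sigma> j (proto \<sigma> i)"
    using assms unfolding has_type_def
    by (intro exI[of _ "1 / \<alpha> * \<beta>"] conjI exI[of _ "- (1 / \<alpha>) *\<^sub>R g + (1 / \<alpha>) *\<^sub>R h"]) auto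
  then have "i = j" using scheme assms by (auto simp: multiscale_scheme_def)
  then show ?thesis using copy_eqD[OF tile_proto[OF assms(1)] assms(3,4)] eq by blast
qed

text \<open>Distinct prototiles are not scaled copies of each other, so \<open>X\<close> determines its type, scale and
  position, and the following union is over at most one rule.\<close>

definition children :: "'a set \<Rightarrow> 'a set set" where
  "children X = {copy \<alpha> g W |\<alpha> g j W. \<alpha> > 0 \<and> j \<in> types \<sigma> \<and> X = copy \<alpha> g (proto \<sigma> j) \<and> W \<in> rule \<sigma> j}"

lemma children_copy_proto:
  assumes "j \<in> types \<sigma>" "\<alpha> > 0" shows "children (copy \<alpha> g (proto \<sigma> j)) = copy \<alpha> g ` rule \<sigma> j"
proof
  show "children (copy \<alpha> g (proto \<sigma> j)) \<subseteq> copy \<alpha> g ` rule \<sigma> j"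
    using assms copy_proto_eqD unfolding children_def by blast
  show "copy \<alpha> g ` rule \<sigma> j \<subseteq> children (copy \<alpha> g (proto \<sigma> j))"
    using assms unfolding children_def by blast
qed

lemma children_copy:
  assumes "scaled X" "c > 0" shows "children (copy c g X) = copy c g ` children X"
proof -
  obtain j \<alpha> h where X: "j \<in> types \<sigma>" "\<alpha> > 0" "X = copy \<alpha> h (proto \<sigma> j)" using assms(1) by (rule scaledE)
  then show ?thesis using assms(2) by (simp add: copy_copy children_copy_proto image_image)
qed

text \<open>Bounds for the ratio of the volumes of a child and its parent.  The value 1/2 keeps the minimum
  and the maximum strictly between 0 and 1 if there is no rule.\<close>

definition min_ratio :: real where
  "min_ratio = Min (insert (1/2) (vol ` (\<Union>j\<in>types \<sigma>. rule \<sigma> j)))"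

definition max_ratio :: real where
  "max_ratio = Max (insert (1/2) (vol ` (\<Union>j\<in>types \<sigma>. rule \<sigma> j)))"

lemma finite_rule: "j \<in> types \<sigma> \<Longrightarrow> finite (rule \<sigma> j)"
  using scheme by (simp add: multiscale_scheme_def)

lemma rule_tileE:
  assumes "j \<in> types \<sigma>" "W \<in> rule \<sigma> j"
  obtains k \<alpha> g where "k \<in> types \<sigma>" "0 < \<alpha>" "\<alpha> < 1" "W = copy \<alpha> g (proto \<sigma> k)"
  using scheme assms unfolding multiscale_scheme_def by (metis greaterThanLessThan_iff)

lemma rule_vol:
  assumes "j \<in> types \<sigma>" "W \<in> rule \<sigma> j" shows "0 < vol W" "vol W < 1"
proof -
  obtain k \<alpha> g where k: "k \<in> types \<sigma>" "0 < \<alpha>" "\<alpha> < 1" "W = copy \<alpha> g (proto \<sigma> k)"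
    using rule_tileE[OF assms] .
  have "vol W = \<alpha> ^ DIM('a)" using k vol_copy_proto by blast
  then show "0 < vol W" "vol W < 1" using k by (simp_all add: power_less_one_iff)
qed

lemma finite_rules: "finite (\<Union>j\<in>types \<sigma>. rule \<sigma> j)"
  using finite_rule by auto

lemma min_ratio_pos: "min_ratio > 0"
  using rule_vol finite_rules unfolding min_ratio_def by (subst Min_gr_iff) auto

lemma max_ratio_less_1: "max_ratio < 1"
  using rule_vol finite_rules unfolding max_ratio_def by (subst Max_less_iff) auto

lemma max_ratio_pos: "max_ratio > 0"
  using finite_rules unfolding max_ratio_def by (subst Max_gr_iff) (auto intro!: bexI[of _ "1/2"])

lemma min_ratio_le_half: "min_ratio \<le> 1/2"
  using finite_rules unfolding min_ratio_def by (intro Min_le) auto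

lemma rule_vol_bounds:
  assumes "j \<in> types \<sigma>" "W \<in> rule \<sigma> j" shows "min_ratio \<le> vol W" "vol W \<le> max_ratio"
  using assms finite_rules unfolding min_ratio_def max_ratio_def by (auto intro!: Min_le Max_ge)

lemma children_facts:
  assumes X: "scaled X"
  shows "finite (children X)" "tessellation X (children X)"
    and "\<And>Y. Y \<in> children X \<Longrightarrow> scaled Y"
    and "\<And>Y. Y \<in> children X \<Longrightarrow> min_ratio * vol X \<le> vol Y"
    and "\<And>Y. Y \<in> children X \<Longrightarrow> vol Y \<le> max_ratio * vol X"
proof -
  obtain j \<alpha> g where j: "j \<in> types \<sigma>" "\<alpha> > 0" "X = copy \<alpha> g (proto \<sigma> j)" using X by (rule scaledE)
  have ch: "children X = copy \<alpha> g ` rule \<sigma> j" using j children_copy_proto by simp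
  show "finite (children X)" using ch finite_rule[OF j(1)] by simp
  have tess: "tessellation (proto \<sigma> j) (rule \<sigma> j)" using scheme j by (simp add: multiscale_scheme_def)
  show "tessellation X (children X)"
    unfolding tessellation_def
  proof (intro conjI)
    show "\<forall>T\<in>children X. tile T"
      using tess j(2) unfolding ch by (auto simp: tessellation_def tile_copy)
    show "\<Union> (children X) = X" using tess unfolding ch copy_Union[symmetric] by (simp add: tessellation_def j(3))
    show "pairwise (\<lambda>T T'. interior T \<inter> interior T' = {}) (children X)"
      unfolding ch pairwise_image
    proof (rule pairwiseI)
      fix T U assume TU: "T \<in> rule \<sigma> j" "U \<in> rule \<sigma> j" "T \<noteq> U"
      then have "interior T \<inter> interior U = {}" using tess by (auto simp: tessellation_def pairwise_def)
      then have "interior (copy \<alpha> g T) \<inter> interior (copy \<alpha> g U) = {}"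
        using j by (simp add: interior_copy flip: copy_Int) (simp add: copy_def)
      then show "copy \<alpha> g T \<noteq> copy \<alpha> g U \<longrightarrow> interior (copy \<alpha> g T) \<inter> interior (copy \<alpha> g U) = {}" ..
    qed
  qed
  have volX: "vol X = \<alpha> ^ DIM('a)" using j by (simp add: vol_copy_proto)
  fix Y assume "Y \<in> children X"
  then obtain W where W: "W \<in> rule \<sigma> j" "Y = copy \<alpha> g W" using ch by auto
  show "scaled Y" using W j rule_tileE[OF j(1) W(1)] by (metis scaled_copy scaled_copy_proto)
  have "vol Y = vol X * vol W" using W j volX by (simp add: vol_copy)
  then show "min_ratio * vol X \<le> vol Y" "vol Y \<le> max_ratio * vol X"
    using rule_vol_bounds[OF j(1) W(1)] scaled_vol_pos[OF X] by (simp_all add: mult.commute)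
qed

lemma vol_child_less: "scaled X \<Longrightarrow> Y \<in> children X \<Longrightarrow> vol Y < vol X"
  using children_facts(5)[of X Y] scaled_vol_pos[of X] max_ratio_less_1
    mult_strict_right_mono[of max_ratio 1 "vol X"] by linarith

lemma vol_children: "scaled X \<Longrightarrow> (\<Sum>Y\<in>children X. vol Y) = vol X"
  using vol_tessellation children_facts(1,2) by metis

lemma child_subset: "scaled X \<Longrightarrow> Y \<in> children X \<Longrightarrow> Y \<subseteq> X"
  using children_facts(2) by (auto simp: tessellation_def)

text \<open>Volumes shrink by a definite factor in each substitution, so a property of all scaled tiles
  can be proved by passing from the children to the parent above any threshold.\<close>

lemma volume_induct [consumes 2, case_names small large]:
  assumes l: "l > 0" and X: "scaled X"
    and small: "\<And>X. scaled X \<Longrightarrow> vol X \<le> l \<Longrightarrow> Q X"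
    and large: "\<And>X. scaled X \<Longrightarrow> vol X > l \<Longrightarrow> (\<And>Y. Y \<in> children X \<Longrightarrow> Q Y) \<Longrightarrow> Q X"
  shows "Q X"
proof -
  have *: "scaled X \<Longrightarrow> vol X * max_ratio ^ n \<le> l \<Longrightarrow> Q X" for n X
  proof (induction n arbitrary: X)
    case 0 then show ?case using small by simp
  next
    case (Suc n)
    show ?case
    proof (cases "vol X \<le> l")
      case True then show ?thesis using small Suc by simp
    next
      case False
      show ?thesis
      proof (rule large)
        fix Y assume Y: "Y \<in> children X"
        have "vol Y * max_ratio ^ n \<le> (max_ratio * vol X) * max_ratio ^ n"
          using children_facts(5)[OF Suc.prems(1) Y] max_ratio_pos by (intro mult_right_mono) auto
        then show "Q Y" using Suc children_facts(3)[OF Suc.prems(1) Y] by (simp add: mult_ac)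
      qed (use False Suc in auto)
    qed
  qed
  have "(\<lambda>n. vol X * max_ratio ^ n) \<longlonglongrightarrow> vol X * 0"
    using max_ratio_pos max_ratio_less_1 by (intro tendsto_intros LIMSEQ_power_zero) auto
  then have "eventually (\<lambda>n. vol X * max_ratio ^ n < l) sequentially"
    using l by (intro order_tendstoD(2)) auto
  then obtain n where "vol X * max_ratio ^ n < l" using eventually_happens by force
  then show ?thesis using *[OF X, of n] by simp
qed

inductive_set descendants :: "real \<Rightarrow> 'a set \<Rightarrow> 'a set set" for l :: real and X :: "'a set" where
  self: "X \<in> descendants l X"
| child: "V \<in> descendants l X \<Longrightarrow> l < vol V \<Longrightarrow> W \<in> children V \<Longrightarrow> W \<in> descendants l X"

text \<open>The first descendants of volume at most \<open>l\<close>.  The patch of the flow is \<open>cut 1\<close>, and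
  \<open>cut (exp (d t))\<close> is its inflation by \<open>exp t\<close>, where \<open>d\<close> is the dimension.\<close>

definition cut :: "real \<Rightarrow> 'a set \<Rightarrow> 'a set set" where
  "cut l X = {V \<in> descendants l X. vol V \<le> l}"

lemma stages_eq: "stages \<sigma> X = descendants 1 X"
proof (intro set_eqI iffI)
  fix V assume "V \<in> stages \<sigma> X" then show "V \<in> descendants 1 X"
  proof induction
    case (substitute \<alpha> g j W)
    then show ?case using children_copy_proto by (metis descendants.child imageI)
  qed (rule descendants.self)
next
  fix V assume "V \<in> descendants 1 X" then show "V \<in> stages \<sigma> X"
  proof induction
    case (child V W)
    then show ?case unfolding children_def by (auto intro: stages.substitute)
  qed (rule stages.start)
qed

lemma flow_eq: "flow \<sigma> t T = cut 1 (copy (exp t) 0 T)"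
  by (simp add: flow_def cut_def stages_eq)

lemma descendants_trans: "V \<in> descendants l X \<Longrightarrow> U \<in> descendants l V \<Longrightarrow> U \<in> descendants l X"
  by (rotate_tac, induction rule: descendants.induct) (auto intro: descendants.child)

lemma descendants_small: "vol X \<le> l \<Longrightarrow> descendants l X = {X}"
proof (intro set_eqI iffI)
  fix V assume X: "vol X \<le> l" and "V \<in> descendants l X"
  from this(2) show "V \<in> {X}" by induction (use X in auto)
qed (auto intro: descendants.self)

lemma descendants_large:
  assumes "vol X > l" shows "descendants l X = insert X (\<Union>Y\<in>children X. descendants l Y)"
proof (intro set_eqI iffI)
  fix V assume "V \<in> descendants l X" then show "V \<in> insert X (\<Union>Y\<in>children X. descendants l Y)"
    by induction (auto intro: descendants.intros)
next
  fix V assume "V \<in> insert X (\<Union>Y\<in>children X. descendants l Y)"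
  then show "V \<in> descendants l X"
    using descendants.child[OF descendants.self assms] descendants_trans descendants.self by blast
qed

lemma cut_small: "vol X \<le> l \<Longrightarrow> cut l X = {X}"
  by (auto simp: cut_def descendants_small)

lemma cut_large: "vol X > l \<Longrightarrow> cut l X = (\<Union>Y\<in>children X. cut l Y)"
  by (auto simp: cut_def descendants_large)

lemma scaled_descendant: "scaled X \<Longrightarrow> V \<in> descendants l X \<Longrightarrow> scaled V"
  by (rotate_tac, induction rule: descendants.induct) (auto intro: children_facts)

lemma scaled_cut: "scaled X \<Longrightarrow> V \<in> cut l X \<Longrightarrow> scaled V"
  using scaled_descendant by (auto simp: cut_def)

lemma descendant_subset: "scaled X \<Longrightarrow> V \<in> descendants l X \<Longrightarrow> V \<subseteq> X"
  by (rotate_tac, induction rule: descendants.induct) (use child_subset scaled_descendant in blast)+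

lemma vol_cut_le: "V \<in> cut l X \<Longrightarrow> vol V \<le> l"
  by (simp add: cut_def)

lemma descendants_antimono: "l \<le> m \<Longrightarrow> V \<in> descendants m X \<Longrightarrow> V \<in> descendants l X"
  by (rotate_tac, induction rule: descendants.induct) (auto intro: descendants.intros)

lemma descendants_copy:
  assumes "scaled X" "c > 0" "V \<in> descendants l X"
  shows "copy c g V \<in> descendants (c ^ DIM('a) * l) (copy c g X)"
  using assms(3)
proof induction
  case (child V W)
  have "scaled V" using scaled_descendant assms child by blast
  then have "copy c g W \<in> children (copy c g V)" using child assms by (simp add: children_copy)
  moreover have "c ^ DIM('a) * l < vol (copy c g V)" using assms child by (simp add: vol_copy)
  ultimately show ?case using child descendants.child by blast
qed (rule descendants.self)

lemma copy_inverse: "c > 0 \<Longrightarrow> copy (1 / c) (- (1 / c) *\<^sub>R g) (copy c g V) = V"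
  by (simp add: copy_copy)

lemma copy_inverse': "c > 0 \<Longrightarrow> copy c g (copy (1 / c) (- (1 / c) *\<^sub>R g) V) = V"
  by (simp add: copy_copy)

lemma cut_copy:
  assumes "scaled X" "c > 0"
  shows "cut (c ^ DIM('a) * l) (copy c g X) = copy c g ` cut l X"
proof
  show "copy c g ` cut l X \<subseteq> cut (c ^ DIM('a) * l) (copy c g X)"
    using assms descendants_copy by (auto simp: cut_def vol_copy)
  show "cut (c ^ DIM('a) * l) (copy c g X) \<subseteq> copy c g ` cut l X"
  proof
    fix V assume V: "V \<in> cut (c ^ DIM('a) * l) (copy c g X)"
    define U where "U = copy (1 / c) (- (1 / c) *\<^sub>R g) V"
    have VU: "V = copy c g U" unfolding U_def using assms by (simp only: copy_inverse')
    have "U \<in> descendants ((1 / c) ^ DIM('a) * (c ^ DIM('a) * l)) (copy (1 / c) (- (1 / c) *\<^sub>R g) (copy c g X))"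
      unfolding U_def using V assms by (intro descendants_copy) (auto simp: cut_def scaled_copy)
    then have "U \<in> descendants l X" using assms by (simp add: copy_inverse power_divide del: scaleR_minus_left)
    moreover have "vol U \<le> l" using V VU assms by (simp add: cut_def vol_copy)
    ultimately show "V \<in> copy c g ` cut l X" using VU by (auto simp: cut_def)
  qed
qed

lemma cut_translate: "scaled X \<Longrightarrow> cut l (copy 1 g X) = copy 1 g ` cut l X"
  using cut_copy[of X 1 l g] by simp

lemma cut_facts:
  assumes "l > 0" "scaled X"
  shows "finite (cut l X) \<and> tessellation X (cut l X) \<and> (\<forall>V\<in>cut l X. min (vol X) (min_ratio * l) \<le> vol V)"
  using assms
proof (induction rule: volume_induct)
  case (small X)
  then show ?case by (auto simp: cut_small tessellation_def scaled_tile)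
next
  case (large X)
  have eq: "cut l X = (\<Union>Y\<in>children X. cut l Y)" using large by (simp add: cut_large)
  have ch: "packing (children X)" "\<Union>(children X) = X"
    using children_facts(2)[OF large(1)] by (auto simp: tessellation_iff)
  have U: "\<Union>(cut l Y) = Y" "packing (cut l Y)" if "Y \<in> children X" for Y
    using large.IH[OF that] by (auto simp: tessellation_iff)
  have "packing (cut l X)"
    unfolding packing_def
  proof (intro conjI pairwiseI)
    show "\<forall>T\<in>cut l X. tile T" using scaled_cut large scaled_tile by blast
    fix T T' assume T: "T \<in> cut l X" "T' \<in> cut l X" "T \<noteq> T'"
    then obtain Y Y' where Y: "Y \<in> children X" "T \<in> cut l Y" "Y' \<in> children X" "T' \<in> cut l Y'" by (auto simp: eq)
    show "interior T \<inter> interior T' = {}"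
    proof (cases "Y = Y'")
      case True then show ?thesis using U(2)[OF Y(1)] Y T by (auto simp: packing_def pairwise_def)
    next
      case False
      then have "interior Y \<inter> interior Y' = {}" using ch Y by (auto simp: packing_def pairwise_def)
      moreover have "interior T \<subseteq> interior Y" "interior T' \<subseteq> interior Y'"
        using U(1) Y by (auto intro!: interior_mono)
      ultimately show ?thesis by blast
    qed
  qed
  moreover have "\<Union>(cut l X) = (\<Union>Y\<in>children X. \<Union>(cut l Y))" by (auto simp: eq)
  then have "\<Union>(cut l X) = X" using U(1) ch(2) by simp
  moreover have "min (vol X) (min_ratio * l) \<le> vol V" if V: "V \<in> cut l X" for V
  proof -
    obtain Y where Y: "Y \<in> children X" "V \<in> cut l Y" using V eq by auto
    have "min_ratio * l \<le> min_ratio * vol X" using large min_ratio_pos by simp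
    also have "\<dots> \<le> vol Y" using children_facts(4) large Y by blast
    finally have "min_ratio * l \<le> min (vol Y) (min_ratio * l)" by simp
    also have "\<dots> \<le> vol V" using large.IH[OF Y(1)] Y(2) by blast
    finally show ?thesis by simp
  qed
  moreover have "finite (cut l X)" using large.IH children_facts(1)[OF large(1)] by (auto simp: eq)
  ultimately show ?case by (simp add: tessellation_iff)
qed

lemma finite_cut: "l > 0 \<Longrightarrow> scaled X \<Longrightarrow> finite (cut l X)"
  and packing_cut: "l > 0 \<Longrightarrow> scaled X \<Longrightarrow> packing (cut l X)"
  and Union_cut: "l > 0 \<Longrightarrow> scaled X \<Longrightarrow> \<Union>(cut l X) = X"
  using cut_facts[of l X] by (simp_all add: tessellation_iff)

lemma vol_cut: "l > 0 \<Longrightarrow> scaled X \<Longrightarrow> (\<Sum>V\<in>cut l X. vol V) = vol X"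
  using cut_facts vol_tessellation by metis

lemma vol_cut_ge:
  assumes "l > 0" "scaled X" "vol X \<ge> l" "V \<in> cut l X" shows "min_ratio * l \<le> vol V"
proof -
  have "min_ratio * l \<le> vol X" using mult_right_mono[of min_ratio 1 l] min_ratio_le_half assms by linarith
  then show ?thesis using cut_facts[OF assms(1,2)] assms(4) by (metis min.absorb2)
qed

text \<open>A common tile would lie in two members of the packing and force them to be equal.\<close>

lemma cut_disjoint:
  assumes "l > 0" "packing C" "\<And>V. V \<in> C \<Longrightarrow> scaled V" "Y \<in> C" "Y' \<in> C" "Y \<noteq> Y'"
  shows "cut l Y \<inter> cut l Y' = {}"
proof (rule ccontr)
  assume "\<not> ?thesis"
  then obtain V where V: "V \<in> cut l Y" "V \<in> cut l Y'" by blast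
  then have "tile V" "V \<subseteq> Y" "V \<subseteq> Y'"
    using assms scaled_cut scaled_tile Union_cut by (blast, blast, blast)
  then show False using packing_subset_eq[OF assms(2)] assms by blast
qed

text \<open>The semigroup law of the substitution flow, with \<open>l\<close> in the role of the time at which the
  flow is interrupted.\<close>

lemma cut_cut:
  assumes "1 \<le> l" "scaled X" shows "cut 1 X = (\<Union>V\<in>cut l X. cut 1 V)"
proof -
  have "l > 0" using assms by simp
  from this assms(2) show ?thesis
  proof (induction rule: volume_induct)
    case (small X) then show ?case by (simp add: cut_small)
  next
    case (large X) then show ?case using assms(1) by (simp add: cut_large)
  qed
qed

lemma cut_descendant: "V \<in> descendants 1 X \<Longrightarrow> cut 1 V \<subseteq> cut 1 X"
  using descendants_trans by (auto simp: cut_def)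

text \<open>The parent of a tile of volume at least 1 has volume above 1, so it is substituted.\<close>

lemma descendants_large_volume:
  assumes "scaled X" "V \<in> descendants 0 X" "vol V \<ge> 1" shows "V \<in> descendants 1 X"
  using assms(2,3)
proof induction
  case (child V W)
  have "vol W < vol V" using child assms scaled_descendant vol_child_less by blast
  with child have "V \<in> descendants 1 X" "1 < vol V" by auto
  then show ?case using child.hyps by (rule_tac descendants.child)
qed (rule descendants.self)

definition superadditive :: "('a set \<Rightarrow> real) \<Rightarrow> bool" where
  "superadditive N \<longleftrightarrow> (\<forall>X. scaled X \<longrightarrow> vol X > 1 \<longrightarrow> (\<Sum>Y\<in>children X. N Y) \<le> N X)"

lemma sum_cut_large:
  fixes f :: "'a set \<Rightarrow> real"
  assumes "l > 0" "scaled X" "vol X > l"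
  shows "(\<Sum>V\<in>cut l X. f V) = (\<Sum>Y\<in>children X. \<Sum>V\<in>cut l Y. f V)"
proof -
  have "packing (children X)" using children_facts(2)[OF assms(2)] by (simp add: tessellation_iff)
  then show ?thesis unfolding cut_large[OF assms(3)]
    using assms children_facts[OF assms(2)] cut_disjoint[OF assms(1)]
    by (intro sum.UNION_disjoint) (auto intro: finite_cut)
qed

lemma superadditive_cut:
  assumes N: "superadditive N" and l: "l \<ge> 1" and X: "scaled X"
  shows "(\<Sum>V\<in>cut l X. N V) \<le> N X"
proof -
  have "l > 0" using l by simp
  from this X show ?thesis
  proof (induction rule: volume_induct)
    case (small X) then show ?case by (simp add: cut_small)
  next
    case (large X)
    have "(\<Sum>V\<in>cut l X. N V) \<le> (\<Sum>Y\<in>children X. N Y)"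
      using large l by (simp add: sum_cut_large sum_mono)
    also have "\<dots> \<le> N X" using N large l by (auto simp: superadditive_def)
    finally show ?case .
  qed
qed

end

section \<open>Loop lengths\<close>

text \<open>Trading \<open>n\<close> copies of \<open>b\<close> for \<open>m\<close> copies of \<open>a\<close> moves a nonnegative
  combination up by the small amount \<open>m a - n b\<close>; a bounded number of trades bridges the gap
  between consecutive multiples of \<open>b\<close>.\<close>

lemma two_step_combinations_dense:
  fixes a b \<delta> :: real and m n :: nat
  assumes "a > 0" "b > 0" and \<theta>: "0 < real m * a - real n * b" "real m * a - real n * b < \<delta>"
  shows "\<exists>K. \<forall>x\<ge>K. \<exists>p q. x \<le> real p * a + real q * b \<and> real p * a + real q * b < x + \<delta>"
proof -
  define t where "t = real m * a - real n * b"
  \<comment> \<open>Enough trades to move by \<open>b\<close>.\<close>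
  define N where "N = nat \<lceil>b / t\<rceil>"
  have t: "0 < t" "t < \<delta>" using \<theta> by (simp_all add: t_def)
  have N: "b \<le> real N * t"
  proof -
    have "b / t \<le> real N" unfolding N_def by (rule real_nat_ceiling_ge)
    then show ?thesis using t by (simp add: field_simps)
  qed
  show ?thesis
  proof (intro exI[of _ "real (N * n) * b"] allI impI)
    fix x assume x: "real (N * n) * b \<le> x"
    \<comment> \<open>The largest multiple of \<open>b\<close> below \<open>x\<close>; its \<open>N n\<close> spare copies of \<open>b\<close> can be traded.\<close>
    define r where "r = nat \<lfloor>(x - real (N * n) * b) / b\<rfloor>"
    define y where "y = real (r + N * n) * b"
    have r0: "0 \<le> (x - real (N * n) * b) / b" using x assms by simp
    have "real r = of_int \<lfloor>(x - real (N * n) * b) / b\<rfloor>" using r0 unfolding r_def by simp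
    then have "real r \<le> (x - real (N * n) * b) / b" "(x - real (N * n) * b) / b < real r + 1"
      by linarith+
    then have y: "y \<le> x" "x < y + b" using assms by (simp_all add: y_def field_simps)
    define s where "s = nat \<lceil>(x - y) / t\<rceil>"
    have "0 \<le> (x - y) / t" using y t by simp
    then have "real s = of_int \<lceil>(x - y) / t\<rceil>" unfolding s_def by simp
    then have s: "(x - y) / t \<le> real s" "real s < (x - y) / t + 1" by linarith+
    have s1: "x \<le> y + real s * t" "y + real s * t < x + t"
      using s t by (simp_all add: field_simps)
    have "(x - y) / t \<le> real N" using N y t by (simp add: field_simps)
    then have "s \<le> N" unfolding s_def by linarith
    then have sn: "s * n \<le> N * n" by simp
    have "real (r + N * n - s * n) = real r + real N * real n - real s * real n"
      using sn trans_le_add2[OF sn, of r] by (subst of_nat_diff) auto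
    then have "real (s * m) * a + real (r + N * n - s * n) * b
        = real s * real m * a + (real r + real N * real n - real s * real n) * b" by simp
    also have "\<dots> = y + real s * t" by (simp add: y_def t_def algebra_simps)
    finally have "real (s * m) * a + real (r + N * n - s * n) * b = y + real s * t" .
    then show "\<exists>p q. x \<le> real p * a + real q * b \<and> real p * a + real q * b < x + \<delta>"
      using s1 t by (intro exI[of _ "s * m"] exI[of _ "r + N * n - s * n"]) linarith
  qed
qed

text \<open>By Dirichlet's theorem some combination \<open>m a - n b\<close> is small; it is nonzero because the ratio is
  irrational.  Depending on its sign, \<open>b\<close> is traded for \<open>a\<close> or \<open>a\<close> for \<open>b\<close>.\<close>

lemma combinations_eventually_dense:
  fixes a b \<delta> :: real
  assumes "a > 0" "b > 0" and irr: "a / b \<notin> \<rat>" and "\<delta> > 0"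
  shows "\<exists>K. \<forall>x\<ge>K. \<exists>p q. x \<le> real p * a + real q * b \<and> real p * a + real q * b < x + \<delta>"
proof -
  define N where "N = nat \<lceil>b / \<delta>\<rceil> + 1"
  have N: "N > 0" "b / \<delta> \<le> real N" unfolding N_def using real_nat_ceiling_ge[of "b / \<delta>"] by linarith+
  obtain h k where hk: "0 < k" "k \<le> int N" "\<bar>of_int k * (a / b) - of_int h\<bar> < 1 / real N"
    using Dirichlet_approx[OF N(1), of "a / b"] by blast
  define t where "t = of_int k * a - of_int h * b"
  have "t = b * (of_int k * (a / b) - of_int h)" using assms by (simp add: t_def field_simps)
  then have "\<bar>t\<bar> = b * \<bar>of_int k * (a / b) - of_int h\<bar>" using assms by (simp add: abs_mult)
  also have "\<dots> < b * (1 / real N)" using hk(3) assms by (intro mult_strict_left_mono) auto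
  also have "\<dots> \<le> \<delta>" using N assms by (simp add: field_simps)
  finally have t: "\<bar>t\<bar> < \<delta>" .
  have "t \<noteq> 0"
  proof
    assume "t = 0"
    then have "a / b = of_int h / of_int k" using hk assms by (simp add: t_def field_simps)
    then show False using irr by auto
  qed
  have "1 / real N \<le> 1" using N by simp
  then have "real_of_int h > of_int k * (a / b) - 1" using hk(3) by linarith
  moreover have "of_int k * (a / b) > 0" using hk assms by simp
  ultimately have "real_of_int h > - 1" by linarith
  then have h: "h \<ge> 0" by linarith
  have eq: "t = real (nat k) * a - real (nat h) * b" using hk h by (simp add: t_def)
  show ?thesis
  proof (cases "t > 0")
    case True
    then show ?thesis using two_step_combinations_dense[of a b "nat k" "nat h" \<delta>] assms t eq by auto
  next
    case False
    then have "0 < real (nat h) * b - real (nat k) * a" "real (nat h) * b - real (nat k) * a < \<delta>"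
      using t eq \<open>t \<noteq> 0\<close> by linarith+
    from two_step_combinations_dense[OF assms(2,1) this] show ?thesis by (metis add.commute)
  qed
qed

context normalized_scheme
begin

text \<open>The lengths of the paths from \<open>i\<close> to \<open>k\<close> in the graph of the scheme, where an edge stands
  for a tile of a rule and its length is minus the logarithm of the scale.\<close>

definition lengths :: "nat \<Rightarrow> nat \<Rightarrow> real set" where
  "lengths i k = {l. \<exists>g. copy (exp (- l)) g (proto \<sigma> k) \<in> descendants 0 (proto \<sigma> i)}"

lemma lengthsE:
  assumes "l \<in> lengths i k" "i \<in> types \<sigma>" "\<alpha> > 0"
  obtains h where "copy (\<alpha> * exp (- l)) h (proto \<sigma> k) \<in> descendants 0 (copy \<alpha> g (proto \<sigma> i))"
proof -
  obtain g' where "copy (exp (- l)) g' (proto \<sigma> k) \<in> descendants 0 (proto \<sigma> i)"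
    using assms(1) by (auto simp: lengths_def)
  from descendants_copy[OF scaled_proto[OF assms(2)] assms(3) this, of g]
  show thesis by (intro that) (simp add: copy_copy)
qed

lemma lengths_add:
  assumes "l \<in> lengths i j" "l' \<in> lengths j k" "j \<in> types \<sigma>"
  shows "l + l' \<in> lengths i k"
proof -
  obtain g where g: "copy (exp (- l)) g (proto \<sigma> j) \<in> descendants 0 (proto \<sigma> i)"
    using assms(1) by (auto simp: lengths_def)
  obtain h where "copy (exp (- l) * exp (- l')) h (proto \<sigma> k) \<in> descendants 0 (copy (exp (- l)) g (proto \<sigma> j))"
    using lengthsE[OF assms(2,3)] by (metis exp_gt_zero)
  then have "copy (exp (- l) * exp (- l')) h (proto \<sigma> k) \<in> descendants 0 (proto \<sigma> i)"
    using g descendants_trans by blast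
  then show ?thesis by (auto simp: lengths_def exp_add exp_minus field_simps)
qed

lemma zero_length: "0 \<in> lengths i i"
  unfolding lengths_def by (auto intro!: exI[of _ 0] descendants.self)

lemma lengths_multiple:
  assumes "a \<in> lengths i i" "i \<in> types \<sigma>" shows "real p * a \<in> lengths i i"
proof (induction p)
  case (Suc p)
  then show ?case using lengths_add[OF Suc assms] by (simp add: algebra_simps)
qed (simp add: zero_length)

lemma lengths_flow:
  assumes "i \<in> types \<sigma>" "V \<in> flow \<sigma> t (proto \<sigma> i)" "V = copy \<alpha> g (proto \<sigma> k)" "\<alpha> > 0"
  shows "t - ln \<alpha> \<in> lengths i k"
proof -
  have "V \<in> descendants 0 (copy (exp t) 0 (proto \<sigma> i))"
    using assms(2) by (auto simp: flow_eq cut_def intro: descendants_antimono[of 0 1])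
  then have "copy (exp (- t)) 0 V \<in> descendants (exp (- t) ^ DIM('a) * 0) (copy (exp (- t)) 0 (copy (exp t) 0 (proto \<sigma> i)))"
    using assms(1) by (intro descendants_copy) (auto simp: scaled_copy_proto)
  then have "copy (exp (- t) * \<alpha>) (exp (- t) *\<^sub>R g) (proto \<sigma> k) \<in> descendants 0 (proto \<sigma> i)"
    by (simp add: assms(3) copy_copy flip: exp_add)
  moreover have "exp (- (t - ln \<alpha>)) = exp (- t) * \<alpha>" using assms(4) by (simp add: exp_diff exp_minus field_simps)
  ultimately show ?thesis by (auto simp: lengths_def)
qed

lemma returns_lengths:
  assumes "i \<in> types \<sigma>" "returns \<sigma> i t" shows "t \<in> lengths i i"
proof -
  obtain V \<alpha> g where V: "V \<in> flow \<sigma> t (proto \<sigma> i)" "vol V = 1" "\<alpha> > 0" "V = copy \<alpha> g (proto \<sigma> i)"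
    using assms(2) by (auto simp: returns_def has_type_def)
  then have "\<alpha> ^ DIM('a) = 1" using assms(1) by (simp add: vol_copy_proto)
  then have "\<alpha> = 1" using V(3) power_eq_imp_eq_base[of \<alpha> "DIM('a)" 1] by simp
  then show ?thesis using lengths_flow[OF assms(1) V(1,4)] by simp
qed

definition irreducible_graph :: bool where
  "irreducible_graph \<longleftrightarrow> (\<forall>i\<in>types \<sigma>. \<forall>k\<in>types \<sigma>. \<exists>l>0. l \<in> lengths i k)"

lemma irreducible_lengths:
  assumes "irreducible_scheme \<sigma>" shows irreducible_graph
  unfolding irreducible_graph_def
proof (intro ballI)
  fix i k assume ik: "i \<in> types \<sigma>" "k \<in> types \<sigma>"
  then obtain t V where tV: "t > 0" "V \<in> flow \<sigma> t (proto \<sigma> i)" "has_type \<sigma> k V"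
    using assms unfolding irreducible_scheme_def by blast
  then obtain \<alpha> g where "\<alpha> > 0" "V = copy \<alpha> g (proto \<sigma> k)" unfolding has_type_def by blast
  note V = tV(1,2) this
  then have "\<alpha> ^ DIM('a) \<le> 1" using ik by (auto simp: flow_def vol_copy_proto)
  then have "\<alpha> \<le> 1" using one_less_power[of \<alpha> "DIM('a)"] by (force simp: not_less[symmetric])
  then have "ln \<alpha> \<le> 0" using V by simp
  then have "t - ln \<alpha> > 0" using V(1) by linarith
  then show "\<exists>l>0. l \<in> lengths i k" using lengths_flow[OF ik(1) V(2,4,3)] by blast
qed

text \<open>Two loops with incommensurable lengths may sit at different types; by irreducibility one of
  them can be moved to the type of the other, at the cost of a round trip, and not both the round
  trip and the moved loop are commensurable with the first loop.\<close>

lemma incommensurable_loops: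
  assumes irreducible_graph "incommensurable \<sigma>"
  obtains i a b where "i \<in> types \<sigma>" "a > 0" "b > 0" "a / b \<notin> \<rat>" "a \<in> lengths i i" "b \<in> lengths i i"
proof -
  obtain i j t1 t2 where t: "i \<in> types \<sigma>" "j \<in> types \<sigma>" "t1 > 0" "t2 > 0"
      "t1 \<notin> {q * t2 |q. q \<in> \<rat>}" "returns \<sigma> i t1" "returns \<sigma> j t2"
    using assms(2) unfolding incommensurable_def by - (elim bexE exE conjE, rule that)
  have l: "t1 \<in> lengths i i" "t2 \<in> lengths j j" using t returns_lengths by blast+
  obtain p where p: "p > 0" "p \<in> lengths i j"
    using assms(1) t(1,2) unfolding irreducible_graph_def by blast
  obtain r where r: "r > 0" "r \<in> lengths j i"
    using assms(1) t(1,2) unfolding irreducible_graph_def by blast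
  note pr = p(1) r(1) p(2) r(2)
  have c: "p + r \<in> lengths i i" using lengths_add[OF pr(3,4) t(2)] .
  have e: "p + t2 + r \<in> lengths i i" using lengths_add[OF lengths_add[OF pr(3) l(2) t(2)] pr(4) t(2)] .
  show thesis
  proof (cases "t1 / (p + r) \<in> \<rat> \<and> t1 / (p + t2 + r) \<in> \<rat>")
    case False
    then show thesis using that[of i t1 "p + r"] that[of i t1 "p + t2 + r"] t(1,3,4) l(1) pr(1,2) c e by auto
  next
    case True
    then have "inverse (t1 / (p + t2 + r)) - inverse (t1 / (p + r)) \<in> \<rat>" by (intro Rats_diff Rats_inverse) auto
    then have "t2 / t1 \<in> \<rat>" by (simp flip: diff_divide_distrib)
    then have "inverse (t2 / t1) \<in> \<rat>" by (rule Rats_inverse)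
    moreover have "t1 = inverse (t2 / t1) * t2" using t by simp
    ultimately show thesis using t(5) by blast
  qed
qed

text \<open>A path from \<open>i\<close> to the type with the two loops, any combination of the loops, and a path on to
  \<open>k\<close>.\<close>

lemma lengths_eventually_dense:
  assumes "irreducible_graph" "incommensurable \<sigma>" "\<delta> > 0"
  shows "\<exists>K. \<forall>i\<in>types \<sigma>. \<forall>k\<in>types \<sigma>. \<forall>x\<ge>K. \<exists>l\<in>lengths i k. x \<le> l \<and> l < x + \<delta>"
proof -
  obtain i0 a b where i0: "i0 \<in> types \<sigma>" "a > 0" "b > 0" "a / b \<notin> \<rat>" "a \<in> lengths i0 i0" "b \<in> lengths i0 i0"
    using incommensurable_loops assms by blast
  obtain K where K: "\<And>x. x \<ge> K \<Longrightarrow> \<exists>p q. x \<le> real p * a + real q * b \<and> real p * a + real q * b < x + \<delta>"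
    using combinations_eventually_dense[OF i0(2-4) assms(3)] by blast
  have "\<forall>i\<in>types \<sigma>. \<exists>l. l > 0 \<and> l \<in> lengths i i0" "\<forall>i\<in>types \<sigma>. \<exists>l. l > 0 \<and> l \<in> lengths i0 i"
    using assms(1) i0(1) unfolding irreducible_graph_def by blast+
  from this[THEN bchoice] obtain u v where u: "\<And>i. i \<in> types \<sigma> \<Longrightarrow> u i > 0 \<and> u i \<in> lengths i i0"
    and v: "\<And>i. i \<in> types \<sigma> \<Longrightarrow> v i > 0 \<and> v i \<in> lengths i0 i"
    by blast
  show ?thesis
  proof (intro exI[of _ "K + (\<Sum>i\<in>types \<sigma>. u i) + (\<Sum>i\<in>types \<sigma>. v i)"] ballI allI impI)
    fix i k x assume i: "i \<in> types \<sigma>" and k: "k \<in> types \<sigma>"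
      and x: "x \<ge> K + (\<Sum>i\<in>types \<sigma>. u i) + (\<Sum>i\<in>types \<sigma>. v i)"
    have "u i \<le> (\<Sum>i\<in>types \<sigma>. u i)" "v k \<le> (\<Sum>i\<in>types \<sigma>. v i)"
      using i k u v by (auto intro!: member_le_sum simp: less_imp_le)
    then have "x - u i - v k \<ge> K" using x by simp
    then obtain p q where pq: "x - u i - v k \<le> real p * a + real q * b" "real p * a + real q * b < x - u i - v k + \<delta>"
      using K by blast
    have "u i + (real p * a + real q * b) + v k \<in> lengths i k"
      using u[OF i] v[OF k] lengths_add[OF _ lengths_add[OF lengths_multiple[OF i0(5,1)] lengths_multiple[OF i0(6,1)] i0(1)] i0(1)]
        lengths_add[OF _ _ i0(1)] by blast
    then show "\<exists>l\<in>lengths i k. x \<le> l \<and> l < x + \<delta>"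
      using pq by (intro bexI[of _ "u i + (real p * a + real q * b) + v k"]) auto
  qed
qed

section \<open>The minimum principle\<close>

text \<open>The number \<open>m\<close> is the lower limit of \<open>N X / vol X\<close> as the volume of \<open>X\<close> tends to
  infinity.\<close>

definition liminf_density :: "('a set \<Rightarrow> real) \<Rightarrow> real \<Rightarrow> bool" where
  "liminf_density N m \<longleftrightarrow>
     (\<forall>\<eta>>0. \<exists>T. \<forall>X. scaled X \<longrightarrow> vol X \<ge> T \<longrightarrow> (m - \<eta>) * vol X \<le> N X) \<and>
     (\<forall>\<eta>>0. \<forall>T. \<exists>X. scaled X \<and> vol X \<ge> T \<and> N X \<le> (m + \<eta>) * vol X)"

lemma scaled_of_large_volume:
  assumes "i \<in> types \<sigma>" shows "\<exists>X. scaled X \<and> vol X \<ge> T"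
proof -
  define c where "c = max 1 T"
  have "T \<le> c" "1 \<le> c" by (auto simp: c_def)
  moreover have "c ^ 1 \<le> c ^ DIM('a)" using \<open>1 \<le> c\<close> DIM_positive[where 'a='a] by (intro power_increasing) auto
  ultimately have "T \<le> c ^ DIM('a)" by simp
  then show ?thesis using vol_copy_proto[OF assms, of c 0] scaled_copy_proto[OF assms, of c 0] \<open>1 \<le> c\<close>
    by (intro exI[of _ "copy c 0 (proto \<sigma> i)"]) simp
qed

text \<open>The lower limit is the supremum of the eventual lower bounds.\<close>

lemma liminf_density_exists:
  assumes i: "i \<in> types \<sigma>"
    and lo: "\<And>X. scaled X \<Longrightarrow> vol X \<ge> 1 \<Longrightarrow> lo * vol X \<le> N X"
    and hi: "\<And>X. scaled X \<Longrightarrow> vol X \<ge> 1 \<Longrightarrow> N X \<le> hi * vol X"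
  shows "\<exists>m. liminf_density N m"
proof -
  define A where "A = {c. \<exists>T. \<forall>X. scaled X \<longrightarrow> vol X \<ge> T \<longrightarrow> c * vol X \<le> N X}"
  have ne: "A \<noteq> {}" using lo unfolding A_def by blast
  have "c \<le> hi" if c: "c \<in> A" for c
  proof -
    obtain T where T: "\<And>X. scaled X \<Longrightarrow> vol X \<ge> T \<Longrightarrow> c * vol X \<le> N X" using c unfolding A_def by blast
    obtain X where "scaled X" "vol X \<ge> max T 1" using scaled_of_large_volume[OF i] by blast
    then show ?thesis using T[of X] hi[of X] scaled_vol_pos[of X]
      by (metis max.boundedE mult_le_cancel_right_pos order_trans)
  qed
  then have bdd: "bdd_above A" by (rule bdd_aboveI)
  have down: "c \<in> A" if c: "c' \<in> A" "c \<le> c'" for c c'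
  proof -
    obtain T where T: "\<And>X. scaled X \<Longrightarrow> vol X \<ge> T \<Longrightarrow> c' * vol X \<le> N X" using c(1) unfolding A_def by blast
    have "c * vol X \<le> N X" if "scaled X" "vol X \<ge> T" for X
      using T[OF that] mult_right_mono[OF \<open>c \<le> c'\<close>, of "vol X"] by (simp add: measure_nonneg)
    then show ?thesis unfolding A_def by blast
  qed
  show ?thesis
  proof (intro exI[of _ "Sup A"], unfold liminf_density_def, intro conjI allI impI)
    fix \<eta> :: real assume "\<eta> > 0"
    then have "Sup A - \<eta> < Sup A" by simp
    then obtain c where "c \<in> A" "Sup A - \<eta> < c" using less_cSupD[OF ne] by blast
    then have "Sup A - \<eta> \<in> A" using down by simp
    then show "\<exists>T. \<forall>X. scaled X \<longrightarrow> vol X \<ge> T \<longrightarrow> (Sup A - \<eta>) * vol X \<le> N X" by (simp add: A_def)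
  next
    fix \<eta> T :: real assume "\<eta> > 0"
    then have "Sup A + \<eta> \<notin> A" using cSup_upper[OF _ bdd, of "Sup A + \<eta>"] by auto
    then obtain X where "scaled X" "vol X \<ge> T" "\<not> (Sup A + \<eta>) * vol X \<le> N X"
      unfolding A_def by blast
    then show "\<exists>X. scaled X \<and> vol X \<ge> T \<and> N X \<le> (Sup A + \<eta>) * vol X"
      by (intro exI[of _ X]) simp
  qed
qed

text \<open>The function \<open>N - c vol\<close> is superadditive too, and nonnegative on all tiles that are large enough.
  So it can only decrease from a parent to a child, as long as the siblings of the child are large.\<close>

lemma superadditive_descendant:
  assumes N: "superadditive N" and T: "\<And>X. scaled X \<Longrightarrow> vol X \<ge> T \<Longrightarrow> c * vol X \<le> N X"
    and X: "scaled X" and Y: "Y \<in> descendants 0 X" "vol Y \<ge> max 1 T / min_ratio"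
  shows "N Y - c * vol Y \<le> N X - c * vol X"
  using Y
proof (induction rule: descendants.induct)
  case (child V W)
  have V: "scaled V" using child X scaled_descendant by blast
  have W: "vol W < vol V" using V child vol_child_less by blast
  have "max 1 T * min_ratio \<le> max 1 T" using min_ratio_le_half by (intro mult_left_le) auto
  then have "max 1 T \<le> max 1 T / min_ratio" using min_ratio_pos by (simp only: pos_le_divide_eq)
  then have "vol V > 1" using W child.prems by linarith
  have big: "c * vol U \<le> N U" if "U \<in> children V" for U
  proof (rule T)
    have "max 1 T \<le> min_ratio * vol W"
      using child.prems min_ratio_pos by (simp only: pos_divide_le_eq mult.commute)
    also have "\<dots> \<le> min_ratio * vol V" using W min_ratio_pos by simp
    also have "\<dots> \<le> vol U" using children_facts(4)[OF V that] .
    finally show "T \<le> vol U" by simp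
  qed (use children_facts(3)[OF V that] in auto)
  have "N W - c * vol W \<le> (\<Sum>U\<in>children V. N U - c * vol U)"
    using child children_facts(1)[OF V] big by (intro member_le_sum) auto
  also have "\<dots> = (\<Sum>U\<in>children V. N U) - c * vol V"
    by (simp add: sum_subtractf vol_children[OF V] flip: sum_distrib_left)
  also have "\<dots> \<le> N V - c * vol V" using N V \<open>vol V > 1\<close> by (simp add: superadditive_def)
  also have "\<dots> \<le> N X - c * vol X" using child W by simp
  finally show ?case .
qed simp

text \<open>Where the density of a superadditive function is close to its lower limit, it is so for all
  not too small descendants: the density of a tile is at least the mean of those of its
  descendants, none of which is much below the lower limit.\<close>

lemma minimum_principle:
  assumes irr: irreducible_graph and N: "superadditive N" and m: "liminf_density N m"
    and i: "i \<in> types \<sigma>" and K: "K > 0" and e: "\<epsilon> > 0"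
  obtains \<alpha> g where "\<alpha> > 0" "vol (copy \<alpha> g (proto \<sigma> i)) \<ge> T"
    "\<And>Y. Y \<in> descendants 0 (copy \<alpha> g (proto \<sigma> i)) \<Longrightarrow> vol (copy \<alpha> g (proto \<sigma> i)) \<le> K * vol Y \<Longrightarrow>
       N Y \<le> (m + \<epsilon>) * vol Y"
proof -
  have "\<forall>j\<in>types \<sigma>. \<exists>l. l > 0 \<and> l \<in> lengths j i"
    using irr i unfolding irreducible_graph_def by blast
  from bchoice[OF this] obtain u where u: "\<And>j. j \<in> types \<sigma> \<Longrightarrow> u j > 0 \<and> u j \<in> lengths j i"
    by blast
  define M where "M = (\<Sum>j\<in>types \<sigma>. exp (u j) ^ DIM('a))"
  have M: "exp (u j) ^ DIM('a) \<le> M" if "j \<in> types \<sigma>" for j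
    unfolding M_def using that by (intro member_le_sum) auto
  have "0 < exp (u i) ^ DIM('a)" by simp
  then have Mpos: "M > 0" using M[OF i] by linarith
  \<comment> \<open>The descendants in question fill at least the fraction \<open>1 / (K M)\<close> of the tile \<open>X0\<close> below, where the
     total excess over the lower bound \<open>m - \<eta>\<close> is at most \<open>2 \<eta>\<close> per volume.\<close>
  define \<eta> where "\<eta> = \<epsilon> / (2 * (K * M))"
  have \<eta>: "\<eta> > 0" "2 * \<eta> * (K * M) = \<epsilon>" using e K Mpos by (simp_all add: \<eta>_def)
  obtain T0 where T0: "\<And>X. scaled X \<Longrightarrow> vol X \<ge> T0 \<Longrightarrow> (m - \<eta>) * vol X \<le> N X"
    using m \<eta>(1) unfolding liminf_density_def by blast
  define T1 where "T1 = max 1 T0 / min_ratio"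
  obtain X0 where X0: "scaled X0" "vol X0 \<ge> max (M * T) (K * M * T1)" "N X0 \<le> (m + \<eta>) * vol X0"
    using m \<eta>(1) unfolding liminf_density_def by blast
  obtain j \<beta> h where j: "j \<in> types \<sigma>" "\<beta> > 0" "X0 = copy \<beta> h (proto \<sigma> j)" using X0(1) by (rule scaledE)
  obtain g where g: "copy (\<beta> * exp (- u j)) g (proto \<sigma> i) \<in> descendants 0 X0"
    using lengthsE[of "u j" j i \<beta> h] u j by blast
  define X where "X = copy (\<beta> * exp (- u j)) g (proto \<sigma> i)"
  have "vol X * exp (u j) ^ DIM('a) = (\<beta> * exp (- u j) * exp (u j)) ^ DIM('a)"
    unfolding X_def using i j by (simp add: vol_copy_proto power_mult_distrib)
  also have "\<dots> = vol X0" using j by (simp add: vol_copy_proto mult.assoc flip: exp_add)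
  finally have volX: "vol X0 = vol X * exp (u j) ^ DIM('a)" by simp
  then have XM: "vol X0 \<le> vol X * M" using M[OF j(1)] by (simp add: mult_left_mono measure_nonneg)
  show thesis
  proof (rule that[of "\<beta> * exp (- u j)" g, folded X_def])
    show "\<beta> * exp (- u j) > 0" using j by simp
    have "M * T \<le> M * vol X" using X0(2) XM by (simp add: mult.commute)
    then show "T \<le> vol X" using Mpos by simp
    fix Y assume Y: "Y \<in> descendants 0 X" "vol X \<le> K * vol Y"
    have YX0: "Y \<in> descendants 0 X0" using Y g descendants_trans X_def by blast
    have X0Y: "vol X0 \<le> K * M * vol Y"
      using order_trans[OF XM mult_right_mono[OF Y(2), of M]] Mpos by (simp add: mult_ac)
    then have "K * M * T1 \<le> K * M * vol Y" using X0(2) by simp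
    then have "T1 \<le> vol Y" using K Mpos by simp
    then have "N Y - (m - \<eta>) * vol Y \<le> N X0 - (m - \<eta>) * vol X0"
      using superadditive_descendant[OF N T0 X0(1) YX0] by (simp add: T1_def)
    also have "\<dots> \<le> 2 * \<eta> * vol X0" using X0(3) by (simp add: algebra_simps)
    also have "\<dots> \<le> 2 * \<eta> * (K * M * vol Y)" using X0Y \<eta>(1) by (intro mult_left_mono) auto
    also have "\<dots> = \<epsilon> * vol Y" using \<eta>(2) by (metis mult.assoc)
    finally have "N Y \<le> (m - \<eta> + \<epsilon>) * vol Y" by (simp add: algebra_simps)
    also have "\<dots> \<le> (m + \<epsilon>) * vol Y" using \<eta>(1) by (intro mult_right_mono) auto
    finally show "N Y \<le> (m + \<epsilon>) * vol Y" .
  qed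
qed

section \<open>Tiles of nearly prescribed volume are rare\<close>

definition window_vol :: "real \<Rightarrow> real \<Rightarrow> 'a set \<Rightarrow> real" where
  "window_vol \<theta> x X = (\<Sum>V\<in>cut 1 X. if \<theta> * x < vol V \<and> vol V \<le> x then vol V else 0)"

lemma window_vol_small:
  assumes "vol X \<le> 1"
  shows "window_vol \<theta> x X = (if \<theta> * x < vol X \<and> vol X \<le> x then vol X else 0)"
  unfolding window_vol_def cut_small[OF assms] by simp

lemma window_vol_large:
  "scaled X \<Longrightarrow> vol X > 1 \<Longrightarrow> window_vol \<theta> x X = (\<Sum>Y\<in>children X. window_vol \<theta> x Y)"
  by (simp add: window_vol_def sum_cut_large)

lemma window_vol_nonneg: "0 \<le> window_vol \<theta> x X"
  unfolding window_vol_def by (intro sum_nonneg) auto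

lemma window_vol_le: 
  assumes "scaled X" shows "window_vol \<theta> x X \<le> vol X"
proof -
  have "window_vol \<theta> x X \<le> (\<Sum>V\<in>cut 1 X. vol V)"
    unfolding window_vol_def by (intro sum_mono) auto
  then show ?thesis using vol_cut[of 1 X] assms by simp
qed

lemma window_vol_translate:
  assumes "scaled X" shows "window_vol \<theta> x (copy 1 g X) = window_vol \<theta> x X"
proof -
  have "inj_on (copy 1 g) (cut 1 X)" using inj_copy[of 1 g] by (auto intro: inj_on_subset)
  then show ?thesis
    unfolding window_vol_def cut_translate[OF assms] by (simp add: sum.reindex vol_copy cong: if_cong)
qed

lemma superadditive_window: "superadditive (\<lambda>X. - window_vol \<theta> x X)"
  by (simp add: superadditive_def window_vol_large sum_negf)

definition window_density :: "real \<Rightarrow> real \<Rightarrow> 'a set \<Rightarrow> real" where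
  "window_density \<theta> x X = window_vol \<theta> x X / vol X"

lemma window_density_nonneg: "0 \<le> window_density \<theta> x X"
  unfolding window_density_def by (intro divide_nonneg_nonneg window_vol_nonneg measure_nonneg)

text \<open>The density of a tile is the mean of those of its children, weighted by their volumes.\<close>

lemma window_density_copy_large:
  assumes "scaled X" "c > 0" "vol (copy c 0 X) > 1"
  shows "window_density \<theta> x (copy c 0 X) * vol X
    = (\<Sum>Y\<in>children X. window_density \<theta> x (copy c 0 Y) * vol Y)"
proof -
  have inj: "inj_on (copy c 0) (children X)" using inj_copy[OF assms(2), of 0] by (auto intro: inj_on_subset)
  have cd: "c ^ DIM('a) > 0" using assms by simp
  have *: "window_density \<theta> x (copy c 0 Z) * vol Z = window_vol \<theta> x (copy c 0 Z) / c ^ DIM('a)"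
    if "scaled Z" for Z
    using scaled_vol_pos[OF that] assms(2) cd by (simp add: window_density_def vol_copy)
  have "window_vol \<theta> x (copy c 0 X) = (\<Sum>Y\<in>children X. window_vol \<theta> x (copy c 0 Y))"
    using assms scaled_copy window_vol_large[of "copy c 0 X"] inj by (simp add: children_copy sum.reindex)
  then show ?thesis
    using * assms(1) children_facts(3)[OF assms(1)] by (simp add: sum_divide_distrib)
qed

text \<open>A point of \<open>X\<close> is counted in the term of \<open>s\<close> if a tile around it in the substitution tree
  of \<open>X\<close> has size close to \<open>exp s\<close> times a constant.  Since the \<open>s\<close> are further apart than the
  window is wide, distinct \<open>s\<close> need distinct tiles; these are nested, and at most \<open>1 + n0\<close>
  of them fit into the range of sizes.\<close>

lemma window_visits:
  assumes S: "finite S" "\<And>s. s \<in> S \<Longrightarrow> 0 \<le> s \<and> s \<le> K"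
    and sep: "\<And>s s'. s \<in> S \<Longrightarrow> s' \<in> S \<Longrightarrow> s < s' \<Longrightarrow> s + \<gamma> \<le> s'"
    and x: "x > 0"
    and n0: "exp K ^ DIM('a) * max_ratio ^ n0 \<le> 1"
    and X: "scaled X"
  shows "(\<Sum>s\<in>S. window_density (exp (- \<gamma>) ^ DIM('a)) x (copy (exp (- s)) 0 X)) \<le> 1 + real n0"
proof -
  define D where "D s X = window_density (exp (- \<gamma>) ^ DIM('a)) x (copy (exp (- s)) 0 X)" for s X
  define small where "small X = {s\<in>S. vol (copy (exp (- s)) 0 X) \<le> 1}" for X :: "'a set"
  have D0: "0 \<le> D s X" for s X by (simp add: D_def window_density_nonneg)
  have fin: "finite (small X)" for X using S by (simp add: small_def)
  \<comment> \<open>A copy of \<open>X\<close> that is not substituted has density 0 or 1, and the latter for at most one \<open>s\<close>.\<close>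
  have sm: "(\<Sum>s\<in>small X. D s X) \<le> 1" if X: "scaled X" for X
  proof -
    define A where "A = {s \<in> small X. exp (- \<gamma>) ^ DIM('a) * x < vol (copy (exp (- s)) 0 X) \<and> vol (copy (exp (- s)) 0 X) \<le> x}"
    have val: "D s X = (if s \<in> A then 1 else 0)" if "s \<in> small X" for s
      using that X scaled_vol_pos[OF scaled_copy[of X "exp (- s)" 0]]
      by (simp add: A_def small_def D_def window_density_def window_vol_small)
    have no: False if "s \<in> A" "s' \<in> A" "s < s'" for s s'
    proof -
      have "exp (- s') \<le> exp (- \<gamma>) * exp (- s)"
        using sep[of s s'] that by (simp add: A_def small_def flip: exp_add)
      then have "exp (- s') ^ DIM('a) \<le> (exp (- \<gamma>) * exp (- s)) ^ DIM('a)"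
        by (intro power_mono) auto
      then have "vol (copy (exp (- s')) 0 X) \<le> exp (- \<gamma>) ^ DIM('a) * vol (copy (exp (- s)) 0 X)"
        by (simp add: vol_copy power_mult_distrib mult_right_mono measure_nonneg flip: mult.assoc)
      also have "\<dots> \<le> exp (- \<gamma>) ^ DIM('a) * x" using that by (intro mult_left_mono) (auto simp: A_def)
      finally show False using that by (simp add: A_def)
    qed
    then have "\<forall>s\<in>A. \<forall>s'\<in>A. s = s'" by (meson linorder_neqE)
    moreover have "finite A" using fin[of X] by (simp add: A_def)
    ultimately have "card A \<le> Suc 0" by (simp add: card_le_Suc0_iff_eq)
    have "(\<Sum>s\<in>small X. D s X) = (\<Sum>s\<in>A. 1)"
      using val fin by (simp add: sum.If_cases Int_absorb1 A_def Collect_conj_eq sum.inter_restrict[symmetric])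
    then show ?thesis using \<open>card A \<le> Suc 0\<close> by simp
  qed
  \<comment> \<open>The copies of \<open>X\<close> that are substituted contribute the mean of the children.\<close>
  have step: "(\<Sum>s\<in>S. D s X) \<le> B + (\<Sum>s\<in>small X. D s X)"
    if X: "scaled X" and B: "\<And>Y. Y \<in> children X \<Longrightarrow> (\<Sum>s\<in>S. D s Y) \<le> B" for X B
  proof -
    have "(\<Sum>s\<in>S - small X. D s X) * vol X = (\<Sum>s\<in>S - small X. \<Sum>Y\<in>children X. D s Y * vol Y)"
      unfolding sum_distrib_right D_def
      by (intro sum.cong refl window_density_copy_large X) (auto simp: small_def)
    also have "\<dots> \<le> (\<Sum>s\<in>S. \<Sum>Y\<in>children X. D s Y * vol Y)"
      using S D0 by (intro sum_mono2) (auto intro!: sum_nonneg mult_nonneg_nonneg)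
    also have "\<dots> = (\<Sum>Y\<in>children X. (\<Sum>s\<in>S. D s Y) * vol Y)"
      by (subst sum.swap) (simp add: sum_distrib_right)
    also have "\<dots> \<le> (\<Sum>Y\<in>children X. B * vol Y)"
      using B by (intro sum_mono mult_right_mono) auto
    also have "\<dots> = B * vol X" using vol_children[OF X] by (simp flip: sum_distrib_left)
    finally have "(\<Sum>s\<in>S - small X. D s X) \<le> B" using scaled_vol_pos[OF X] by simp
    moreover have "(\<Sum>s\<in>S. D s X) = (\<Sum>s\<in>S - small X. D s X) + (\<Sum>s\<in>small X. D s X)"
      using S by (intro sum.subset_diff) (auto simp: small_def)
    ultimately show ?thesis by simp
  qed
  have le1: "vol (copy (exp (- s)) 0 Y) \<le> 1" if "s \<in> S" "vol Y \<le> 1" for s and Y :: "'a set"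
  proof -
    have "exp (- s) ^ DIM('a) \<le> 1" using S(2)[OF that(1)] by (intro power_le_one) auto
    then show ?thesis using that by (simp add: vol_copy mult_le_one)
  qed
  \<comment> \<open>Each generation adds at most 1, as long as some copy is not substituted \<dots>\<close>
  have bound: "scaled X \<Longrightarrow> vol X * max_ratio ^ n \<le> 1 \<Longrightarrow> (\<Sum>s\<in>S. D s X) \<le> 1 + real n" for n X
  proof (induction n arbitrary: X)
    case 0
    then have "small X = S" using le1 by (auto simp: small_def)
    then show ?case using sm[OF 0(1)] by simp
  next
    case (Suc n)
    have "(\<Sum>s\<in>S. D s Y) \<le> 1 + real n" if Y: "Y \<in> children X" for Y
    proof (rule Suc.IH)
      have "vol Y * max_ratio ^ n \<le> (max_ratio * vol X) * max_ratio ^ n"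
        using children_facts(5)[OF Suc.prems(1) Y] max_ratio_pos by (intro mult_right_mono) auto
      then show "vol Y * max_ratio ^ n \<le> 1" using Suc.prems by (simp add: mult_ac)
    qed (use children_facts(3) Suc.prems Y in auto)
    from step[OF Suc.prems(1) this] show ?case using sm[OF Suc.prems(1)] by simp
  qed
  \<comment> \<open>\<dots> and above volume \<open>exp K\<close> to the power of the dimension, all copies are substituted.\<close>
  have mp: "max_ratio ^ n0 > 0" using max_ratio_pos by simp
  have "(1 / max_ratio ^ n0) > 0" using mp by simp
  from this X have "(\<Sum>s\<in>S. D s X) \<le> 1 + real n0"
  proof (induction rule: volume_induct)
    case (small X)
    then show ?case using bound mp by (simp add: field_simps)
  next
    case (large X)
    have "vol (copy (exp (- s)) 0 X) > 1" if "s \<in> S" for s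
    proof -
      have "exp K ^ DIM('a) \<le> 1 / max_ratio ^ n0" using n0 mp by (simp add: pos_le_divide_eq)
      also have "\<dots> < vol X" using large(2) .
      finally have "exp (- s) ^ DIM('a) * exp K ^ DIM('a) < exp (- s) ^ DIM('a) * vol X" by simp
      moreover have "exp (- s) ^ DIM('a) * exp K ^ DIM('a) \<ge> 1"
        using S(2)[OF that] by (simp flip: power_mult_distrib exp_add add: one_le_power)
      ultimately have "1 < exp (- s) ^ DIM('a) * vol X" by linarith
      then show ?thesis by (simp add: vol_copy)
    qed
    then have "small X = {}" by (simp add: small_def not_le)
    then show ?case using step[OF large(1) large.IH] by simp
  qed
  then show ?thesis by (simp add: D_def)
qed

lemma irrational_combination_inj:
  fixes a b :: real
  assumes "a > 0" "b > 0" "a / b \<notin> \<rat>" shows "inj (\<lambda>(p, q). real p * a + real q * b)"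
proof (rule injI)
  fix u v :: "nat \<times> nat"
  obtain p q p' q' where uv: "u = (p, q)" "v = (p', q')" by (metis surj_pair)
  assume "(case u of (p, q) \<Rightarrow> real p * a + real q * b) = (case v of (p, q) \<Rightarrow> real p * a + real q * b)"
  then have eq: "(real p - real p') * a = (real q' - real q) * b" by (simp add: uv algebra_simps)
  have "p = p'"
  proof (rule ccontr)
    assume "p \<noteq> p'"
    then have "a / b = (real q' - real q) / (real p - real p')" using eq assms by (simp add: field_simps)
    moreover have "(real q' - real q) / (real p - real p') \<in> \<rat>" by (intro Rats_divide Rats_diff) auto
    ultimately show False using assms(3) by simp
  qed
  then show "u = v" using eq assms by (simp add: uv)
qed

text \<open>If the tiles of volume close to \<open>x\<close> kept a density \<open>c\<close>, then by the minimum principle they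
  would have density at least \<open>c / 2\<close> at the same place for all sizes given by combinations
  \<open>p a + q b\<close>, \<open>p, q \<le> n\<close>, of two incommensurable loops.  There are quadratically many of these in a
  range of linear length, more than a point has ancestors.\<close>

lemma window_rare:
  assumes irr: irreducible_graph and inc: "incommensurable \<sigma>" and c: "c > 0" and x: "x > 0"
  shows "\<exists>\<theta>. 0 < \<theta> \<and> \<theta> < 1 \<and> (\<exists>T. \<forall>X. scaled X \<longrightarrow> vol X \<ge> T \<longrightarrow> window_vol \<theta> x X \<le> c * vol X)"
proof -
  obtain i a b where i: "i \<in> types \<sigma>" "a > 0" "b > 0" "a / b \<notin> \<rat>" "a \<in> lengths i i" "b \<in> lengths i i"
    using incommensurable_loops irr inc by blast
  have "(\<lambda>n. exp (a + b) ^ DIM('a) * max_ratio ^ n) \<longlonglongrightarrow> exp (a + b) ^ DIM('a) * 0"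
    using max_ratio_pos max_ratio_less_1 by (intro tendsto_mult tendsto_const LIMSEQ_power_zero) auto
  then have "eventually (\<lambda>n. exp (a + b) ^ DIM('a) * max_ratio ^ n < 1) sequentially"
    by (rule order_tendstoD(2)) simp
  then obtain r where r: "exp (a + b) ^ DIM('a) * max_ratio ^ r < 1" using eventually_happens by force
  \<comment> \<open>Now \<open>n\<close> is so large that \<open>(n + 1)\<^sup>2\<close> densities \<open>c / 2\<close> exceed the bound \<open>1 + r n\<close>.\<close>
  define n where "n = nat \<lceil>(1 + real r) * 2 / c\<rceil>"
  have "(1 + real r) * 2 / c \<le> real n" unfolding n_def by (rule real_nat_ceiling_ge)
  then have n1: "1 + real r \<le> real n * (c / 2)" using c by (simp add: field_simps)
  have "n > 0" using n1 by (cases "n = 0") auto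
  then have "1 + real (r * n) < (real n + 1) * (1 + real r)" by (simp add: algebra_simps)
  also have "\<dots> \<le> (real n + 1) * ((real n + 1) * (c / 2))"
    using n1 c by (intro mult_left_mono) (auto simp: algebra_simps)
  finally have n: "1 + real (r * n) < real ((n + 1) * (n + 1)) * (c / 2)" by (simp add: algebra_simps)
  define S where "S = (\<lambda>(p, q). real p * a + real q * b) ` ({..n} \<times> {..n})"
  have Sfin: "finite S" by (simp add: S_def)
  have cardS: "card S = (n + 1) * (n + 1)"
    unfolding S_def by (subst card_image) (use irrational_combination_inj[OF i(2-4)] in \<open>auto intro: inj_on_subset\<close>)
  define K where "K = real n * (a + b)"
  have SK: "0 \<le> s \<and> s \<le> K \<and> s \<in> lengths i i" if s: "s \<in> S" for s
  proof -
    obtain p q where pq: "p \<le> n" "q \<le> n" "s = real p * a + real q * b" using s by (auto simp: S_def)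
    then have "real p * a \<le> real n * a" "real q * b \<le> real n * b" using i by (auto intro: mult_right_mono)
    then have "s \<le> K" unfolding pq(3) K_def by (simp add: distrib_left)
    then show ?thesis
      using pq i lengths_add[OF lengths_multiple[OF i(5,1)] lengths_multiple[OF i(6,1)] i(1)]
      by auto
  qed
  \<comment> \<open>The smallest gap determines the width of the window.\<close>
  define \<gamma> where "\<gamma> = Min (insert 1 ((\<lambda>(s, s'). \<bar>s - s'\<bar>) ` ((S \<times> S) - Id)))"
  have fin: "finite (insert 1 ((\<lambda>(s, s'). \<bar>s - s'\<bar>) ` ((S \<times> S) - Id)))" using Sfin by simp
  have \<gamma>: "\<gamma> > 0" unfolding \<gamma>_def using fin by (subst Min_gr_iff) auto
  have sep: "s + \<gamma> \<le> s'" if "s \<in> S" "s' \<in> S" "s < s'" for s s'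
  proof -
    have "\<gamma> \<le> \<bar>s - s'\<bar>" unfolding \<gamma>_def using fin that by (intro Min_le) force+
    then show ?thesis using that by simp
  qed
  define \<theta> where "\<theta> = exp (- \<gamma>) ^ DIM('a)"
  have \<theta>: "0 < \<theta>" "\<theta> < 1" using \<gamma> by (simp_all add: \<theta>_def power_less_one_iff)
  have "exp K ^ DIM('a) * max_ratio ^ (r * n) = (exp (a + b) ^ DIM('a) * max_ratio ^ r) ^ n"
    unfolding K_def by (simp add: exp_of_nat_mult power_mult_distrib mult.commute flip: power_mult)
  also have "\<dots> \<le> 1" using r max_ratio_pos by (intro power_le_one) auto
  finally have n0: "exp K ^ DIM('a) * max_ratio ^ (r * n) \<le> 1" .
  define N where "N X = - window_vol \<theta> x X" for X
  have N: "superadditive N" unfolding N_def by (rule superadditive_window)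
  obtain m where m: "liminf_density N m"
    using liminf_density_exists[OF i(1), of "-1" N 0] window_vol_nonneg window_vol_le by (auto simp: N_def)
  have "- m < c"
  proof (rule ccontr)
    assume mc: "\<not> - m < c"
    obtain \<alpha> g where X: "\<alpha> > 0"
      "\<And>Y. Y \<in> descendants 0 (copy \<alpha> g (proto \<sigma> i)) \<Longrightarrow> vol (copy \<alpha> g (proto \<sigma> i)) \<le> exp K ^ DIM('a) * vol Y \<Longrightarrow>
         N Y \<le> (m + c / 2) * vol Y"
      using minimum_principle[OF irr N m i(1) _ half_gt_zero[OF c], of "exp K ^ DIM('a)" 1]
      by (metis exp_gt_zero zero_less_power)
    define X where "X = copy \<alpha> g (proto \<sigma> i)"
    have sX: "scaled X" unfolding X_def using X(1) i scaled_copy_proto by blast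
    have "c / 2 \<le> window_density \<theta> x (copy (exp (- s)) 0 X)" if s: "s \<in> S" for s
    proof -
      obtain h where h: "copy (\<alpha> * exp (- s)) h (proto \<sigma> i) \<in> descendants 0 X"
        using lengthsE[of s i i \<alpha> g] SK[OF s] i X unfolding X_def by blast
      define Y where "Y = copy (\<alpha> * exp (- s)) h (proto \<sigma> i)"
      have sY: "scaled Y" unfolding Y_def using X(1) i by (intro scaled_copy_proto) auto
      have "exp (- s) * exp K \<ge> 1" using SK[OF s] by (simp flip: exp_add)
      then have "\<alpha> ^ DIM('a) * 1 \<le> \<alpha> ^ DIM('a) * (exp (- s) * exp K) ^ DIM('a)"
        using X(1) by (intro mult_left_mono one_le_power) auto
      then have "vol X \<le> exp K ^ DIM('a) * vol Y"
        unfolding X_def Y_def using X(1) i by (simp add: vol_copy_proto power_mult_distrib mult_ac)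
      then have "N Y \<le> (m + c / 2) * vol Y" using X(2)[folded X_def] h Y_def by blast
      also have "\<dots> \<le> (- (c / 2)) * vol Y" using mc by (intro mult_right_mono) auto
      finally have "c / 2 \<le> window_density \<theta> x Y"
        using scaled_vol_pos[OF sY] by (simp add: N_def window_density_def field_simps)
      moreover have "copy (exp (- s)) 0 X = copy 1 (exp (- s) *\<^sub>R g - h) Y"
        unfolding X_def Y_def by (simp add: copy_copy mult.commute)
      ultimately show ?thesis using sY
        by (simp add: window_density_def window_vol_translate vol_copy)
    qed
    then have "(\<Sum>s\<in>S. c / 2) \<le> (\<Sum>s\<in>S. window_density \<theta> x (copy (exp (- s)) 0 X))"
      by (rule sum_mono)
    also have "\<dots> \<le> 1 + real (r * n)"
      unfolding \<theta>_def by (rule window_visits[OF Sfin _ sep x n0 sX]) (use SK in auto)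
    finally show False using n cardS by simp
  qed
  then obtain T where "\<And>X. scaled X \<Longrightarrow> vol X \<ge> T \<Longrightarrow> (m - (m + c)) * vol X \<le> N X"
    using m unfolding liminf_density_def by (metis add.commute less_add_same_cancel2 minus_add_cancel neg_less_iff_less add_strict_left_mono add.right_inverse)
  then show ?thesis using \<theta> by (auto simp: N_def)
qed

end

section \<open>Positions of a patch\<close>

lemma bounded_frontier: "bounded (S::'a::euclidean_space set) \<Longrightarrow> bounded (frontier S)"
  using compact_frontier_bounded compact_imp_bounded by blast

text \<open>Scaling down to the prototile turns \<open>r\<close> into a small radius.\<close>

lemma (in normalized_scheme) boundary_rare:
  assumes "r \<ge> 0" "e > 0"
  shows "\<exists>T. \<forall>V. scaled V \<longrightarrow> vol V \<ge> T \<longrightarrow> vol (thicken (frontier V) r) \<le> e * vol V"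
proof -
  have "\<forall>j\<in>types \<sigma>. \<exists>s. s > 0 \<and> vol (thicken (frontier (proto \<sigma> j)) s) \<le> e"
    using tile_proto assms by (auto simp: tile_def intro!: vol_thicken_tendsto_0 bounded_frontier)
  from bchoice[OF this] obtain s where s: "\<And>j. j \<in> types \<sigma> \<Longrightarrow> s j > 0"
      "\<And>j. j \<in> types \<sigma> \<Longrightarrow> vol (thicken (frontier (proto \<sigma> j)) (s j)) \<le> e" by blast
  define s0 where "s0 = Min (insert 1 (s ` types \<sigma>))"
  have s0: "s0 > 0" using s by (simp add: s0_def)
  show ?thesis
  proof (intro exI[of _ "(r / s0) ^ DIM('a)"] allI impI)
    fix V assume V: "scaled V" "(r / s0) ^ DIM('a) \<le> vol V"
    obtain j \<alpha> g where j: "j \<in> types \<sigma>" "\<alpha> > 0" "V = copy \<alpha> g (proto \<sigma> j)" using V(1) by (rule scaledE)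
    have fr: "bounded (frontier (proto \<sigma> j))" using tile_proto[OF j(1)] by (simp add: tile_def bounded_frontier)
    have volV: "vol V = \<alpha> ^ DIM('a)" using j by (simp add: vol_copy_proto)
    have "r / s0 \<le> \<alpha>"
      using power_strict_mono[of \<alpha> "r / s0" "DIM('a)"] V(2) j(2) unfolding volV by fastforce
    then have "r / \<alpha> \<le> s0" using j s0 by (simp add: field_simps)
    also have "s0 \<le> s j" unfolding s0_def using j by (intro Min_le) auto
    finally have "vol (thicken (frontier (proto \<sigma> j)) (r / \<alpha>)) \<le> vol (thicken (frontier (proto \<sigma> j)) (s j))"
      using fr by (intro measure_mono_fmeasurable thicken_mono lmeasurable_thicken fmeasurableD)
    also have "\<dots> \<le> e" using s j by simp
    finally show "vol (thicken (frontier V) r) \<le> e * vol V"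
      using j volV by (simp add: frontier_copy thicken_copy vol_copy mult_left_mono mult.commute)
  qed
qed

text \<open>The number \<open>R\<close> bounds the distance of a copy of \<open>P\<close>, at any scale in \<open>I\<close>, from its position.\<close>

locale patch_in_scheme = normalized_scheme +
  fixes P :: "'a set set" and I :: "real set" and R :: real
  assumes irreducible: irreducible_graph and incommensurable: "incommensurable \<sigma>"
    and P: "finite P" "P \<noteq> {}" "\<And>V. V \<in> P \<Longrightarrow> tile V"
    and I: "is_interval I" "bdd_above I" "1 \<in> I"
    and R: "R > 0" "\<And>\<alpha>. \<alpha> \<in> I \<Longrightarrow> \<alpha> > 0 \<Longrightarrow> copy \<alpha> 0 (\<Union>P) \<subseteq> cball 0 R"
begin

lemma copy_patch_subset:
  assumes "\<alpha> \<in> I" "\<alpha> > 0" "V \<in> P" shows "copy \<alpha> g V \<subseteq> cball g R"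
proof
  fix x assume "x \<in> copy \<alpha> g V"
  then obtain y where y: "y \<in> V" "x = g + \<alpha> *\<^sub>R y" by (auto simp: copy_def)
  then have "\<alpha> *\<^sub>R y \<in> copy \<alpha> 0 (\<Union>P)" using assms(3) by (auto simp: copy_def)
  then have "\<alpha> *\<^sub>R y \<in> cball 0 R" using R(2)[OF assms(1,2)] by blast
  then show "x \<in> cball g R" using y by (simp add: dist_norm)
qed

definition is_position :: "'a set set \<Rightarrow> 'a \<Rightarrow> bool" where
  "is_position C g \<longleftrightarrow> (\<exists>\<alpha>\<in>I. \<alpha> > 0 \<and> copy \<alpha> g ` P \<subseteq> C)"

text \<open>Copies of different scales may have the same position, even if they lie in different children of
  \<open>X\<close>.  The condition on the ball puts the position into the interior of \<open>X\<close> itself, so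
  tiles with disjoint interiors have no position in common and the number is superadditive.\<close>

definition positions :: "'a set \<Rightarrow> 'a set" where
  "positions X = {g. cball g R \<subseteq> X \<and> is_position (cut 1 X) g}"

definition num_positions :: "'a set \<Rightarrow> real" where
  "num_positions X = real (card (positions X))"

text \<open>Positions are counted through the copy of one tile of the patch, at one of the scales that occur.\<close>

definition base_tile :: "'a set" where "base_tile = (SOME V. V \<in> P)"

lemma base_tile: "base_tile \<in> P" "tile base_tile"
  using P someI_ex[of "\<lambda>V. V \<in> P"] by (auto simp: base_tile_def)

definition scale_at :: "'a set set \<Rightarrow> 'a \<Rightarrow> real" where
  "scale_at C g = (SOME \<alpha>. \<alpha> \<in> I \<and> \<alpha> > 0 \<and> copy \<alpha> g ` P \<subseteq> C)"

definition anchor :: "'a set set \<Rightarrow> 'a \<Rightarrow> 'a set" where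
  "anchor C g = copy (scale_at C g) g base_tile"

lemma scale_at:
  assumes "is_position C g"
  shows "scale_at C g \<in> I" "scale_at C g > 0" "copy (scale_at C g) g ` P \<subseteq> C"
  using assms someI_ex[of "\<lambda>\<alpha>. \<alpha> \<in> I \<and> \<alpha> > 0 \<and> copy \<alpha> g ` P \<subseteq> C"]
  unfolding is_position_def scale_at_def by blast+

lemma anchor_mem: "is_position C g \<Longrightarrow> anchor C g \<in> C"
  using scale_at(3) base_tile by (auto simp: anchor_def)

lemma anchor_subset: "is_position C g \<Longrightarrow> anchor C g \<subseteq> cball g R"
  using scale_at copy_patch_subset base_tile by (simp add: anchor_def)

text \<open>The anchor determines the scale and the position, so positions are at most as many as tiles.\<close>

lemma inj_anchor: "inj_on (anchor C) {g. is_position C g}"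
proof (rule inj_onI)
  fix g h assume "g \<in> {g. is_position C g}" "h \<in> {g. is_position C g}" "anchor C g = anchor C h"
  then show "g = h" using copy_eqD[OF base_tile(2), of "scale_at C g" "scale_at C h" g h] scale_at(2)
    by (simp add: anchor_def)
qed

lemma positions_count:
  assumes C: "packing C" "\<And>V. V \<in> C \<Longrightarrow> vol V \<ge> w" "w > 0"
    and E: "\<And>g. g \<in> E \<Longrightarrow> is_position C g" "\<And>g. g \<in> E \<Longrightarrow> cball g R \<subseteq> U" and U: "U \<in> lmeasurable"
  shows "finite E \<and> real (card E) \<le> vol U / w"
proof -
  have sub: "anchor C ` E \<subseteq> C" "\<And>V. V \<in> anchor C ` E \<Longrightarrow> V \<subseteq> U"
    using E anchor_mem anchor_subset by blast+
  have "finite (anchor C ` E) \<and> real (card (anchor C ` E)) \<le> vol U / w"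
    using sub C by (intro packing_count[OF packing_subset[OF C(1)]] U) auto
  moreover have "inj_on (anchor C) E" using E inj_on_subset[OF inj_anchor[of C], of E] by blast
  ultimately show ?thesis by (simp add: card_image finite_image_iff)
qed

lemma num_positions_facts:
  assumes X: "scaled X" shows "finite (positions X)"
    and "vol X \<ge> 1 \<Longrightarrow> num_positions X \<le> vol X / min_ratio"
proof -
  have E: "is_position (cut 1 X) g" "cball g R \<subseteq> X" if "g \<in> positions X" for g
    using that by (auto simp: positions_def)
  have "anchor (cut 1 X) ` positions X \<subseteq> cut 1 X" using E anchor_mem by blast
  then have "finite (anchor (cut 1 X) ` positions X)" using finite_cut[of 1 X] X finite_subset by auto
  moreover have "inj_on (anchor (cut 1 X)) (positions X)"
    using E inj_on_subset[OF inj_anchor[of "cut 1 X"], of "positions X"] by blast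
  ultimately show "finite (positions X)" by (simp add: finite_image_iff)
  show "num_positions X \<le> vol X / min_ratio" if "vol X \<ge> 1"
  proof -
    have "min_ratio \<le> vol V" if V: "V \<in> cut 1 X" for V using vol_cut_ge[of 1 X V] X \<open>vol X \<ge> 1\<close> V by simp
    from positions_count[OF packing_cut[OF _ X] this min_ratio_pos E tile_lmeasurable[OF scaled_tile[OF X]]]
    show ?thesis by (simp add: num_positions_def)
  qed
qed

lemma is_position_mono: "is_position C g \<Longrightarrow> C \<subseteq> D \<Longrightarrow> is_position D g"
  unfolding is_position_def by blast

lemma positions_mono:
  assumes "scaled X" "V \<in> descendants 1 X" shows "positions V \<subseteq> positions X"
proof -
  have "V \<subseteq> X" "cut 1 V \<subseteq> cut 1 X" using assms descendant_subset cut_descendant by blast+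
  then show ?thesis using is_position_mono unfolding positions_def by blast
qed

lemma num_positions_mono:
  assumes "scaled X" "V \<in> descendants 1 X" shows "num_positions V \<le> num_positions X"
  unfolding num_positions_def using positions_mono[OF assms] num_positions_facts(1)[OF assms(1)]
  by (simp add: card_mono)

lemma position_interior: "g \<in> positions X \<Longrightarrow> g \<in> interior X"
  using R(1) by (auto simp: positions_def mem_interior_cball)

lemma superadditive_num_positions: "superadditive num_positions"
  unfolding superadditive_def
proof (intro allI impI)
  fix X assume X: "scaled X" "vol X > 1"
  note ch = children_facts[OF X(1)]
  have "(\<Sum>Y\<in>children X. num_positions Y) = real (\<Sum>Y\<in>children X. card (positions Y))"
    by (simp add: num_positions_def)
  also have "(\<Sum>Y\<in>children X. card (positions Y)) = card (\<Union>Y\<in>children X. positions Y)"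
  proof (rule card_UN_disjoint[symmetric])
    show "\<forall>Y\<in>children X. \<forall>Y'\<in>children X. Y \<noteq> Y' \<longrightarrow> positions Y \<inter> positions Y' = {}"
      using ch(2) position_interior unfolding tessellation_def pairwise_def by blast
  qed (use ch num_positions_facts(1) in auto)
  also have "\<dots> \<le> card (positions X)"
    using positions_mono[OF X(1)] descendants.child[OF descendants.self X(2)] num_positions_facts(1)[OF X(1)]
    by (intro card_mono) blast+
  finally show "(\<Sum>Y\<in>children X. num_positions Y) \<le> num_positions X" by (simp add: num_positions_def)
qed

lemma num_positions_translate:
  assumes "scaled X" shows "num_positions (copy 1 t X) = num_positions X"
proof -
  have sub: "(+) t ` positions X \<subseteq> positions (copy 1 t X)" if X: "scaled X" for X t
  proof
    fix y assume "y \<in> (+) t ` positions X"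
    then obtain g \<alpha> where g: "y = t + g" "cball g R \<subseteq> X" "\<alpha> \<in> I" "\<alpha> > 0" "copy \<alpha> g ` P \<subseteq> cut 1 X"
      by (auto simp: positions_def is_position_def)
    have "cball y R \<subseteq> copy 1 t X"
    proof
      fix z assume "z \<in> cball y R"
      then have "z - t \<in> cball g R" by (simp add: g(1) dist_norm algebra_simps)
      then have "z - t \<in> X" using g(2) by blast
      then show "z \<in> copy 1 t X" unfolding copy_def by (intro image_eqI[of _ _ "z - t"]) auto
    qed
    moreover have "copy \<alpha> y ` P \<subseteq> cut 1 (copy 1 t X)"
      unfolding cut_translate[OF X] using g(5) by (force simp: g(1) copy_copy image_iff)
    ultimately show "y \<in> positions (copy 1 t X)" using g by (auto simp: positions_def is_position_def)
  qed
  have "(+) (- t) ` positions (copy 1 t X) \<subseteq> positions X"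
    using sub[OF scaled_copy[OF assms, of 1 t], of "- t"] by (simp add: copy_copy)
  then have "positions (copy 1 t X) \<subseteq> (+) t ` positions X" by (force simp: image_iff subset_iff)
  then have "positions (copy 1 t X) = (+) t ` positions X" using sub[OF assms] by blast
  then show ?thesis by (simp add: num_positions_def card_image)
qed

text \<open>If the ball around a position \<open>g\<close> in \<open>V\<close> is contained in \<open>V\<close>, then the tiles of the copy of
  \<open>P\<close> at \<open>g\<close> are tiles of \<open>cut 1 V\<close>.  Otherwise \<open>g\<close> is within \<open>R\<close> of the boundary of \<open>V\<close>, and its
  anchor within \<open>2 R\<close>, so volume bounds the number of such positions.\<close>

lemma positions_in_union:
  assumes C: "packing C" "\<And>V. V \<in> C \<Longrightarrow> vol V \<ge> min_ratio"
    and D: "finite D" "\<And>V. V \<in> D \<Longrightarrow> scaled V" "\<And>V. V \<in> D \<Longrightarrow> cut 1 V \<subseteq> C"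
    and E: "E \<subseteq> \<Union>D" "\<And>g. g \<in> E \<Longrightarrow> is_position C g"
  shows "finite E \<and> real (card E) \<le> (\<Sum>V\<in>D. num_positions V + vol (thicken (frontier V) (2 * R)) / min_ratio)"
proof -
  define B where "B V = {g \<in> E. g \<in> thicken (frontier V) R}" for V
  have B: "finite (B V) \<and> real (card (B V)) \<le> vol (thicken (frontier V) (2 * R)) / min_ratio" if V: "V \<in> D" for V
  proof (rule positions_count[OF C min_ratio_pos])
    show "cball g R \<subseteq> thicken (frontier V) (2 * R)" if "g \<in> B V" for g
      using that thicken_add[of g "frontier V" R _ R] by (auto simp: B_def dist_commute)
    show "thicken (frontier V) (2 * R) \<in> lmeasurable"
      using scaled_tile[OF D(2)[OF V]] by (intro lmeasurable_thicken) (simp add: tile_def bounded_frontier)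
  qed (use E in \<open>auto simp: B_def\<close>)
  have cover: "E \<subseteq> (\<Union>V\<in>D. positions V \<union> B V)"
  proof
    fix g assume g: "g \<in> E"
    then obtain V where V: "V \<in> D" "g \<in> V" using E by blast
    show "g \<in> (\<Union>V\<in>D. positions V \<union> B V)"
    proof (cases "cball g R \<subseteq> V")
      case True
      have "copy (scale_at C g) g U \<in> cut 1 V" if U: "U \<in> P" for U
      proof (rule packing_covered_mem[OF C(1) D(3)[OF V(1)] finite_cut[OF _ D(2)[OF V(1)]]])
        show "copy (scale_at C g) g U \<in> C" using scale_at(3)[OF E(2)[OF g]] U by blast
        have "copy (scale_at C g) g U \<subseteq> V"
          using copy_patch_subset[OF scale_at(1,2)[OF E(2)[OF g]] U, of g] True by blast
        then show "copy (scale_at C g) g U \<subseteq> \<Union>(cut 1 V)" using Union_cut[OF _ D(2)[OF V(1)], of 1] by simp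
      qed auto
      then have "g \<in> positions V"
        using True scale_at(1,2)[OF E(2)[OF g]] by (auto simp: positions_def is_position_def)
      then show ?thesis using V by blast
    next
      case False
      have "g \<in> cball g R" using R(1) by simp
      then have "cball g R \<inter> frontier V \<noteq> {}"
        using V False by (intro connected_Int_frontier connected_cball) blast+
      then obtain y where "y \<in> frontier V" "dist g y \<le> R" by auto
      then have "g \<in> B V" using g thicken_point[of y "frontier V" g R] by (simp add: B_def)
      then show ?thesis using V by blast
    qed
  qed
  have fin: "finite (\<Union>V\<in>D. positions V \<union> B V)"
    using D B num_positions_facts(1) by blast
  have "card E \<le> card (\<Union>V\<in>D. positions V \<union> B V)" by (rule card_mono[OF fin cover])
  also have "\<dots> \<le> (\<Sum>V\<in>D. card (positions V \<union> B V))" by (rule card_UN_le[OF D(1)])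
  also have "\<dots> \<le> (\<Sum>V\<in>D. card (positions V) + card (B V))" by (intro sum_mono card_Un_le)
  finally have "real (card E) \<le> real (\<Sum>V\<in>D. card (positions V) + card (B V))" by (rule of_nat_mono)
  also have "\<dots> \<le> (\<Sum>V\<in>D. num_positions V + vol (thicken (frontier V) (2 * R)) / min_ratio)"
    unfolding of_nat_sum of_nat_add num_positions_def using B by (intro sum_mono add_left_mono) blast
  finally show ?thesis using finite_subset[OF cover fin] by blast
qed

section \<open>Densities vary slowly\<close>

lemma card_window_le:
  assumes "scaled X" "vol X \<ge> 1"
  shows "real (card {V \<in> cut 1 X. \<theta> * x < vol V \<and> vol V \<le> x}) \<le> window_vol \<theta> x X / min_ratio"
proof -
  have "real (card {V \<in> cut 1 X. \<theta> * x < vol V \<and> vol V \<le> x}) * min_ratio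
      = (\<Sum>V\<in>{V \<in> cut 1 X. \<theta> * x < vol V \<and> vol V \<le> x}. min_ratio)" by simp
  also have "\<dots> \<le> (\<Sum>V\<in>{V \<in> cut 1 X. \<theta> * x < vol V \<and> vol V \<le> x}. vol V)"
    using vol_cut_ge[of 1 X] assms by (intro sum_mono) auto
  also have "\<dots> = window_vol \<theta> x X"
    unfolding window_vol_def using finite_cut[of 1 X] assms by (simp add: sum.inter_filter)
  finally show ?thesis using min_ratio_pos by (simp add: field_simps)
qed

text \<open>Under inflation by \<open>exp v\<close> a position is lost only if its scale leaves \<open>I\<close> at the upper end, or
  if a tile of the copy becomes larger than volume 1.  Either way the volume of the anchor is in one
  of finitely many windows.\<close>

lemma lost_position:
  assumes Y: "scaled Y" and v: "v \<ge> 0"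
    and g: "g \<in> positions Y" "exp v *\<^sub>R g \<notin> positions (copy (exp v) 0 Y)"
  shows "\<exists>x\<in>insert (Sup I ^ DIM('a) * vol base_tile) ((\<lambda>U. vol base_tile / vol U) ` P).
    exp (- v) ^ DIM('a) * x \<le> vol (anchor (cut 1 Y) g) \<and> vol (anchor (cut 1 Y) g) \<le> x"
proof -
  define \<alpha> where "\<alpha> = scale_at (cut 1 Y) g"
  have pos: "is_position (cut 1 Y) g" "cball g R \<subseteq> Y" using g by (auto simp: positions_def)
  have \<alpha>: "\<alpha> \<in> I" "\<alpha> > 0" "copy \<alpha> g ` P \<subseteq> cut 1 Y" unfolding \<alpha>_def using scale_at[OF pos(1)] .
  have vb: "vol base_tile > 0" using base_tile by (simp add: tile_def)
  have va: "vol (anchor (cut 1 Y) g) = \<alpha> ^ DIM('a) * vol base_tile"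
    using \<alpha> by (simp add: anchor_def vol_copy flip: \<alpha>_def)
  have ev: "exp (- v) ^ DIM('a) * exp v ^ DIM('a) = 1" by (simp flip: power_mult_distrib exp_add)
  have "cball (exp v *\<^sub>R g) R \<subseteq> copy (exp v) 0 Y"
  proof
    fix z assume z: "z \<in> cball (exp v *\<^sub>R g) R"
    have "dist g (exp (- v) *\<^sub>R z) = exp (- v) * dist (exp v *\<^sub>R g) z"
    proof -
      have "g - exp (- v) *\<^sub>R z = exp (- v) *\<^sub>R (exp v *\<^sub>R g - z)" by (simp add: algebra_simps flip: exp_add)
      then show ?thesis by (simp add: dist_norm)
    qed
    also have "\<dots> \<le> 1 * R" using z v by (intro mult_mono) auto
    finally have "exp (- v) *\<^sub>R z \<in> Y" using pos(2) by auto
    then show "z \<in> copy (exp v) 0 Y" unfolding copy_def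
      by (intro image_eqI[of _ _ "exp (- v) *\<^sub>R z"]) (simp_all flip: exp_add)
  qed
  then have np: "\<not> is_position (cut 1 (copy (exp v) 0 Y)) (exp v *\<^sub>R g)" using g(2) by (simp add: positions_def)
  show ?thesis
  proof (cases "exp v * \<alpha> \<in> I")
    case False
    have \<alpha>_le: "\<alpha> \<le> exp v * \<alpha>" using v \<alpha>(2) by simp
    have "y \<le> exp v * \<alpha>" if y: "y \<in> I" for y
      using mem_is_interval_1_I[OF I(1) \<alpha>(1) y \<alpha>_le] False by linarith
    then have "Sup I \<le> exp v * \<alpha>" using I by (intro cSup_least) auto
    then have "exp (- v) * Sup I \<le> exp (- v) * (exp v * \<alpha>)" by simp
    then have 1: "exp (- v) * Sup I \<le> \<alpha>" by (simp flip: exp_add mult.assoc)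
    have "1 \<le> Sup I" using I by (intro cSup_upper)
    then have "(exp (- v) * Sup I) ^ DIM('a) \<le> \<alpha> ^ DIM('a)" using 1 by (intro power_mono) auto
    moreover have "\<alpha> ^ DIM('a) \<le> Sup I ^ DIM('a)" using \<alpha> I by (intro power_mono cSup_upper) auto
    ultimately show ?thesis
      using vb by (simp add: va power_mult_distrib mult_right_mono flip: mult.assoc)
  next
    case True
    have "\<exists>U\<in>P. vol (copy (exp v) 0 (copy \<alpha> g U)) > 1"
    proof (rule ccontr)
      assume no: "\<not> ?thesis"
      have "copy (exp v * \<alpha>) (exp v *\<^sub>R g) U \<in> cut 1 (copy (exp v) 0 Y)" if U: "U \<in> P" for U
      proof -
        have "copy \<alpha> g U \<in> descendants 1 Y" using \<alpha>(3) U by (auto simp: cut_def)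
        from descendants_copy[OF Y _ this, of "exp v" 0]
        have "copy (exp v) 0 (copy \<alpha> g U) \<in> descendants (exp v ^ DIM('a)) (copy (exp v) 0 Y)" by simp
        then have "copy (exp v) 0 (copy \<alpha> g U) \<in> descendants 1 (copy (exp v) 0 Y)"
          using v by (intro descendants_antimono[of 1 "exp v ^ DIM('a)"] one_le_power) auto
        then have "copy (exp v) 0 (copy \<alpha> g U) \<in> cut 1 (copy (exp v) 0 Y)" using no U by (auto simp: cut_def)
        then show ?thesis by (simp add: copy_copy)
      qed
      then show False using np True \<alpha>(2) by (auto simp: is_position_def)
    qed
    then obtain U where U: "U \<in> P" "exp v ^ DIM('a) * (\<alpha> ^ DIM('a) * vol U) > 1"
      using \<alpha>(2) by (auto simp: vol_copy)
    have vU: "vol U > 0" using P(3)[OF U(1)] by (simp add: tile_def)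
    have "copy \<alpha> g U \<in> cut 1 Y" using \<alpha>(3) U by blast
    then have 1: "\<alpha> ^ DIM('a) * vol U \<le> 1" using vol_cut_le \<alpha>(2) by (metis vol_copy)
    have "exp (- v) ^ DIM('a) * 1 \<le> exp (- v) ^ DIM('a) * (exp v ^ DIM('a) * (\<alpha> ^ DIM('a) * vol U))"
      using U by (intro mult_left_mono) auto
    then have 2: "exp (- v) ^ DIM('a) \<le> \<alpha> ^ DIM('a) * vol U" using ev by (simp flip: mult.assoc)
    have "exp (- v) ^ DIM('a) * (vol base_tile / vol U) \<le> \<alpha> ^ DIM('a) * vol U * (vol base_tile / vol U)"
      "\<alpha> ^ DIM('a) * vol U * (vol base_tile / vol U) \<le> 1 * (vol base_tile / vol U)"
      using 1 2 vb vU by (intro mult_right_mono; simp)+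
    moreover have "\<alpha> ^ DIM('a) * vol U * (vol base_tile / vol U) = vol (anchor (cut 1 Y) g)"
      using vU va by simp
    ultimately show ?thesis using U(1) by (intro bexI[of _ "vol base_tile / vol U"]) auto
  qed
qed

text \<open>By \<open>window_rare\<close> few positions are lost under a slight inflation.  The inequality carries a low
  density from a tile to slightly smaller tiles of the same type.\<close>

lemma density_oscillation:
  assumes e: "e > 0"
  shows "\<exists>\<delta>>0. \<exists>T. \<forall>Y v. scaled Y \<longrightarrow> vol Y \<ge> T \<longrightarrow> 0 \<le> v \<longrightarrow> v < \<delta> \<longrightarrow>
    num_positions Y / vol Y \<le> num_positions (copy (exp v) 0 Y) / vol (copy (exp v) 0 Y) + e"
proof -
  define W where "W = insert (Sup I ^ DIM('a) * vol base_tile) ((\<lambda>U. vol base_tile / vol U) ` P)"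
  have Wfin: "finite W" "card W > 0" using P by (auto simp: W_def card_gt_0_iff)
  have "1 \<le> Sup I" using I by (intro cSup_upper)
  then have Wpos: "x > 0" if "x \<in> W" for x
    using that base_tile P(3) by (auto simp: W_def tile_def)
  define c where "c = e * min_ratio / (2 * real (card W))"
  have c: "c > 0" using e min_ratio_pos Wfin by (simp add: c_def)
  have "\<forall>x\<in>W. \<exists>\<theta>. 0 < \<theta> \<and> \<theta> < 1 \<and> (\<exists>T. \<forall>X. scaled X \<longrightarrow> vol X \<ge> T \<longrightarrow> window_vol \<theta> x X \<le> c * vol X)"
    using window_rare[OF irreducible incommensurable c] Wpos by blast
  from bchoice[OF this] obtain \<theta> where \<theta>: "\<And>x. x \<in> W \<Longrightarrow> 0 < \<theta> x \<and> \<theta> x < 1"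
    and "\<forall>x\<in>W. \<exists>T. \<forall>X. scaled X \<longrightarrow> vol X \<ge> T \<longrightarrow> window_vol (\<theta> x) x X \<le> c * vol X" by blast
  from bchoice[OF this(2)] obtain T where
    T: "\<And>x X. x \<in> W \<Longrightarrow> scaled X \<Longrightarrow> vol X \<ge> T x \<Longrightarrow> window_vol (\<theta> x) x X \<le> c * vol X" by blast
  define T0 where "T0 = Max (insert 1 (T ` W))"
  have T0: "1 \<le> T0" "\<And>x. x \<in> W \<Longrightarrow> T x \<le> T0" unfolding T0_def using Wfin by (auto intro!: Max_ge)
  define \<theta>0 where "\<theta>0 = Max (\<theta> ` W)"
  have "W \<noteq> {}" by (simp add: W_def)
  then have \<theta>0: "\<theta>0 < 1" "\<And>x. x \<in> W \<Longrightarrow> \<theta> x \<le> \<theta>0" "0 < \<theta>0"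
    unfolding \<theta>0_def using Wfin \<theta> by (auto intro!: Max_ge simp: Max_gr_iff)
  \<comment> \<open>A bound for the growth of volume: below the first term, the anchors of lost positions are in
     the windows, and below the second, the change of the denominator costs at most \<open>e / 2\<close>.\<close>
  define u where "u = min (1 / \<theta>0) (1 + e * min_ratio / 2)"
  have u: "u > 1" "\<theta>0 \<le> 1 / u" "u - 1 \<le> e * min_ratio / 2"
  proof -
    show "u > 1" using \<theta>0 e min_ratio_pos by (simp add: u_def)
    moreover have "u \<le> 1 / \<theta>0" by (simp add: u_def)
    ultimately show "\<theta>0 \<le> 1 / u" using \<theta>0 by (simp add: field_simps)
    have "u \<le> 1 + e * min_ratio / 2" unfolding u_def by (rule min.cobounded2)
    then show "u - 1 \<le> e * min_ratio / 2" by simp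
  qed
  define \<delta> where "\<delta> = ln u / DIM('a)"
  have \<delta>: "\<delta> > 0" using u by (simp add: \<delta>_def)
  have eu: "exp \<delta> ^ DIM('a) = u" using u by (simp add: \<delta>_def flip: exp_of_nat_mult)
  show ?thesis
  proof (rule exI[of _ \<delta>], intro conjI \<delta> exI[of _ T0] allI impI)
    fix Y v assume Y: "scaled Y" "T0 \<le> vol Y" and v: "0 \<le> v" "v < \<delta>"
    define Y' where "Y' = copy (exp v) 0 Y"
    have Y1: "vol Y \<ge> 1" using Y T0 by simp
    have q: "1 \<le> exp v ^ DIM('a)" "exp v ^ DIM('a) < u"
    proof -
      show "1 \<le> exp v ^ DIM('a)" using v by (simp add: one_le_power)
      show "exp v ^ DIM('a) < u" unfolding eu[symmetric] using v by (intro power_strict_mono) auto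
    qed
    have "exp (- v) ^ DIM('a) = 1 / exp v ^ DIM('a)" by (simp add: exp_minus inverse_eq_divide power_divide)
    also have "\<dots> > 1 / u" using q u by (intro divide_strict_left_mono) auto
    finally have \<theta>v: "\<theta>0 < exp (- v) ^ DIM('a)" using u(2) by simp
    have sY': "scaled Y'" unfolding Y'_def using Y scaled_copy by simp
    have vY': "vol Y' = exp v ^ DIM('a) * vol Y" by (simp add: Y'_def vol_copy)
    have Y'1: "vol Y' \<ge> 1" unfolding vY' using mult_mono[OF q(1) Y1] by simp
    define bad where "bad = {g \<in> positions Y. exp v *\<^sub>R g \<notin> positions Y'}"
    define good where "good = {g \<in> positions Y. exp v *\<^sub>R g \<in> positions Y'}"
    have finY: "finite (positions Y)" using num_positions_facts(1) Y by blast
    have "card good = card ((*\<^sub>R) (exp v) ` good)" by (subst card_image) (auto simp: inj_on_def)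
    also have "\<dots> \<le> card (positions Y')"
      using num_positions_facts(1)[OF sY'] by (intro card_mono) (auto simp: good_def)
    finally have good: "real (card good) \<le> num_positions Y'" by (simp add: num_positions_def)
    have isp: "is_position (cut 1 Y) g" if "g \<in> bad" for g using that by (simp add: bad_def positions_def)
    have sub: "anchor (cut 1 Y) ` bad \<subseteq> (\<Union>x\<in>W. {V \<in> cut 1 Y. \<theta> x * x < vol V \<and> vol V \<le> x})"
    proof
      fix V assume "V \<in> anchor (cut 1 Y) ` bad"
      then obtain g where g: "g \<in> bad" "V = anchor (cut 1 Y) g" by blast
      obtain x where x: "x \<in> W" "exp (- v) ^ DIM('a) * x \<le> vol V" "vol V \<le> x"
        using lost_position[OF Y(1) v(1), of g] g(1) unfolding bad_def Y'_def W_def g(2) by blast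
      have "\<theta> x * x < exp (- v) ^ DIM('a) * x" using \<theta>0(2)[OF x(1)] \<theta>v Wpos[OF x(1)] by simp
      then show "V \<in> (\<Union>x\<in>W. {V \<in> cut 1 Y. \<theta> x * x < vol V \<and> vol V \<le> x})"
        using x anchor_mem[OF isp[OF g(1)]] g(2) by (intro UN_I[OF x(1)]) simp
    qed
    have finU: "finite (\<Union>x\<in>W. {V \<in> cut 1 Y. \<theta> x * x < vol V \<and> vol V \<le> x})"
      using Wfin finite_cut[of 1 Y] Y by auto
    have "inj_on (anchor (cut 1 Y)) bad"
      using isp inj_on_subset[OF inj_anchor[of "cut 1 Y"], of bad] by blast
    then have "card bad = card (anchor (cut 1 Y) ` bad)" by (simp add: card_image)
    also have "\<dots> \<le> card (\<Union>x\<in>W. {V \<in> cut 1 Y. \<theta> x * x < vol V \<and> vol V \<le> x})"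
      by (rule card_mono[OF finU sub])
    also have "\<dots> \<le> (\<Sum>x\<in>W. card {V \<in> cut 1 Y. \<theta> x * x < vol V \<and> vol V \<le> x})"
      by (rule card_UN_le[OF Wfin(1)])
    finally have "real (card bad) \<le> (\<Sum>x\<in>W. real (card {V \<in> cut 1 Y. \<theta> x * x < vol V \<and> vol V \<le> x}))"
      using of_nat_mono by fastforce
    also have "\<dots> \<le> (\<Sum>x\<in>W. c * vol Y / min_ratio)"
    proof (rule sum_mono)
      fix x assume x: "x \<in> W"
      have "real (card {V \<in> cut 1 Y. \<theta> x * x < vol V \<and> vol V \<le> x}) \<le> window_vol (\<theta> x) x Y / min_ratio"
        by (rule card_window_le[OF Y(1) Y1])
      also have "\<dots> \<le> c * vol Y / min_ratio"
        using T[OF x Y(1)] T0(2)[OF x] Y(2) min_ratio_pos by (intro divide_right_mono) auto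
      finally show "real (card {V \<in> cut 1 Y. \<theta> x * x < vol V \<and> vol V \<le> x}) \<le> c * vol Y / min_ratio" .
    qed
    also have "\<dots> = e / 2 * vol Y" using min_ratio_pos Wfin \<open>W \<noteq> {}\<close> by (simp add: c_def)
    finally have bad: "real (card bad) \<le> e / 2 * vol Y" .
    have "positions Y = good \<union> bad" by (auto simp: good_def bad_def)
    then have "card (positions Y) \<le> card good + card bad" by (metis card_Un_le)
    then have "num_positions Y \<le> num_positions Y' + e / 2 * vol Y"
      using good bad by (simp add: num_positions_def)
    then have "num_positions Y / vol Y \<le> num_positions Y' / vol Y + e / 2"
      using Y1 by (simp add: field_simps)
    also have "num_positions Y' / vol Y = num_positions Y' / vol Y' * exp v ^ DIM('a)"
      using Y1 by (simp add: vY')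
    also have "\<dots> = num_positions Y' / vol Y' + num_positions Y' / vol Y' * (exp v ^ DIM('a) - 1)"
      unfolding right_diff_distrib by simp
    also have "num_positions Y' / vol Y' * (exp v ^ DIM('a) - 1) \<le> 1 / min_ratio * (e * min_ratio / 2)"
    proof (rule mult_mono)
      show "num_positions Y' / vol Y' \<le> 1 / min_ratio"
        using num_positions_facts(2)[OF sY' Y'1] Y'1 min_ratio_pos by (simp add: field_simps)
    qed (use q u min_ratio_pos in auto)
    also have "\<dots> = e / 2" using min_ratio_pos by simp
    finally show "num_positions Y / vol Y \<le> num_positions (copy (exp v) 0 Y) / vol (copy (exp v) 0 Y) + e"
      by (simp add: Y'_def)
  qed
qed

end

section \<open>The density of positions in large tiles\<close>

context patch_in_scheme
begin

text \<open>Near a minimum of the density all types and, by eventual density of the path lengths and slow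
  variation, all sizes in a fixed window have density close to the lower limit.\<close>

lemma window_of_low_density:
  assumes i: "i \<in> types \<sigma>" and m: "liminf_density num_positions m" and e: "e > 0"
  obtains l where "l \<ge> T" "l \<ge> 1"
    "\<And>V. scaled V \<Longrightarrow> min_ratio * l \<le> vol V \<Longrightarrow> vol V \<le> l \<Longrightarrow> num_positions V \<le> (m + 2 * e) * vol V"
proof -
  obtain \<delta> T1 where \<delta>: "\<delta> > 0" and osc: "\<And>Y v. scaled Y \<Longrightarrow> vol Y \<ge> T1 \<Longrightarrow> 0 \<le> v \<Longrightarrow> v < \<delta> \<Longrightarrow>
    num_positions Y / vol Y \<le> num_positions (copy (exp v) 0 Y) / vol (copy (exp v) 0 Y) + e"
    using density_oscillation[OF e] by blast
  have "\<delta> / 2 > 0" using \<delta> by simp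
  from lengths_eventually_dense[OF irreducible incommensurable this] obtain K0 where
    K0: "\<And>i k x. i \<in> types \<sigma> \<Longrightarrow> k \<in> types \<sigma> \<Longrightarrow> x \<ge> K0 \<Longrightarrow> \<exists>l\<in>lengths i k. x \<le> l \<and> l < x + \<delta> / 2"
    by blast
  \<comment> \<open>Descendants whose linear size is smaller than that of \<open>X\<close> by a factor \<open>exp K1\<close> or more have nearly
     dense sizes; \<open>l\<close> is the largest of their volumes.\<close>
  define K1 where "K1 = max K0 0 + \<delta> / 2"
  define q where "q = exp K1 ^ DIM('a)"
  have q: "q > 0" by (simp add: q_def)
  obtain \<alpha> g where X: "\<alpha> > 0" "vol (copy \<alpha> g (proto \<sigma> i)) \<ge> q * max 1 (max T (T1 / min_ratio))"
    "\<And>Y. Y \<in> descendants 0 (copy \<alpha> g (proto \<sigma> i)) \<Longrightarrow> vol (copy \<alpha> g (proto \<sigma> i)) \<le> (q / min_ratio) * vol Y \<Longrightarrow>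
       num_positions Y \<le> (m + e) * vol Y"
    using minimum_principle[OF irreducible superadditive_num_positions m i divide_pos_pos[OF q min_ratio_pos] e] by blast
  define X where "X = copy \<alpha> g (proto \<sigma> i)"
  have volX: "vol X = \<alpha> ^ DIM('a)" using X(1) i by (simp add: X_def vol_copy_proto)
  define l where "l = vol X / q"
  have l: "max 1 (max T (T1 / min_ratio)) \<le> l"
    unfolding l_def by (subst pos_le_divide_eq[OF q]) (use X(2) in \<open>simp only: mult.commute X_def\<close>)
  show thesis
  proof (rule that[of l])
    show "T \<le> l" "1 \<le> l" using l by auto
    fix V assume V: "scaled V" "min_ratio * l \<le> vol V" "vol V \<le> l"
    obtain k \<beta> h where k: "k \<in> types \<sigma>" "\<beta> > 0" "V = copy \<beta> h (proto \<sigma> k)" using V(1) by (rule scaledE)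
    have volV: "vol V = \<beta> ^ DIM('a)" using k by (simp add: vol_copy_proto)
    have "\<beta> ^ DIM('a) * exp K1 ^ DIM('a) \<le> \<alpha> ^ DIM('a)"
      using V(3) q by (simp add: volV l_def volX pos_le_divide_eq flip: q_def)
    then have "\<beta> * exp K1 \<le> \<alpha>"
      using power_strict_mono[of \<alpha> "\<beta> * exp K1" "DIM('a)"] X(1) by (fastforce simp: power_mult_distrib)
    then have "ln (\<beta> * exp K1) \<le> ln \<alpha>" using k(2) X(1) by simp
    then have "ln \<beta> + K1 \<le> ln \<alpha>" using k(2) by (simp add: ln_mult)
    then have "ln \<alpha> - ln \<beta> - \<delta> / 2 \<ge> K0" by (simp add: K1_def)
    then obtain p where p: "p \<in> lengths i k" "ln \<alpha> - ln \<beta> - \<delta> / 2 \<le> p" "p < ln \<alpha> - ln \<beta>"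
      using K0[OF i k(1)] by fastforce
    \<comment> \<open>The descendant \<open>Z\<close> of \<open>X\<close> has the type of \<open>V\<close> and is slightly larger.\<close>
    define v where "v = ln \<alpha> - ln \<beta> - p"
    have v: "0 \<le> v" "v < \<delta>" using p \<delta> by (simp_all add: v_def)
    obtain t where t: "copy (\<alpha> * exp (- p)) t (proto \<sigma> k) \<in> descendants 0 X"
      using lengthsE[OF p(1) i X(1)] unfolding X_def by blast
    define Z where "Z = copy (\<alpha> * exp (- p)) t (proto \<sigma> k)"
    have sZ: "scaled Z" unfolding Z_def using k X(1) by (intro scaled_copy_proto) auto
    have scale: "\<alpha> * exp (- p) = exp v * \<beta>"
      using k(2) X(1) by (simp add: v_def exp_diff exp_minus exp_add field_simps)
    have eqZ: "copy (exp v) 0 V = copy 1 (exp v *\<^sub>R h - t) Z"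
      by (simp add: k(3) Z_def copy_copy scale)
    have volZ: "vol Z = exp v ^ DIM('a) * vol V"
      using X(1) k by (simp add: Z_def vol_copy_proto scale power_mult_distrib)
    have "1 * vol V \<le> exp v ^ DIM('a) * vol V" using v by (intro mult_right_mono one_le_power) auto
    then have "min_ratio * l \<le> vol Z" using V(2) volZ by simp
    then have "vol X \<le> q / min_ratio * vol Z" using q min_ratio_pos by (simp add: l_def field_simps)
    then have "num_positions Z \<le> (m + e) * vol Z" using X(3)[folded X_def] t Z_def by blast
    then have dZ: "num_positions Z / vol Z \<le> m + e" using scaled_vol_pos[OF sZ] by (simp add: pos_divide_le_eq)
    have "T1 / min_ratio \<le> l" using l by simp
    then have "T1 \<le> vol V" using V(2) min_ratio_pos by (simp add: field_simps)
    then have "num_positions V / vol V \<le> num_positions Z / vol Z + e"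
      using osc[OF V(1) _ v] by (simp add: eqZ num_positions_translate[OF sZ] vol_copy)
    then have "num_positions V / vol V \<le> m + 2 * e" using dZ by simp
    then show "num_positions V \<le> (m + 2 * e) * vol V" using scaled_vol_pos[OF V(1)] by (simp add: pos_divide_le_eq)
  qed
qed

text \<open>A large tile is a union of tiles \<open>V\<close> with volumes between \<open>min_ratio * l\<close> and \<open>l\<close>, all of low
  density, and the positions near their boundaries are few.  This bounds its density from above; the
  bound from below is the definition of \<open>m\<close>.\<close>

lemma density_limit:
  assumes i: "i \<in> types \<sigma>" and m: "liminf_density num_positions m" and e: "e > 0"
  shows "\<exists>T. \<forall>X. scaled X \<longrightarrow> vol X \<ge> T \<longrightarrow>
    (m - e) * vol X \<le> num_positions X \<and> num_positions X \<le> (m + e) * vol X"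
proof -
  have e3: "e / 3 > 0" "e / 3 * min_ratio > 0" using e min_ratio_pos by auto
  obtain T1 where T1: "\<And>X. scaled X \<Longrightarrow> vol X \<ge> T1 \<Longrightarrow> (m - e) * vol X \<le> num_positions X"
    using m e unfolding liminf_density_def by blast
  obtain T2 where T2: "\<And>V. scaled V \<Longrightarrow> vol V \<ge> T2 \<Longrightarrow>
      vol (thicken (frontier V) (2 * R)) \<le> e / 3 * min_ratio * vol V"
    using boundary_rare[of "2 * R", OF _ e3(2)] R(1) by auto
  obtain l where l: "l \<ge> T2 / min_ratio" "l \<ge> 1" and
    low: "\<And>V. scaled V \<Longrightarrow> min_ratio * l \<le> vol V \<Longrightarrow> vol V \<le> l \<Longrightarrow> num_positions V \<le> (m + 2 * (e / 3)) * vol V"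
    using window_of_low_density[OF i m e3(1)] by blast
  have upper: "num_positions X \<le> (m + e) * vol X" if X: "scaled X" "vol X \<ge> l" for X
  proof -
    have l0: "l > 0" using l by simp
    have w: "scaled V" "min_ratio * l \<le> vol V" "vol V \<le> l" if V: "V \<in> cut l X" for V
      using vol_cut_ge[OF l0 X V] vol_cut_le[OF V] scaled_cut[OF X(1) V] by auto
    have X1: "vol X \<ge> 1" using X l by simp
    have "real (card (positions X)) \<le>
        (\<Sum>V\<in>cut l X. num_positions V + vol (thicken (frontier V) (2 * R)) / min_ratio)"
    proof (rule positions_in_union[THEN conjunct2])
      show "packing (cut 1 X)" using packing_cut X by simp
      show "min_ratio \<le> vol V" if "V \<in> cut 1 X" for V using vol_cut_ge[of 1 X V] X(1) X1 that by simp
      show "cut 1 V \<subseteq> cut 1 X" if "V \<in> cut l X" for V using cut_cut[OF l(2) X(1)] that by blast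
      show "positions X \<subseteq> \<Union>(cut l X)"
        using position_interior interior_subset Union_cut[OF l0 X(1)] by blast
    qed (use finite_cut[OF l0 X(1)] w in \<open>auto simp: positions_def\<close>)
    also have "\<dots> \<le> (\<Sum>V\<in>cut l X. (m + e) * vol V)"
    proof (rule sum_mono)
      fix V assume V: "V \<in> cut l X"
      have "T2 \<le> min_ratio * l" using l(1) min_ratio_pos by (simp add: field_simps)
      then have "vol (thicken (frontier V) (2 * R)) / min_ratio \<le> e / 3 * min_ratio * vol V / min_ratio"
        using T2[of V] w[OF V] min_ratio_pos by (intro divide_right_mono) auto
      also have "\<dots> = e / 3 * vol V" using min_ratio_pos by simp
      finally show "num_positions V + vol (thicken (frontier V) (2 * R)) / min_ratio \<le> (m + e) * vol V"
        using low[OF w[OF V]] by (simp add: algebra_simps)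
    qed
    also have "\<dots> = (m + e) * vol X" using vol_cut[OF l0 X(1)] by (simp flip: sum_distrib_left)
    finally show ?thesis by (simp add: num_positions_def)
  qed
  show ?thesis using T1 upper by (intro exI[of _ "max T1 l"]) auto
qed

lemma num_positions_liminf: 
  assumes i: "i \<in> types \<sigma>" shows "\<exists>m. liminf_density num_positions m"
proof (rule liminf_density_exists[OF i])
  show "0 * vol X \<le> num_positions X" for X by (simp add: num_positions_def)
  show "num_positions X \<le> 1 / min_ratio * vol X" if "scaled X" "vol X \<ge> 1" for X
    using num_positions_facts(2)[OF that] by simp
qed

text \<open>A large tile is a union of tiles of volume at most \<open>l\<close>, each containing a position, so its
  density is at least \<open>1 / l\<close>.\<close>

lemma liminf_positive:
  assumes m: "liminf_density num_positions m"
    and pos: "\<And>X. scaled X \<Longrightarrow> vol X \<ge> T \<Longrightarrow> num_positions X \<ge> 1"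
  shows "m > 0"
proof -
  define l where "l = max 1 (T / min_ratio)"
  have l: "l \<ge> 1" "l > 0" "T \<le> min_ratio * l"
    using min_ratio_pos by (auto simp: l_def field_simps max_def)
  obtain X where X: "scaled X" "vol X \<ge> l" "num_positions X \<le> (m + 1 / (2 * l)) * vol X"
    using m l unfolding liminf_density_def by (metis zero_less_divide_1_iff zero_less_mult_iff zero_less_numeral)
  have "vol X = (\<Sum>V\<in>cut l X. vol V)" using vol_cut[OF l(2) X(1)] by simp
  also have "\<dots> \<le> (\<Sum>V\<in>cut l X. l * num_positions V)"
  proof (rule sum_mono)
    fix V assume V: "V \<in> cut l X"
    have "num_positions V \<ge> 1" using vol_cut_ge[OF l(2) X(1,2) V] l(3) scaled_cut[OF X(1) V] pos by simp
    then have "l * 1 \<le> l * num_positions V" using l by (intro mult_left_mono) auto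
    then show "vol V \<le> l * num_positions V" using vol_cut_le[OF V] by simp
  qed
  also have "\<dots> \<le> l * num_positions X"
    using superadditive_cut[OF superadditive_num_positions l(1) X(1)] l by (simp flip: sum_distrib_left)
  also have "\<dots> \<le> l * ((m + 1 / (2 * l)) * vol X)" using X(3) l by simp
  finally have "1 * vol X \<le> (l * (m + 1 / (2 * l))) * vol X" by (simp only: mult_1 mult.assoc)
  then have "1 \<le> l * (m + 1 / (2 * l))" using scaled_vol_pos[OF X(1)] by (simp only: mult_le_cancel_right_pos)
  then have "l * m > 0" using l by (simp add: distrib_left)
  then show ?thesis using l by (simp add: zero_less_mult_iff)
qed

text \<open>A copy of \<open>P\<close> of scale 1 persists when the tile around it is shrunk slightly, because the
  parents of its tiles have volume strictly greater than 1; its new scale is slightly less than 1 and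
  lies in \<open>I\<close>.  Every large tile has such a shrunken tile as a descendant, by eventual density
  of the path lengths.  The radius \<open>2 R\<close> and the bound \<open>\<alpha> \<ge> 2\<close> leave room for shrinking by a factor up to 2.\<close>

lemma large_tiles_have_positions:
  assumes i: "i \<in> types \<sigma>" and \<alpha>: "\<alpha> \<ge> 2"
    and g: "cball g (2 * R) \<subseteq> copy \<alpha> h (proto \<sigma> i)" "copy 1 g ` P \<subseteq> cut 1 (copy \<alpha> h (proto \<sigma> i))"
    and e: "\<epsilon> > 0" "{1 - \<epsilon><..<1} \<subseteq> I"
  shows "\<exists>T. \<forall>X. scaled X \<longrightarrow> vol X \<ge> T \<longrightarrow> num_positions X \<ge> 1"
proof -
  define Z where "Z = copy \<alpha> h (proto \<sigma> i)"
  have sZ: "scaled Z" unfolding Z_def using i \<alpha> by (intro scaled_copy_proto) auto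
  have "\<exists>\<mu>>1. V \<in> descendants \<mu> Z" if "V \<in> descendants 1 Z" for V
    using that
  proof induction
    case self then show ?case by (intro exI[of _ 2]) (auto intro: descendants.self)
  next
    case (child V W)
    then obtain \<mu> where \<mu>: "\<mu> > 1" "V \<in> descendants \<mu> Z" by blast
    \<comment> \<open>Some threshold strictly between 1 and the volume of the parent.\<close>
    define \<nu> where "\<nu> = min \<mu> ((1 + vol V) / 2)"
    have "\<nu> > 1" using \<mu>(1) child.hyps by (simp add: \<nu>_def)
    moreover have "\<nu> \<le> (1 + vol V) / 2" "\<nu> \<le> \<mu>"
      unfolding \<nu>_def by (rule min.cobounded2 min.cobounded1)+
    then have "\<nu> < vol V" "V \<in> descendants \<nu> Z"
      using child.hyps descendants_antimono[OF _ \<mu>(2)] by auto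
    ultimately show ?case using child.hyps descendants.child by blast
  qed
  then have "\<forall>U\<in>P. \<exists>\<mu>>1. copy 1 g U \<in> descendants \<mu> Z" using g(2) by (auto simp: cut_def Z_def)
  then have "\<forall>U\<in>P. \<exists>\<mu>. \<mu> > 1 \<and> copy 1 g U \<in> descendants \<mu> Z" by blast
  from bchoice[OF this] obtain \<mu> where \<mu>: "\<And>U. U \<in> P \<Longrightarrow> \<mu> U > 1 \<and> copy 1 g U \<in> descendants (\<mu> U) Z" by blast
  define \<mu>0 where "\<mu>0 = Min (\<mu> ` P)"
  have "\<mu>0 > 1" using P \<mu> by (simp add: \<mu>0_def Min_gr_iff)
  have desc: "copy 1 g U \<in> descendants \<mu>0 Z" if "U \<in> P" for U
    using \<mu>[OF that] P that by (intro descendants_antimono[of \<mu>0 "\<mu> U"]) (auto simp: \<mu>0_def)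
  \<comment> \<open>Shrinking by \<open>exp v\<close>, \<open>v < \<delta>\<close>, is by a factor less than 2, leaves the parents of the tiles in the
     copy larger than volume 1, and the scale in \<open>I\<close>.\<close>
  define \<delta> where "\<delta> = min (min (ln 2) (ln \<mu>0 / DIM('a))) (if \<epsilon> < 1 then - ln (1 - \<epsilon>) else 1)"
  have \<delta>: "\<delta> > 0" using \<open>\<mu>0 > 1\<close> e(1) by (auto simp: \<delta>_def)
  have shrunk: "num_positions (copy (exp (- v)) t Z) \<ge> 1" if v: "0 < v" "v < \<delta>" for v t
  proof -
    define c where "c = exp (- v)"
    have c: "0 < c" "c < 1" using v by (simp_all add: c_def)
    have "v < ln 2" using v by (simp add: \<delta>_def)
    then have "exp (- ln 2) < c" by (simp add: c_def)
    then have c2: "1 / 2 < c" by (simp add: exp_minus)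
    have "1 - \<epsilon> < c"
    proof (cases "\<epsilon> < 1")
      case True
      then have "ln (1 - \<epsilon>) < - v" using v by (simp add: \<delta>_def)
      then have "exp (ln (1 - \<epsilon>)) < c" by (simp only: c_def exp_less_cancel_iff)
      then show ?thesis using True by simp
    qed (use c in auto)
    then have cI: "c \<in> I" using e(2) c by auto
    have "v * DIM('a) < ln \<mu>0" using v by (simp add: \<delta>_def pos_less_divide_eq)
    then have "exp (v * DIM('a)) < exp (ln \<mu>0)" by (simp only: exp_less_cancel_iff)
    then have "exp v ^ DIM('a) < \<mu>0" using \<open>\<mu>0 > 1\<close> by (simp add: mult.commute flip: exp_of_nat_mult)
    then have "c ^ DIM('a) * exp v ^ DIM('a) \<le> c ^ DIM('a) * \<mu>0" using c by simp
    then have c\<mu>: "1 \<le> c ^ DIM('a) * \<mu>0" by (simp add: c_def flip: power_mult_distrib exp_add)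
    have "copy c (t + c *\<^sub>R g) U \<in> cut 1 (copy c t Z)" if U: "U \<in> P" for U
    proof -
      have "copy c t (copy 1 g U) \<in> descendants 1 (copy c t Z)"
        using descendants_copy[OF sZ c(1) desc[OF U]] descendants_antimono[OF c\<mu>] by blast
      moreover have "copy 1 g U \<in> cut 1 Z" using g(2) U by (auto simp: Z_def)
      then have "c ^ DIM('a) * vol (copy 1 g U) \<le> 1 * 1"
        using vol_cut_le c by (intro mult_mono power_le_one) auto
      ultimately show ?thesis using c by (simp add: cut_def vol_copy copy_copy)
    qed
    moreover have "cball (t + c *\<^sub>R g) R \<subseteq> copy c t Z"
    proof
      fix z assume z: "z \<in> cball (t + c *\<^sub>R g) R"
      have "g - (1 / c) *\<^sub>R (z - t) = (1 / c) *\<^sub>R (t + c *\<^sub>R g - z)" using c by (simp add: algebra_simps)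
      then have "dist g ((1 / c) *\<^sub>R (z - t)) = 1 / c * dist (t + c *\<^sub>R g) z" using c by (simp add: dist_norm)
      also have "\<dots> \<le> 2 * R" using z c c2 by (intro mult_mono) (auto simp: field_simps)
      finally have "(1 / c) *\<^sub>R (z - t) \<in> Z" using g(1) unfolding Z_def by (auto simp: subset_iff)
      then show "z \<in> copy c t Z" unfolding copy_def
        using c by (intro image_eqI[of _ _ "(1 / c) *\<^sub>R (z - t)"]) auto
    qed
    ultimately have "t + c *\<^sub>R g \<in> positions (copy c t Z)"
      using cI c by (auto simp: positions_def is_position_def)
    then have "card (positions (copy c t Z)) > 0"
      using num_positions_facts(1)[OF scaled_copy[OF sZ c(1)]] by (auto simp: card_gt_0_iff)
    then show ?thesis by (simp add: num_positions_def c_def)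
  qed
  have "\<delta> / 2 > 0" using \<delta> by simp
  from lengths_eventually_dense[OF irreducible incommensurable this] obtain K where
    K: "\<And>i k x. i \<in> types \<sigma> \<Longrightarrow> k \<in> types \<sigma> \<Longrightarrow> x \<ge> K \<Longrightarrow> \<exists>l\<in>lengths i k. x \<le> l \<and> l < x + \<delta> / 2"
    by blast
  show ?thesis
  proof (intro exI[of _ "exp (K + ln \<alpha>) ^ DIM('a)"] allI impI)
    fix X assume X: "scaled X" "exp (K + ln \<alpha>) ^ DIM('a) \<le> vol X"
    obtain j \<beta> s where j: "j \<in> types \<sigma>" "\<beta> > 0" "X = copy \<beta> s (proto \<sigma> j)" using X(1) by (rule scaledE)
    have "exp (K + ln \<alpha>) \<le> \<beta>"
      using X(2) j power_strict_mono[of \<beta> "exp (K + ln \<alpha>)" "DIM('a)"] by (fastforce simp: vol_copy_proto)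
    then have "ln (exp (K + ln \<alpha>)) \<le> ln \<beta>" using j(2) by (subst ln_le_cancel_iff) auto
    then have "K \<le> ln \<beta> - ln \<alpha> + \<delta> / 4" using \<delta> by simp
    then obtain p where p: "p \<in> lengths j i" "ln \<beta> - ln \<alpha> + \<delta> / 4 \<le> p" "p < ln \<beta> - ln \<alpha> + \<delta> / 4 + \<delta> / 2"
      using K[OF j(1) i] by blast
    define v where "v = p - (ln \<beta> - ln \<alpha>)"
    have v: "0 < v" "v < \<delta>" using p \<delta> by (simp_all add: v_def)
    obtain t where t: "copy (\<beta> * exp (- p)) t (proto \<sigma> i) \<in> descendants 0 X"
      using lengthsE[OF p(1) j(1,2)] unfolding j(3) by blast
    have scale: "\<beta> * exp (- p) = exp (- v) * \<alpha>"
      using j(2) \<alpha> by (simp add: v_def exp_diff exp_minus exp_add field_simps)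
    define Y where "Y = copy (\<beta> * exp (- p)) t (proto \<sigma> i)"
    have eqY: "Y = copy (exp (- v)) (t - exp (- v) *\<^sub>R h) Z"
      by (simp add: Y_def Z_def copy_copy scale)
    have "v < ln 2" using v by (simp add: \<delta>_def)
    then have "exp (- ln 2) < exp (- v)" by simp
    then have "1 / 2 < exp (- v)" by (simp add: exp_minus)
    then have "1 / 2 * 2 \<le> exp (- v) * \<alpha>" using \<alpha> by (intro mult_mono) auto
    then have "vol Y \<ge> 1" using i by (simp add: Y_def scale vol_copy_proto one_le_power)
    then have "Y \<in> descendants 1 X" using descendants_large_volume[OF X(1)] t Y_def by blast
    then have "num_positions Y \<le> num_positions X" using num_positions_mono X(1) by blast
    then show "1 \<le> num_positions X" using shrunk[OF v, of "t - exp (- v) *\<^sub>R h"] eqY by simp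
  qed
qed

end

section \<open>Counting in a large region\<close>

lemma segment_crosses_frontier:
  assumes "z \<in> B" "y \<notin> (B::'a::euclidean_space set)"
  shows "y \<in> thicken (frontier B) (dist y z)" "z \<in> thicken (frontier B) (dist y z)"
proof -
  have "closed_segment y z \<inter> frontier B \<noteq> {}"
    using assms by (intro connected_Int_frontier) auto
  then obtain w where "w \<in> closed_segment y z" "w \<in> frontier B" by blast
  then show "y \<in> thicken (frontier B) (dist y z)" "z \<in> thicken (frontier B) (dist y z)"
    using dist_in_closed_segment[of w y z] by (auto intro!: thicken_point simp: dist_commute)
qed

lemma (in normalized_scheme) scaled_diameter:
  "\<exists>\<rho>\<ge>0. \<forall>V. scaled V \<longrightarrow> vol V \<le> l \<longrightarrow> (\<forall>x\<in>V. \<forall>y\<in>V. dist x y \<le> \<rho>)"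
proof -
  define D where "D = (\<Sum>j\<in>types \<sigma>. diameter (proto \<sigma> j))"
  have bdd: "bounded (proto \<sigma> j)" if "j \<in> types \<sigma>" for j using tile_proto[OF that] by (simp add: tile_def)
  have D: "diameter (proto \<sigma> j) \<le> D" if "j \<in> types \<sigma>" for j
    unfolding D_def using that bdd by (intro member_le_sum diameter_ge_0) auto
  have D0: "D \<ge> 0" unfolding D_def using bdd by (intro sum_nonneg diameter_ge_0) auto
  show ?thesis
  proof (intro exI[of _ "max 1 l * D"] conjI allI impI ballI)
    show "0 \<le> max 1 l * D" using D0 by simp
    fix V x y assume V: "scaled V" "vol V \<le> l" and xy: "x \<in> V" "y \<in> V"
    obtain j \<beta> g where j: "j \<in> types \<sigma>" "\<beta> > 0" "V = copy \<beta> g (proto \<sigma> j)" using V(1) by (rule scaledE)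
    have "\<beta> \<le> max 1 l"
    proof (cases "\<beta> \<ge> 1")
      case True
      then have "\<beta> ^ 1 \<le> \<beta> ^ DIM('a)" using DIM_positive[where 'a='a] by (intro power_increasing) auto
      then show ?thesis using V(2) j by (simp add: vol_copy_proto)
    qed auto
    obtain x' y' where x': "x' \<in> proto \<sigma> j" "y' \<in> proto \<sigma> j" "x = g + \<beta> *\<^sub>R x'" "y = g + \<beta> *\<^sub>R y'"
      using xy j by (auto simp: copy_def)
    have "dist x y = \<beta> * dist x' y'"
      using j(2) by (simp add: x' dist_norm flip: scaleR_diff_right)
    also have "\<dots> \<le> max 1 l * D"
      using diameter_bounded_bound[OF bdd[OF j(1)] x'(1,2)] D[OF j(1)] j(2) D0 \<open>\<beta> \<le> max 1 l\<close>
      by (intro mult_mono) auto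
    finally show "dist x y \<le> max 1 l * D" .
  qed
qed

context patch_in_scheme
begin

text \<open>The tiles of \<open>cut l (X k)\<close> contained in \<open>B\<close> cover \<open>B\<close> up to points near the boundary, and the
  positions in them are counted in \<open>B\<close>.  Conversely, the tiles that contain a position counted in
  \<open>B\<close> cover little more than \<open>B\<close>.\<close>

lemma count_copies_estimate:
  assumes S: "packing S" "S = (\<Union>k. cut 1 (X k))"
    and X: "\<And>k::nat. scaled (X k)" "\<And>k. vol (X k) \<ge> 1"
    and exhaust: "\<And>b L. \<exists>k. cball 0 b \<subseteq> X k \<and> vol (X k) \<ge> L"
    and i: "i \<in> types \<sigma>" and m: "liminf_density num_positions m" "m \<ge> 0" and e: "e > 0"
  shows "\<exists>r>0. \<forall>B. bounded B \<longrightarrow> B \<in> sets lebesgue \<longrightarrow>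
    \<bar>real (count_copies P I B S) - m * vol B\<bar> \<le> e * vol B + (m + e) * vol (thicken (frontier B) r)"
proof -
  have e2: "e / 2 > 0" "e / 2 * min_ratio > 0" using e min_ratio_pos by auto
  obtain T1 where T1: "\<And>V. scaled V \<Longrightarrow> vol V \<ge> T1 \<Longrightarrow> (m - e / 2) * vol V \<le> num_positions V"
      "\<And>V. scaled V \<Longrightarrow> vol V \<ge> T1 \<Longrightarrow> num_positions V \<le> (m + e / 2) * vol V"
    using density_limit[OF i m(1) e2(1)] by blast
  obtain T2 where T2: "\<And>V. scaled V \<Longrightarrow> vol V \<ge> T2 \<Longrightarrow>
      vol (thicken (frontier V) (2 * R)) \<le> e / 2 * min_ratio * vol V"
    using boundary_rare[of "2 * R", OF _ e2(2)] R(1) by auto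
  define l where "l = max 1 (max T1 T2 / min_ratio)"
  have l: "l \<ge> 1" "l > 0" "T1 \<le> min_ratio * l" "T2 \<le> min_ratio * l"
  proof -
    have "max T1 T2 / min_ratio \<le> l" by (simp add: l_def)
    then have "max T1 T2 \<le> min_ratio * l" using min_ratio_pos by (simp only: pos_divide_le_eq mult.commute)
    then show "T1 \<le> min_ratio * l" "T2 \<le> min_ratio * l" by simp_all
  qed (simp_all add: l_def)
  obtain \<rho> where \<rho>: "\<rho> \<ge> 0" "\<And>V x y. scaled V \<Longrightarrow> vol V \<le> l \<Longrightarrow> x \<in> V \<Longrightarrow> y \<in> V \<Longrightarrow> dist x y \<le> \<rho>"
    using scaled_diameter[of l] by blast
  have Svol: "min_ratio \<le> vol V" if "V \<in> S" for V
    using that vol_cut_ge[OF _ X(1) X(2)] unfolding S(2) by fastforce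
  \<comment> \<open>A position is within \<open>R\<close> of its copy in \<open>B\<close>, and the tile around it has diameter at most \<open>\<rho>\<close>.\<close>
  define r where "r = R + \<rho>"
  have r: "r > 0" using R(1) \<rho>(1) by (simp add: r_def)
  show ?thesis
  proof (intro exI[of _ r] conjI r allI impI)
    fix B :: "'a set" assume B: "bounded B" "B \<in> sets lebesgue"
    define N where "N = thicken (frontier B) r"
    have Bm: "B \<in> lmeasurable" "N \<in> lmeasurable"
      using B by (auto simp: N_def bounded_set_imp_lmeasurable lmeasurable_thicken bounded_frontier)
    obtain b where b: "\<And>x. x \<in> B \<Longrightarrow> norm x \<le> b" using B(1) by (auto simp: bounded_iff)
    obtain k where k: "cball 0 (b + R) \<subseteq> X k" "vol (X k) \<ge> l" using exhaust by blast
    define D where "D = cut l (X k)"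
    have D: "finite D" "packing D" "\<Union>D = X k"
      using l(2) X(1) by (simp_all add: D_def finite_cut packing_cut Union_cut)
    have V: "scaled V" "vol V \<le> l" "T1 \<le> vol V" "T2 \<le> vol V" if "V \<in> D" for V
      using that scaled_cut[OF X(1)] vol_cut_le vol_cut_ge[OF l(2) X(1) k(2)] l(3,4)
      unfolding D_def by (blast, blast, force, force)
    have cutS: "cut 1 V \<subseteq> S" if "V \<in> D" for V
      using that cut_cut[OF l(1) X(1)] unfolding S(2) D_def by blast
    have sub: "finite D'" "vol (\<Union>D') = (\<Sum>V\<in>D'. vol V)" "\<Union>D' \<in> lmeasurable" if "D' \<subseteq> D" for D'
    proof -
      show "finite D'" using that D(1) finite_subset by blast
      then show "vol (\<Union>D') = (\<Sum>V\<in>D'. vol V)" using vol_packing packing_subset[OF D(2) that] by blast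
      show "\<Union>D' \<in> lmeasurable"
        using \<open>finite D'\<close> that V(1) scaled_tile tile_lmeasurable by (intro fmeasurable.finite_Union) blast+
    qed
    define E where "E = {g. \<exists>\<alpha>\<in>I. \<alpha> > 0 \<and> copy \<alpha> g ` P \<subseteq> S \<and> copy \<alpha> g (\<Union>P) \<subseteq> B}"
    have Epos: "is_position S g" if "g \<in> E" for g using that by (auto simp: E_def is_position_def)
    have Enear: "\<exists>z\<in>B. dist g z \<le> R" if "g \<in> E" for g
    proof -
      obtain \<alpha> where \<alpha>: "\<alpha> \<in> I" "\<alpha> > 0" "copy \<alpha> g (\<Union>P) \<subseteq> B" using \<open>g \<in> E\<close> by (auto simp: E_def)
      obtain x where "x \<in> base_tile" using tile_nonempty[OF base_tile(2)] by blast
      then have "g + \<alpha> *\<^sub>R x \<in> copy \<alpha> g base_tile" by (auto simp: copy_def)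
      then have "g + \<alpha> *\<^sub>R x \<in> B" "g + \<alpha> *\<^sub>R x \<in> cball g R"
        using \<alpha>(3) base_tile(1) copy_patch_subset[OF \<alpha>(1,2) base_tile(1), of g] copy_mono[of base_tile "\<Union>P" \<alpha> g] by blast+
      then show ?thesis by auto
    qed
    define D2 where "D2 = {V \<in> D. V \<inter> E \<noteq> {}}"
    have "E \<subseteq> \<Union>D2"
    proof
      fix g assume g: "g \<in> E"
      then obtain z where z: "z \<in> B" "dist g z \<le> R" using Enear by blast
      have "norm g \<le> b + R" using b[OF z(1)] z(2) norm_triangle_sub[of g z] by (simp add: dist_norm)
      then have "g \<in> \<Union>D" using k(1) D(3) by auto
      then show "g \<in> \<Union>D2" using g by (auto simp: D2_def)
    qed
    then have upper: "finite E \<and> real (card E) \<le>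
        (\<Sum>V\<in>D2. num_positions V + vol (thicken (frontier V) (2 * R)) / min_ratio)"
      using D(1) V(1) cutS Epos by (intro positions_in_union[OF S(1) Svol]) (auto simp: D2_def)
    have "(\<Sum>V\<in>D2. num_positions V + vol (thicken (frontier V) (2 * R)) / min_ratio) \<le> (\<Sum>V\<in>D2. (m + e) * vol V)"
    proof (rule sum_mono)
      fix V assume "V \<in> D2"
      then have VD: "V \<in> D" by (simp add: D2_def)
      have "vol (thicken (frontier V) (2 * R)) / min_ratio \<le> e / 2 * min_ratio * vol V / min_ratio"
        using T2[OF V(1)[OF VD] V(4)[OF VD]] min_ratio_pos by (intro divide_right_mono) auto
      also have "\<dots> = e / 2 * vol V" using min_ratio_pos by simp
      finally show "num_positions V + vol (thicken (frontier V) (2 * R)) / min_ratio \<le> (m + e) * vol V"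
        using T1(2)[OF V(1)[OF VD] V(3)[OF VD]] by (simp add: algebra_simps)
    qed
    also have "\<dots> = (m + e) * vol (\<Union>D2)" using sub[of D2] by (simp add: D2_def sum_distrib_left)
    also have "vol (\<Union>D2) \<le> vol (B \<union> N)"
    proof (rule measure_mono_fmeasurable)
      show "\<Union>D2 \<subseteq> B \<union> N"
      proof
        fix y assume "y \<in> \<Union>D2"
        then obtain V0 g where g: "V0 \<in> D" "g \<in> V0" "g \<in> E" "y \<in> V0" by (auto simp: D2_def)
        obtain z where z: "z \<in> B" "dist g z \<le> R" using Enear[OF g(3)] by blast
        have "dist y z \<le> r"
          using dist_triangle[of y z g] z(2) \<rho>(2)[OF V(1,2)[OF g(1)] g(4,2)] by (simp add: r_def)
        then show "y \<in> B \<union> N"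
          using segment_crosses_frontier(1)[OF z(1), of y] thicken_mono[of "dist y z" r "frontier B"]
          by (auto simp: N_def)
      qed
    qed (use sub[of D2] Bm in \<open>auto simp: D2_def\<close>)
    also have "vol (B \<union> N) \<le> vol B + vol N" using Bm by (intro measure_Un_le) auto
    finally have "real (card E) \<le> (m + e) * (vol B + vol N)"
      using upper m(2) e by (simp add: mult_left_mono)
    then have up: "real (card E) \<le> m * vol B + (e * vol B + (m + e) * vol N)" by (simp add: algebra_simps)
    define D1 where "D1 = {V \<in> D. V \<subseteq> B}"
    have D1: "D1 \<subseteq> D" by (auto simp: D1_def)
    have "vol B \<le> vol (\<Union>D1 \<union> N)"
    proof (rule measure_mono_fmeasurable)
      show "B \<subseteq> \<Union>D1 \<union> N"
      proof
        fix z assume z: "z \<in> B"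
        have "norm z \<le> b + R" using b[OF z] R(1) by simp
        then obtain V0 where V0: "V0 \<in> D" "z \<in> V0" using k(1) D(3) by (metis UnionE mem_cball_0 subsetD)
        show "z \<in> \<Union>D1 \<union> N"
        proof (cases "V0 \<subseteq> B")
          case True then show ?thesis using V0 by (auto simp: D1_def)
        next
          case False
          then obtain y where y: "y \<in> V0" "y \<notin> B" by blast
          have "dist y z \<le> r" using \<rho>(2)[OF V(1,2)[OF V0(1)] y(1) V0(2)] R(1) by (simp add: r_def)
          then show ?thesis
            using segment_crosses_frontier(2)[OF z y(2)] thicken_mono[of "dist y z" r "frontier B"]
            by (auto simp: N_def)
        qed
      qed
    qed (use sub(3)[OF D1] Bm in auto)
    also have "\<dots> \<le> vol (\<Union>D1) + vol N" using sub(3)[OF D1] Bm by (intro measure_Un_le) auto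
    finally have inner1: "vol B - vol N \<le> vol (\<Union>D1)" by simp
    have inner2: "vol (\<Union>D1) \<le> vol B"
      using sub(3)[OF D1] Bm by (intro measure_mono_fmeasurable) (auto simp: D1_def)
    have "(\<Union>V\<in>D1. positions V) \<subseteq> E"
    proof
      fix g assume "g \<in> (\<Union>V\<in>D1. positions V)"
      then obtain V0 \<alpha> where g: "V0 \<in> D" "V0 \<subseteq> B" "\<alpha> \<in> I" "\<alpha> > 0" "copy \<alpha> g ` P \<subseteq> cut 1 V0"
        by (auto simp: D1_def positions_def is_position_def)
      have "copy \<alpha> g (\<Union>P) \<subseteq> \<Union>(cut 1 V0)" using g(5) unfolding copy_Union by blast
      then have "copy \<alpha> g (\<Union>P) \<subseteq> B" using g(2) Union_cut[OF _ V(1)[OF g(1)], of 1] by auto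
      then show "g \<in> E" using g cutS[OF g(1)] unfolding E_def by blast
    qed
    then have "card (\<Union>V\<in>D1. positions V) \<le> card E" using upper by (intro card_mono) auto
    moreover have "card (\<Union>V\<in>D1. positions V) = (\<Sum>V\<in>D1. card (positions V))"
    proof (rule card_UN_disjoint)
      show "\<forall>V\<in>D1. \<forall>W\<in>D1. V \<noteq> W \<longrightarrow> positions V \<inter> positions W = {}"
        using D(2) D1 position_interior packing_eqI by blast
    qed (use sub(1)[OF D1] V(1) D1 num_positions_facts(1) in auto)
    ultimately have "(\<Sum>V\<in>D1. num_positions V) \<le> real (card E)"
      unfolding num_positions_def by (metis of_nat_mono of_nat_sum)
    moreover have "(\<Sum>V\<in>D1. (m - e / 2) * vol V) \<le> (\<Sum>V\<in>D1. num_positions V)"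
      using T1(1) V(1,3) D1 by (intro sum_mono) blast
    moreover have "(\<Sum>V\<in>D1. (m - e / 2) * vol V) = (m - e / 2) * vol (\<Union>D1)"
      using sub(2)[OF D1] by (simp add: sum_distrib_left)
    ultimately have "m * vol (\<Union>D1) - e / 2 * vol (\<Union>D1) \<le> real (card E)" by (simp add: algebra_simps)
    moreover have "m * (vol B - vol N) \<le> m * vol (\<Union>D1)" using inner1 m(2) by (rule mult_left_mono)
    moreover have "e / 2 * vol (\<Union>D1) \<le> e * vol B" using inner2 e by (intro mult_mono) auto
    moreover have "0 \<le> e * vol N" using e by simp
    ultimately have low: "m * vol B - (e * vol B + (m + e) * vol N) \<le> real (card E)" by (simp add: algebra_simps)
    show "\<bar>real (count_copies P I B S) - m * vol B\<bar> \<le> e * vol B + (m + e) * vol (thicken (frontier B) r)"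
      using up low by (simp add: count_copies_def flip: E_def N_def)
  qed
qed

lemma count_copies_uniform_limit:
  assumes S: "packing S" "S = (\<Union>k. cut 1 (X k))"
    and X: "\<And>k::nat. scaled (X k)" "\<And>k. vol (X k) \<ge> 1"
    and exhaust: "\<And>b L. \<exists>k. cball 0 b \<subseteq> X k \<and> vol (X k) \<ge> L"
    and i: "i \<in> types \<sigma>" and m: "liminf_density num_positions m" "m \<ge> 0" and A: "van_Hove A"
  shows "uniform_limit UNIV
    (\<lambda>q h. real (count_copies P I ((\<lambda>x. x + h) ` A q) S) / vol (A q)) (\<lambda>h. m) sequentially"
proof (rule uniform_limitI)
  fix \<epsilon> :: real assume \<epsilon>: "\<epsilon> > 0"
  define e where "e = \<epsilon> / 2"
  have e: "e > 0" using \<epsilon> by (simp add: e_def)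
  obtain r where r: "r > 0" and est: "\<And>B. bounded B \<Longrightarrow> B \<in> sets lebesgue \<Longrightarrow>
    \<bar>real (count_copies P I B S) - m * vol B\<bar> \<le> e * vol B + (m + e) * vol (thicken (frontier B) r)"
    using count_copies_estimate[OF S X exhaust i m e] by blast
  have "(\<lambda>q. vol (thicken (frontier (A q)) r) / vol (A q)) \<longlonglongrightarrow> 0"
    using A r by (simp add: van_Hove_def)
  then have "eventually (\<lambda>q. vol (thicken (frontier (A q)) r) / vol (A q) < e / (m + e)) sequentially"
    by (rule order_tendstoD(2)) (use e m(2) in \<open>simp add: add_nonneg_pos\<close>)
  then show "\<forall>\<^sub>F q in sequentially. \<forall>h\<in>UNIV.
      dist (real (count_copies P I ((\<lambda>x. x + h) ` A q) S) / vol (A q)) m < \<epsilon>"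
    using eventually_ge_at_top[of 1]
  proof eventually_elim
    case (elim q)
    have Aq: "bounded (A q)" "A q \<in> sets lebesgue" "vol (A q) > 0" using A elim(2) by (auto simp: van_Hove_def)
    show ?case
    proof
      fix h :: 'a
      define B where "B = copy 1 h (A q)"
      have B: "(\<lambda>x. x + h) ` A q = B" by (simp add: B_def copy_def add.commute)
      have volB: "vol B = vol (A q)" "vol (thicken (frontier B) r) = vol (thicken (frontier (A q)) r)"
        by (simp_all add: B_def vol_copy frontier_copy thicken_copy)
      have "bounded B" "B \<in> sets lebesgue" using Aq by (simp_all add: B_def bounded_copy lebesgue_sets_copy)
      from est[OF this] have "\<bar>real (count_copies P I B S) - m * vol (A q)\<bar>
          \<le> e * vol (A q) + (m + e) * vol (thicken (frontier (A q)) r)" by (simp add: volB)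
      moreover have "(m + e) * vol (thicken (frontier (A q)) r) < e * vol (A q)"
        using elim(1) Aq(3) e m(2) by (simp add: field_simps)
      ultimately have "\<bar>real (count_copies P I B S) - m * vol (A q)\<bar> < \<epsilon> * vol (A q)"
        by (simp add: e_def)
      moreover have "\<bar>real (count_copies P I B S) / vol (A q) - m\<bar>
          = \<bar>real (count_copies P I B S) - m * vol (A q)\<bar> / vol (A q)"
        using Aq(3) by (simp add: abs_if field_simps)
      ultimately show "dist (real (count_copies P I ((\<lambda>x. x + h) ` A q) S) / vol (A q)) m < \<epsilon>"
        using Aq(3) by (simp add: B dist_real_def pos_divide_less_eq)
    qed
  qed
qed

end

section \<open>Uniform patch frequencies\<close>

theorem theorem9p2:
  fixes \<sigma> :: "'a::euclidean_space scheme" and S P :: "'a set set" and I :: "real set"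
  assumes "multiscale_scheme \<sigma>" and "normalized \<sigma>"
    and "irreducible_scheme \<sigma>" and "incommensurable \<sigma>"
    and "stationary \<sigma> S"
    and "subpatch P S" and "P \<noteq> {}" and "finite P"
    and "is_interval I" and "bounded I" and "1 \<in> I" and "\<exists>\<epsilon>>0. {1 - \<epsilon><..<1} \<subseteq> I"
  shows "\<exists>freq::real. freq > 0 \<and>
    (\<forall>A :: nat \<Rightarrow> 'a set. van_Hove A \<longrightarrow>
       uniform_limit UNIV
         (\<lambda>q h. real (count_copies P I ((\<lambda>x. x + h) ` A q) S) / vol (A q))
         (\<lambda>h. freq) sequentially)"
proof -
  interpret normalized_scheme \<sigma> using assms(1,2) by unfold_locales
  have PS: "P \<subseteq> S" "\<And>V. V \<in> P \<Longrightarrow> tile V" "bounded (\<Union>P)"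
    using assms(6) by (auto simp: subpatch_def patch_def tessellation_def)
  obtain M where M: "\<And>\<alpha>. \<alpha> \<in> I \<Longrightarrow> \<bar>\<alpha>\<bar> \<le> M" using assms(10) by (auto simp: bounded_iff)
  obtain b where b: "\<And>x. x \<in> \<Union>P \<Longrightarrow> norm x \<le> b" using PS(3) unfolding bounded_iff by blast
  define R where "R = \<bar>M\<bar> * \<bar>b\<bar> + 1"
  interpret patch_in_scheme \<sigma> P I R
  proof
    show irreducible_graph using assms(3) by (rule irreducible_lengths)
    show "bdd_above I" using assms(10) by (rule bounded_imp_bdd_above)
    show "R > 0" by (simp add: R_def add_nonneg_pos)
    show "copy \<alpha> 0 (\<Union>P) \<subseteq> cball 0 R" if \<alpha>: "\<alpha> \<in> I" "\<alpha> > 0" for \<alpha>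
    proof
      fix z assume "z \<in> copy \<alpha> 0 (\<Union>P)"
      then obtain x where x: "x \<in> \<Union>P" "z = \<alpha> *\<^sub>R x" by (auto simp: copy_def)
      have "\<bar>\<alpha>\<bar> * norm x \<le> \<bar>M\<bar> * \<bar>b\<bar>" using M[OF \<alpha>(1)] b[OF x(1)] by (intro mult_mono) auto
      then show "z \<in> cball 0 R" by (simp add: x R_def)
    qed
  qed (use assms PS in auto)
  have tess: "tessellation UNIV S" using assms(5) by (simp add: stationary_def tiling_space_def tiling_def)
  then have S: "packing S" by (simp add: tessellation_iff)
  obtain i T a s where i: "i \<in> types \<sigma>" and T: "positioned \<sigma> i T" and as: "a \<ge> 0" "s > 0"
    and nested: "\<And>k::nat. flow \<sigma> (a + real k * s) T \<subseteq> flow \<sigma> (a + real (Suc k) * s) T"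
    and SU: "S = (\<Union>k::nat. flow \<sigma> (a + real k * s) T)"
    using assms(5) unfolding stationary_def by blast
  obtain x where x: "x \<in> interior (proto \<sigma> i)" "T = copy 1 (- x) (proto \<sigma> i)"
    using T by (auto simp: positioned_def)
  define c where "c k = exp (a + real k * s)" for k
  define X where "X k = copy (c k) (- (c k *\<^sub>R x)) (proto \<sigma> i)" for k
  have flow_X: "flow \<sigma> (a + real k * s) T = cut 1 (X k)" for k
    by (simp add: flow_eq x(2) X_def copy_copy c_def)
  have c1: "c k \<ge> 1" for k using as by (simp add: c_def)
  have cpos: "c k > 0" for k by (simp add: c_def)
  have sX: "scaled (X k)" for k unfolding X_def using i cpos by (rule scaled_copy_proto)
  have volX: "vol (X k) = c k ^ DIM('a)" for k unfolding X_def using i cpos by (rule vol_copy_proto)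
  have volX1: "vol (X k) \<ge> 1" for k using c1 by (simp add: volX one_le_power)
  obtain \<rho> where \<rho>: "\<rho> > 0" "cball x \<rho> \<subseteq> proto \<sigma> i"
    using x(1) mem_interior_cball by blast
  have ball: "cball 0 (c k * \<rho>) \<subseteq> X k" for k
  proof
    fix z :: 'a assume "z \<in> cball 0 (c k * \<rho>)"
    then have "norm ((1 / c k) *\<^sub>R z) \<le> \<rho>" using cpos[of k] by (simp add: field_simps)
    then have "x + (1 / c k) *\<^sub>R z \<in> proto \<sigma> i" using \<rho>(2) by (auto simp: dist_norm)
    moreover have "z = - (c k *\<^sub>R x) + c k *\<^sub>R (x + (1 / c k) *\<^sub>R z)"
      using cpos[of k] by (simp add: algebra_simps)
    ultimately show "z \<in> X k" unfolding X_def copy_def by (rule rev_image_eqI)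
  qed
  have large: "\<exists>k0. \<forall>k\<ge>k0. c k \<ge> L" for L
  proof -
    obtain k0 :: nat where k0: "L / s \<le> real k0" using real_arch_simple by blast
    have "L \<le> c k" if "k \<ge> k0" for k
    proof -
      have "L \<le> real k0 * s" using k0 as by (simp add: field_simps)
      also have "\<dots> \<le> real k * s" using that as by (intro mult_right_mono) auto
      also have "\<dots> \<le> c k" using exp_ge_add_one_self[of "a + real k * s"] as unfolding c_def by linarith
      finally show ?thesis .
    qed
    then show ?thesis by blast
  qed
  have exhaust: "\<exists>k0. \<forall>k\<ge>k0. cball 0 b' \<subseteq> X k \<and> vol (X k) \<ge> L" for b' L
  proof -
    obtain k0 where k0: "\<And>k. k \<ge> k0 \<Longrightarrow> c k \<ge> max (b' / \<rho>) L" using large by blast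
    have "cball 0 b' \<subseteq> X k \<and> vol (X k) \<ge> L" if k: "k \<ge> k0" for k
    proof
      have "b' / \<rho> \<le> c k" using k0[OF k] by simp
      then have "b' \<le> c k * \<rho>" using \<rho>(1) by (simp only: pos_divide_le_eq)
      then show "cball 0 b' \<subseteq> X k" using ball[of k] by (meson subset_cball order_trans)
      have "c k ^ 1 \<le> c k ^ DIM('a)" using c1 DIM_positive[where 'a='a] by (intro power_increasing) auto
      then show "vol (X k) \<ge> L" using k0[OF k] by (simp add: volX)
    qed
    then show ?thesis by blast
  qed
  have mono: "cut 1 (X j) \<subseteq> cut 1 (X k)" if "j \<le> k" for j k
    using lift_Suc_mono_le[of "\<lambda>k. cut 1 (X k)", OF _ that] nested unfolding flow_X by blast
  have SX: "S = (\<Union>k. cut 1 (X k))" using SU unfolding flow_X .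
  have "\<exists>k0. P \<subseteq> cut 1 (X k0)"
    using \<open>finite P\<close> PS(1)
  proof (induction P)
    case (insert V Q)
    then obtain k1 k2 where "Q \<subseteq> cut 1 (X k1)" "V \<in> cut 1 (X k2)" by (auto simp: SX)
    then have "insert V Q \<subseteq> cut 1 (X (max k1 k2))"
      using mono[of k1 "max k1 k2"] mono[of k2 "max k1 k2"] by auto
    then show ?case by blast
  qed simp
  then obtain k0 where k0: "P \<subseteq> cut 1 (X k0)" by blast
  obtain k1 where k1: "\<And>k. k \<ge> k1 \<Longrightarrow> cball 0 (2 * R) \<subseteq> X k" using exhaust by blast
  obtain k2 where k2: "\<And>k. k \<ge> k2 \<Longrightarrow> c k \<ge> 2" using large by blast
  define k where "k = max k0 (max k1 k2)"
  obtain \<epsilon> where \<epsilon>: "\<epsilon> > 0" "{1 - \<epsilon><..<1} \<subseteq> I" using assms(12) by blast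
  have "P \<subseteq> cut 1 (X k)" using k0 mono[of k0 k] by (auto simp: k_def)
  then have "copy 1 0 ` P \<subseteq> cut 1 (X k)" by auto
  then obtain T0 where T0: "\<And>Y. scaled Y \<Longrightarrow> vol Y \<ge> T0 \<Longrightarrow> num_positions Y \<ge> 1"
    using large_tiles_have_positions[OF i, of "c k" 0 "- (c k *\<^sub>R x)" \<epsilon>] k1[of k] k2[of k] \<epsilon>
    unfolding X_def k_def by auto
  obtain m where m: "liminf_density num_positions m" using num_positions_liminf[OF i] by blast
  have "m > 0" using liminf_positive[OF m T0] .
  moreover have "uniform_limit UNIV
      (\<lambda>q h. real (count_copies P I ((\<lambda>x. x + h) ` A q) S) / vol (A q)) (\<lambda>h. m) sequentially"
    if "van_Hove A" for A :: "nat \<Rightarrow> 'a set"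
    by (rule count_copies_uniform_limit[OF S SX sX volX1 _ i m _ that])
       (use exhaust \<open>m > 0\<close> in \<open>blast, simp\<close>)
  ultimately show ?thesis by blast
qed

end
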